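(* Let $d\ge1$, $\beta>1$ and $C>0$. There exists a potential $U(x,t)$, defined for all $x\in\mathbf{R}^d$ and all $t<0$, such that $U(\cdot,t)$ is $C^1$ for every $t<0$, $$0\le U(x,t)\le C,\qquad |\nabla U(x,t)|\le C\qquad\text{for all }x\in\mathbf{R}^d,\ t<0,$$ and for every $x\in\mathbf{R}^d$ (and any choice of the minimizers $\gamma^x_{t,0}$, $t<0$) $$\limsup_{t\to-\infty}|\dot\gamma^x_{t,0}(0)|=\infty .$$ Moreover, the potential $U(x,t)$ may be chosen continuous in $t$.
   Context: $\nabla$ denotes the gradient with respect to $x\in\mathbf{R}^d$; potentials $U$ are assumed measurable in $(x,t)$ so that the action is defined. For $t_1<t_2\le 0$ and an absolutely continuous curve $\gamma:[t_1,t_2]\to\mathbf{R}^d$, the action is $$A_{t_1,t_2}[\gamma]=\int_{t_1}^{t_2}\Bigl(\tfrac1\beta|\dot\gamma(s)|^\beta-U(\gamma(s),s)\Bigr)ds .$$ For $x\in\mathbf{R}^d$, $\gamma^x_{t_1,t_2}:[t_1,t_2]\to\mathbf{R}^d$ denotes a (not necessarily unique) minimizer of $A_{t_1,t_2}$ among all absolutely continuous curves $\gamma$ on $[t_1,t_2]$ with $\gamma(t_2)=x$ (the initial point $\gamma(t_1)$ being free). Such minimizers are $C^1$ curves up to the endpoints, satisfying the Euler--Lagrange equation $\frac{d}{dt}(\dot\gamma|\dot\gamma|^{\beta-2})=-\nabla U(\gamma(t),t)$ (in integrated form if $U$ is merely measurable in $t$) and $\dot\gamma^x_{t_1,t_2}(t_1)=0$.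 *)

theory Defs
  imports "HOL-Analysis.Analysis"
begin

text \<open>Absolute continuity of a curve on a compact interval, in the epsilon-delta sense. (The library
  constant \<^const>\<open>absolutely_continuous\<close> is the unrelated notion for measures.)\<close>

definition abs_continuous_on :: "real \<Rightarrow> real \<Rightarrow> (real \<Rightarrow> 'a::real_normed_vector) \<Rightarrow> bool" where
  "abs_continuous_on a b f \<longleftrightarrow>
     (\<forall>\<epsilon>>0. \<exists>\<delta>>0. \<forall>(n::nat) u v.
        (\<forall>i<n. a \<le> u i \<and> u i \<le> v i \<and> v i \<le> b) \<longrightarrow>
        disjoint_family_on (\<lambda>i. {u i<..<v i}) {..<n} \<longrightarrow>
        (\<Sum>i<n. v i - u i) < \<delta> \<longrightarrow>
        (\<Sum>i<n. norm (f (v i) - f (u i))) < \<epsilon>)"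

text \<open>Derivatives are taken within the interval, so the values of a curve outside it are irrelevant
  and the derivative at an endpoint is the one-sided one.\<close>

definition velocity :: "real \<Rightarrow> real \<Rightarrow> (real \<Rightarrow> 'a::real_normed_vector) \<Rightarrow> real \<Rightarrow> 'a" where
  "velocity t1 t2 \<gamma> s = vector_derivative \<gamma> (at s within {t1..t2})"

definition lagrangian ::
  "real \<Rightarrow> ('a::real_normed_vector \<Rightarrow> real \<Rightarrow> real) \<Rightarrow> real \<Rightarrow> real \<Rightarrow> (real \<Rightarrow> 'a) \<Rightarrow> real \<Rightarrow> real" where
  "lagrangian \<beta> U t1 t2 \<gamma> s = 1 / \<beta> * norm (velocity t1 t2 \<gamma> s) powr \<beta> - U (\<gamma> s) s"

text \<open>The action is the extended-real Lebesgue integral: positive part minus negative part, where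
  \<^const>\<open>ennreal\<close> truncates negative reals to \<open>0\<close>. For a bounded potential the negative part is finite
  and the action is \<open>\<infinity>\<close> exactly when \<open>|\<gamma>'|\<close> to the power \<open>\<beta>\<close> is not integrable. A Bochner integral
  would wrongly give such curves the action \<open>0\<close>.\<close>

definition action ::
  "real \<Rightarrow> ('a::real_normed_vector \<Rightarrow> real \<Rightarrow> real) \<Rightarrow> real \<Rightarrow> real \<Rightarrow> (real \<Rightarrow> 'a) \<Rightarrow> ereal" where
  "action \<beta> U t1 t2 \<gamma> =
     enn2ereal (\<integral>\<^sup>+s\<in>{t1..t2}. ennreal (lagrangian \<beta> U t1 t2 \<gamma> s) \<partial>lebesgue) -
     enn2ereal (\<integral>\<^sup>+s\<in>{t1..t2}. ennreal (- lagrangian \<beta> U t1 t2 \<gamma> s) \<partial>lebesgue)"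

definition is_minimizer ::
  "real \<Rightarrow> ('a::real_normed_vector \<Rightarrow> real \<Rightarrow> real) \<Rightarrow> real \<Rightarrow> real \<Rightarrow> 'a \<Rightarrow> (real \<Rightarrow> 'a) \<Rightarrow> bool" where
  "is_minimizer \<beta> U t1 t2 x \<gamma> \<longleftrightarrow>
     abs_continuous_on t1 t2 \<gamma> \<and> \<gamma> t2 = x \<and>
     (\<forall>\<eta>. abs_continuous_on t1 t2 \<eta> \<and> \<eta> t2 = x \<longrightarrow> action \<beta> U t1 t2 \<gamma> \<le> action \<beta> U t1 t2 \<eta>)"

end

theory Submission
  imports Defs
begin

text \<open>Write \<open>p = u^(\<beta>-1)\<close> and \<open>E = (1 - 1/\<beta>) u^\<beta>\<close> for the momentum and the kinetic energy of a
  particle of speed \<open>u\<close>. If the value function has slope \<open>p\<close> on a long interval, a potential that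
  equals \<open>C/2\<close> to the left of a point and \<open>0\<close> to the right of it, kept on for a long time, creates
  a long interval on which the slope is the momentum at energy \<open>E + C/2\<close>. The transition costs an
  additive error bounded by the increment of the momentum, so after any number of such layers the
  error is at most \<open>p\<close>. Since \<open>E\<close> is superlinear in \<open>p\<close>, for large \<open>u\<close> this error, and the effect of any
  bounded potential acting during a given later time interval, are negligible against \<open>E\<close>:
  minimizers starting before the layers must come from far away. Infinitely many blocks of layers,
  each much faster than the time elapsed after it, give the potential. It vanishes on \<open>[-1, 0]\<close>,
  where minimizers are therefore straight, so their final velocity is their displacement.
  That the action controls displacements at all rests on the fundamental theorem of calculus for
  absolutely continuous curves; differentiability almost everywhere is proved by Austin's argument.\<close>

section \<open>Absolutely continuous functions\<close>

text \<open>The value function f in dimension one satisfies f_t + H(f_x) = -U, with H(p) = E. With c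
  = C/2 the potential on the left, p x - (E + c) t solves this on the left and q x - E' t on the
  right, where U = 0. The branches decrease at the same rate exactly when E' = E + c; this
  determines the next momentum q. On the right the old branch p x - E t decreases more slowly by c
  per unit of time, so after a time of order (q - p) R / c it lies above the new one on [-R, R];
  hence the long duration. The height is C/2 because the C^1 step in use has slope up to 2. After a
  block of speed u, straight motion during the remaining time T reaches x with action about p x - E
  T. A curve moving by less than M in the last unit of time gives up about E, in exchange for at
  most p M and what the potential returns, at most C T. As E = (1 - 1/\<beta>) u p, a large u
  excludes this. Upper bounds come from piecewise linear curves, lower bounds from integrating
  Young's inequality. Only curves that start with a block are controlled, which is why the
  conclusion is a limsup.\<close>

definition superadditive_on :: "real \<Rightarrow> real \<Rightarrow> (real \<Rightarrow> real \<Rightarrow> real) \<Rightarrow> bool" where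
  "superadditive_on a b g \<longleftrightarrow>
     (\<forall>u v. a \<le> u \<and> u \<le> v \<and> v \<le> b \<longrightarrow> 0 \<le> g u v) \<and>
     (\<forall>u v w. a \<le> u \<and> u \<le> v \<and> v \<le> w \<and> w \<le> b \<longrightarrow> g u v + g v w \<le> g u w)"

lemma superadditive_on_subset:
  "superadditive_on a b g \<Longrightarrow> a \<le> a' \<Longrightarrow> b' \<le> b \<Longrightarrow> superadditive_on a' b' g"
  unfolding superadditive_on_def by (meson order_trans)

text \<open>Induction on the number of intervals: the one with the largest left endpoint
  \<open>l\<close> is split off. By disjointness all others end before \<open>l\<close>, so the
  induction hypothesis applies to them on \<open>[a, l]\<close>.\<close>

lemma superadditive_sum_disjoint:
  assumes "superadditive_on a b g" "finite F" "a \<le> b"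
    and "\<And>l r. (l, r) \<in> F \<Longrightarrow> a \<le> l \<and> l < r \<and> r \<le> b"
    and "pairwise (\<lambda>i j. disjnt {fst i..snd i} {fst j..snd j}) F"
  shows "(\<Sum>(l, r)\<in>F. g l r) \<le> g a b"
  using assms
proof (induction "card F" arbitrary: F b)
  case 0
  then show ?case by (auto simp: superadditive_on_def)
next
  case (Suc n)
  then have ne: "F \<noteq> {}" by auto
  then have "fst ` F \<noteq> {}" "finite (fst ` F)" using Suc.prems by auto
  then have "Max (fst ` F) \<in> fst ` F" by (rule Max_in[rotated])
  then obtain l r where lr: "(l, r) \<in> F" "l = Max (fst ` F)" by auto
  have lmax: "l' \<le> l" if "(l', r') \<in> F" for l' r'
    using that lr(2) Suc.prems(2) by (metis Max_ge finite_imageI fst_conv imageI)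
  let ?G = "F - {(l, r)}"
  have b: "a \<le> l" "l < r" "r \<le> b" using Suc.prems(4)[OF lr(1)] by auto
  have "(\<Sum>(l, r)\<in>?G. g l r) \<le> g a l"
  proof (rule Suc.hyps(1))
    show "n = card ?G" using Suc.hyps(2) lr(1) Suc.prems(2) by simp
    show "superadditive_on a l g"
      using superadditive_on_subset[OF Suc.prems(1)] b by simp
    show "finite ?G" using Suc.prems by auto
    show "a \<le> l" using b by simp
    show "a \<le> l' \<and> l' < r' \<and> r' \<le> l" if "(l', r') \<in> ?G" for l' r'
    proof -
      have "disjnt {l'..r'} {l..r}"
        using Suc.prems(5) that lr(1) by (force simp: pairwise_def)
      moreover have "l' \<le> l" "a \<le> l'" "l' < r'" using lmax that Suc.prems(4) by auto
      ultimately have "\<not> l \<le> r'"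
        using b by (auto simp: disjnt_iff)
      then show ?thesis using \<open>a \<le> l'\<close> \<open>l' < r'\<close> by auto
    qed
    show "pairwise (\<lambda>i j. disjnt {fst i..snd i} {fst j..snd j}) ?G"
      using Suc.prems(5) by (auto simp: pairwise_def)
  qed
  moreover have "(\<Sum>(l, r)\<in>F. g l r) = g l r + (\<Sum>(l, r)\<in>?G. g l r)"
    using lr(1) Suc.prems(2) by (subst sum.remove[of _ "(l, r)"]) auto
  moreover have "g a l + g l r \<le> g a r" "g a r + g r b \<le> g a b" "0 \<le> g r b"
    using Suc.prems(1) b by (auto simp: superadditive_on_def)
  ultimately show ?case by linarith
qed

section \<open>Total variation of a real function\<close>

text \<open>Partitions are weakly monotone sequences: repeated points contribute 0, so clipping a
  partition with \<open>min\<close> or \<open>max\<close> again gives a partition, and an interval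
  may be a single point.\<close>

definition var_sums :: "(real \<Rightarrow> real) \<Rightarrow> real \<Rightarrow> real \<Rightarrow> real set" where
  "var_sums f u v =
     {(\<Sum>i<n. \<bar>f (x (Suc i)) - f (x i)\<bar>) | x (n :: nat). mono x \<and> x 0 = u \<and> x n = v}"

text \<open>A real supremum, informative only when \<open>var_sums\<close> is bounded above; the
  lemmas on it therefore carry a \<open>bdd_above\<close> assumption.\<close>

definition total_var :: "(real \<Rightarrow> real) \<Rightarrow> real \<Rightarrow> real \<Rightarrow> real" where
  "total_var f u v = Sup (var_sums f u v)"

lemma var_sumsI:
  assumes "mono x" "x 0 = u" "x n = v"
  shows "(\<Sum>i<n. \<bar>f (x (Suc i)) - f (x i)\<bar>) \<in> var_sums f u v"
  using assms unfolding var_sums_def by blast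

lemma abs_diff_in_var_sums:
  assumes "u \<le> v" shows "\<bar>f v - f u\<bar> \<in> var_sums f u v"
proof -
  have "mono (\<lambda>i::nat. if i = 0 then u else v)"
    using assms by (auto intro!: monoI)
  from var_sumsI[OF this, of u "Suc 0" v f] show ?thesis by simp
qed

lemma var_sums_concat:
  assumes "p \<in> var_sums f u v" "q \<in> var_sums f v w"
  shows "p + q \<in> var_sums f u w"
proof -
  obtain x n where x: "p = (\<Sum>i<n. \<bar>f (x (Suc i)) - f (x i)\<bar>)" "mono x" "x 0 = u" "x n = v"
    using assms(1) unfolding var_sums_def by blast
  obtain y m where y: "q = (\<Sum>i<m. \<bar>f (y (Suc i)) - f (y i)\<bar>)" "mono y" "y 0 = v" "y m = w"
    using assms(2) unfolding var_sums_def by blast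
  let ?z = "\<lambda>i. if i \<le> n then x i else y (i - n)"
  have "mono ?z"
  proof (rule monoI)
    fix i j :: nat assume "i \<le> j"
    moreover have "x i \<le> y (j - n)" if "i \<le> n"
      using monoD[OF x(2) that] monoD[OF y(2), of 0 "j - n"] x y by simp
    ultimately show "?z i \<le> ?z j"
      using monoD[OF x(2)] monoD[OF y(2)] by auto
  qed
  moreover have "?z 0 = u" "?z (n + m) = w" using x y by auto
  moreover have "(\<Sum>i<n + m. \<bar>f (?z (Suc i)) - f (?z i)\<bar>) = p + q"
  proof -
    have "(\<Sum>i<n + m. \<bar>f (?z (Suc i)) - f (?z i)\<bar>)
        = (\<Sum>i<n. \<bar>f (?z (Suc i)) - f (?z i)\<bar>) + (\<Sum>i<m. \<bar>f (?z (Suc (n + i))) - f (?z (n + i))\<bar>)"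
      by (induction m) auto
    also have "(\<Sum>i<n. \<bar>f (?z (Suc i)) - f (?z i)\<bar>) = p"
      unfolding x by (intro sum.cong) auto
    also have "(\<Sum>i<m. \<bar>f (?z (Suc (n + i))) - f (?z (n + i))\<bar>) = q"
      unfolding y(1) by (intro sum.cong refl) (use x y in \<open>auto simp: Suc_diff_le\<close>)
    finally show ?thesis .
  qed
  ultimately show ?thesis using var_sumsI[of ?z u "n + m" w f] by simp
qed

text \<open>A partition of the large interval need not contain \<open>v\<close>. Clipping it with
  \<open>min _ v\<close> and \<open>max _ v\<close> yields partitions of the two halves whose
  increments dominate the original ones by the triangle inequality.\<close>

lemma bdd_above_var_sums_concat:
  assumes "bdd_above (var_sums f u v)" "bdd_above (var_sums f v w)" "u \<le> v" "v \<le> w"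
  shows "bdd_above (var_sums f u w)"
proof -
  obtain A B where A: "\<And>p. p \<in> var_sums f u v \<Longrightarrow> p \<le> A" and B: "\<And>p. p \<in> var_sums f v w \<Longrightarrow> p \<le> B"
    using assms by (auto simp: bdd_above_def)
  have "p \<le> A + B" if p: "p \<in> var_sums f u w" for p
  proof -
    obtain x n where x: "p = (\<Sum>i<n. \<bar>f (x (Suc i)) - f (x i)\<bar>)" "mono x" "x 0 = u" "x n = w"
      using p unfolding var_sums_def by blast
    have "p \<le> (\<Sum>i<n. \<bar>f (min (x (Suc i)) v) - f (min (x i) v)\<bar> + \<bar>f (max (x (Suc i)) v) - f (max (x i) v)\<bar>)"
      unfolding x(1)
    proof (rule sum_mono)
      fix i show "\<bar>f (x (Suc i)) - f (x i)\<bar> \<le>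
        \<bar>f (min (x (Suc i)) v) - f (min (x i) v)\<bar> + \<bar>f (max (x (Suc i)) v) - f (max (x i) v)\<bar>"
        using monoD[OF x(2), of i "Suc i"] by (auto simp: min_def max_def)
    qed
    also have "\<dots> \<le> A + B"
      unfolding sum.distrib
    proof (rule add_mono)
      have "mono (\<lambda>i. min (x i) v)" "mono (\<lambda>i. max (x i) v)"
        using x(2) by (auto simp: mono_def min_def max_def intro: order_trans)
      moreover have "min (x 0) v = u" "min (x n) v = v" "max (x 0) v = v" "max (x n) v = w"
        using x assms(3,4) by auto
      ultimately show "(\<Sum>i<n. \<bar>f (min (x (Suc i)) v) - f (min (x i) v)\<bar>) \<le> A"
        "(\<Sum>i<n. \<bar>f (max (x (Suc i)) v) - f (max (x i) v)\<bar>) \<le> B"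
        by (intro A B var_sumsI[where x = "\<lambda>i. min (x i) v"] var_sumsI[where x = "\<lambda>i. max (x i) v"]; simp)+
    qed
    finally show ?thesis .
  qed
  then show ?thesis by (auto simp: bdd_above_def)
qed

lemma bdd_above_var_sums_subset:
  assumes "bdd_above (var_sums f a b)" "a \<le> u" "u \<le> v" "v \<le> b"
  shows "bdd_above (var_sums f u v)"
proof -
  obtain A where A: "\<And>p. p \<in> var_sums f a b \<Longrightarrow> p \<le> A"
    using assms by (auto simp: bdd_above_def)
  have "p \<le> A" if "p \<in> var_sums f u v" for p
  proof -
    have "\<bar>f u - f a\<bar> + p + \<bar>f b - f v\<bar> \<in> var_sums f a b"
      using assms that abs_diff_in_var_sums var_sums_concat by meson
    from A[OF this] show ?thesis by linarith
  qed
  then show ?thesis by (auto simp: bdd_above_def)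
qed

lemma abs_diff_le_total_var:
  assumes "bdd_above (var_sums f a b)" "a \<le> u" "u \<le> v" "v \<le> b"
  shows "\<bar>f v - f u\<bar> \<le> total_var f u v"
  unfolding total_var_def
  by (intro cSup_upper abs_diff_in_var_sums bdd_above_var_sums_subset[OF assms(1)] assms)

lemma total_var_add_le:
  assumes "bdd_above (var_sums f a b)" "a \<le> u" "u \<le> v" "v \<le> w" "w \<le> b"
  shows "total_var f u v + total_var f v w \<le> total_var f u w"
proof -
  have bdd: "bdd_above (var_sums f u w)"
    using assms by (intro bdd_above_var_sums_subset[OF assms(1)]) auto
  have ne: "var_sums f u v \<noteq> {}" "var_sums f v w \<noteq> {}"
    using abs_diff_in_var_sums assms by blast+
  have "p \<le> total_var f u w - total_var f v w" if p: "p \<in> var_sums f u v" for p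
  proof -
    have "q \<le> total_var f u w - p" if q: "q \<in> var_sums f v w" for q
      using cSup_upper[OF var_sums_concat[OF p q] bdd] unfolding total_var_def by linarith
    then have "total_var f v w \<le> total_var f u w - p"
      unfolding total_var_def[of f v w] by (intro cSup_least ne)
    then show ?thesis by linarith
  qed
  then have "total_var f u v \<le> total_var f u w - total_var f v w"
    unfolding total_var_def[of f u v] by (intro cSup_least ne)
  then show ?thesis by linarith
qed

text \<open>The last two interval functions are twice the negative and twice the positive variation.
  They measure what an interval with slope of the wrong sign adds to the variation.\<close>

lemma superadditive_total_var:
  assumes "bdd_above (var_sums f a b)"
  shows "superadditive_on a b (total_var f)"
    "superadditive_on a b (\<lambda>u v. total_var f u v - (f v - f u))"
    "superadditive_on a b (\<lambda>u v. total_var f u v + (f v - f u))"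
proof -
  note 1 = abs_diff_le_total_var[OF assms] and 2 = total_var_add_le[OF assms]
  show "superadditive_on a b (total_var f)"
    "superadditive_on a b (\<lambda>u v. total_var f u v - (f v - f u))"
    "superadditive_on a b (\<lambda>u v. total_var f u v + (f v - f u))"
    unfolding superadditive_on_def using order_trans[OF abs_ge_zero 1] order_trans[OF abs_ge_self 1]
      order_trans[OF abs_ge_minus_self 1] 2
    by (auto simp: algebra_simps)
qed

text \<open>Absolute continuity with \<epsilon> = 1 bounds the variation by 1 on every interval
  shorter than the corresponding \<delta>; the bisection principle \<open>Bolzano\<close> patches
  these together.\<close>

lemma abs_continuous_on_bdd_var:
  fixes f :: "real \<Rightarrow> real"
  assumes "abs_continuous_on a b f" "a \<le> b"
  shows "bdd_above (var_sums f a b)"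
proof -
  obtain \<delta> where \<delta>: "\<delta> > 0" "\<And>(n::nat) u v. (\<forall>i<n. a \<le> u i \<and> u i \<le> v i \<and> v i \<le> b) \<Longrightarrow>
        disjoint_family_on (\<lambda>i. {u i<..<v i}) {..<n} \<Longrightarrow>
        (\<Sum>i<n. v i - u i) < \<delta> \<Longrightarrow> (\<Sum>i<n. norm (f (v i) - f (u i))) < 1"
    using assms(1)[unfolded abs_continuous_on_def, rule_format, OF zero_less_one] by blast
  have loc: "bdd_above (var_sums f u v)" if uv: "a \<le> u" "v \<le> b" "v - u < \<delta>" for u v
  proof -
    have "p \<le> 1" if p: "p \<in> var_sums f u v" for p
    proof -
      obtain x n where x: "p = (\<Sum>i<n. \<bar>f (x (Suc i)) - f (x i)\<bar>)" "mono x" "x 0 = u" "x n = v"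
        using p unfolding var_sums_def by blast
      have "disjoint_family_on (\<lambda>i. {x i<..<x (Suc i)}) {..<n}"
        unfolding disjoint_family_on_def
      proof (intro ballI impI)
        fix i j :: nat assume "i \<noteq> j"
        then have "Suc i \<le> j \<or> Suc j \<le> i" by auto
        then have "x (Suc i) \<le> x j \<or> x (Suc j) \<le> x i" using x(2) by (auto dest: monoD)
        then show "{x i<..<x (Suc i)} \<inter> {x j<..<x (Suc j)} = {}" by auto
      qed
      moreover have "\<forall>i<n. a \<le> x i \<and> x i \<le> x (Suc i) \<and> x (Suc i) \<le> b"
      proof (intro allI impI)
        fix i assume "i < n"
        then have "x 0 \<le> x i" "x i \<le> x (Suc i)" "x (Suc i) \<le> x n" using monoD[OF x(2)] by auto
        then show "a \<le> x i \<and> x i \<le> x (Suc i) \<and> x (Suc i) \<le> b" using x(3,4) uv by auto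
      qed
      moreover have "(\<Sum>i<n. x (Suc i) - x i) < \<delta>"
        using uv x by (simp add: sum_lessThan_telescope)
      ultimately have "p < 1" using \<delta>(2)[of n x "\<lambda>i. x (Suc i)"] by (simp add: x(1))
      then show ?thesis by simp
    qed
    then show ?thesis by (auto simp: bdd_above_def)
  qed
  have "a \<le> a \<and> b \<le> b \<longrightarrow> bdd_above (var_sums f a b)"
  proof (rule Bolzano[where P = "\<lambda>u v. a \<le> u \<and> v \<le> b \<longrightarrow> bdd_above (var_sums f u v)"])
    show "a \<le> b" by fact
  next
    fix u v w assume "a \<le> u \<and> v \<le> b \<longrightarrow> bdd_above (var_sums f u v)"
      "a \<le> v \<and> w \<le> b \<longrightarrow> bdd_above (var_sums f v w)" "u \<le> v" "v \<le> w"
    then show "a \<le> u \<and> w \<le> b \<longrightarrow> bdd_above (var_sums f u w)"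
      using bdd_above_var_sums_concat[of f u v w] by auto
  next
    fix x show "\<exists>d>0. \<forall>u v. u \<le> x \<and> x \<le> v \<and> v - u < d \<longrightarrow> a \<le> u \<and> v \<le> b \<longrightarrow> bdd_above (var_sums f u v)"
    proof (intro exI[of _ \<delta>] conjI allI impI)
      fix u v assume "u \<le> x \<and> x \<le> v \<and> v - u < \<delta>" "a \<le> u \<and> v \<le> b"
      then show "bdd_above (var_sums f u v)" using loc by simp
    qed (fact \<delta>(1))
  qed
  then show ?thesis by simp
qed

section \<open>Differentiability almost everywhere of functions of bounded variation\<close>

text \<open>The quantifier order is the point: \<kappa> depends on \<open>E\<close> alone, so it can
  be fixed before the partition that determines \<open>Q\<close> and the discarded set
  \<open>P\<close>. No measurability of \<open>E\<close> is assumed; \<kappa> is a fifth of a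
  positive lower bound for the measure of its measurable supersets. The clause
  \<open>v \<le> u + 1\<close> keeps the radii bounded, as Vitali's lemma requires.\<close>

lemma Vitali_finite_intervals:
  fixes E :: "real set"
  assumes "\<not> negligible E"
  shows "\<exists>\<kappa>>0. \<forall>Q P. negligible P \<longrightarrow>
       (\<forall>x\<in>E - P. \<exists>u v. Q u v \<and> u < v \<and> v \<le> u + 1 \<and> u \<le> x \<and> x \<le> v) \<longrightarrow>
       (\<exists>F. finite F \<and> (\<forall>(u, v)\<in>F. u < v \<and> Q u v) \<and>
           pairwise (\<lambda>i j. disjnt {fst i..snd i} {fst j..snd j}) F \<and> \<kappa> < (\<Sum>(u, v)\<in>F. v - u))"
proof -
  obtain e where e: "e > 0" "\<And>T. E \<subseteq> T \<Longrightarrow> T \<in> lmeasurable \<Longrightarrow> e < measure lebesgue T"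
    using assms unfolding negligible_outer_le by (meson not_le)
  have "\<exists>F. finite F \<and> (\<forall>(u, v)\<in>F. u < v \<and> Q u v) \<and>
           pairwise (\<lambda>i j. disjnt {fst i..snd i} {fst j..snd j}) F \<and> e / 5 < (\<Sum>(u, v)\<in>F. v - u)"
    if P: "negligible P" and Q: "\<forall>x\<in>E - P. \<exists>u v. Q u v \<and> u < v \<and> v \<le> u + 1 \<and> u \<le> x \<and> x \<le> v" for Q P
  proof -
    define K where "K = {(u, v). Q u v \<and> u < v \<and> v \<le> u + (1::real)}"
    define m where "m = (\<lambda>i::real\<times>real. (fst i + snd i) / 2)"
    define r where "r = (\<lambda>i::real\<times>real. (snd i - fst i) / 2)"
    have cb: "cball (m i) (r i) = {fst i..snd i}" for i
      by (auto simp: m_def r_def cball_eq_atLeastAtMost field_simps)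
    have "E - P \<subseteq> (\<Union>i\<in>K. cball (m i) (r i))"
      using Q unfolding K_def cb by force
    moreover have "\<And>i. i \<in> K \<Longrightarrow> 0 < r i \<and> r i \<le> 1" by (auto simp: K_def r_def)
    ultimately obtain D where D: "countable D" "D \<subseteq> K"
        "pairwise (\<lambda>i j. disjnt (cball (m i) (r i)) (cball (m j) (r j))) D"
        "E - P \<subseteq> (\<Union>i\<in>D. cball (m i) (5 * r i))"
      by (rule Vitali_covering_lemma_cballs[where a = m and r = r and S = "E - P" and K = K and B = 1]) blast
    \<comment> \<open>If every finite subfamily had total length at most \<open>e / 5\<close>, the
      balls enlarged fivefold would cover \<open>E - P\<close> with measure at most
      \<open>e\<close>, against the choice of \<open>e\<close>.\<close>
    have "\<exists>F. F \<subseteq> D \<and> finite F \<and> e / 5 < (\<Sum>(u, v)\<in>F. v - u)"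
    proof (rule ccontr)
      assume "\<not> ?thesis"
      then have *: "(\<Sum>i\<in>F. snd i - fst i) \<le> e / 5" if "F \<subseteq> D" "finite F" for F
        using that by (auto simp: case_prod_unfold not_less)
      let ?T = "\<Union>i\<in>D. cball (m i) (5 * r i)"
      have meas: "measure lebesgue (cball (m i) (5 * r i)) = 5 * (snd i - fst i)" if "i \<in> D" for i
        using that D(2) by (auto simp: cball_eq_atLeastAtMost K_def r_def field_simps)
      have bd: "(\<Sum>i\<in>F. measure lebesgue (cball (m i) (5 * r i))) \<le> e" if "F \<subseteq> D" "finite F" for F
      proof -
        have "(\<Sum>i\<in>F. measure lebesgue (cball (m i) (5 * r i))) = 5 * (\<Sum>i\<in>F. snd i - fst i)"
          unfolding sum_distrib_left using that meas by (intro sum.cong) auto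
        with *[OF that] show ?thesis by linarith
      qed
      have bd': "measure lebesgue (\<Union>i\<in>F. cball (m i) (5 * r i)) \<le> e" if "F \<subseteq> D" "finite F" for F
        using measure_UNION_le[OF that(2), of "\<lambda>i. cball (m i) (5 * r i)" lebesgue] bd[OF that] by simp
      have T: "?T \<in> lmeasurable" "measure lebesgue ?T \<le> e"
        using fmeasurable_UN_bound[OF D(1) _ bd'] measure_UN_bound[OF D(1) _ bd'] by auto
      have "?T \<union> P \<in> lmeasurable" using T P negligible_imp_measurable by blast
      moreover have "E \<subseteq> ?T \<union> P" using D(4) by blast
      ultimately have "e < measure lebesgue (?T \<union> P)" using e by blast
      also have "\<dots> \<le> measure lebesgue ?T + measure lebesgue P"
        using T P negligible_imp_measurable by (intro measure_Un_le) (auto simp: fmeasurableD)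
      also have "measure lebesgue P = 0" using P by (simp add: negligible_imp_measure0)
      finally show False using T by simp
    qed
    then obtain F where F: "F \<subseteq> D" "finite F" "e / 5 < (\<Sum>(u, v)\<in>F. v - u)" by blast
    have "pairwise (\<lambda>i j. disjnt {fst i..snd i} {fst j..snd j}) F"
      using pairwise_subset[OF D(3) F(1)] by (simp add: cb)
    moreover have "\<forall>(u, v)\<in>F. u < v \<and> Q u v" using F(1) D(2) by (auto simp: K_def)
    ultimately show ?thesis using F by blast
  qed
  with e(1) show ?thesis by (intro exI[of _ "e / 5"] conjI allI impI) simp_all
qed

lemma chain_sum_le_superadditive:
  assumes "superadditive_on a b g" "mono (x :: nat \<Rightarrow> real)" "a \<le> x 0" "x n \<le> b"
  shows "(\<Sum>i<n. g (x i) (x (Suc i))) \<le> g (x 0) (x n)"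
  using assms(4)
proof (induction n)
  case 0
  then show ?case using assms by (auto simp: superadditive_on_def)
next
  case (Suc n)
  have m: "x 0 \<le> x n" "x n \<le> x (Suc n)" using monoD[OF assms(2), of 0 n] monoD[OF assms(2), of n "Suc n"] by auto
  then have "(\<Sum>i<n. g (x i) (x (Suc i))) \<le> g (x 0) (x n)" using Suc by simp
  moreover have "g (x 0) (x n) + g (x n) (x (Suc n)) \<le> g (x 0) (x (Suc n))"
    using assms(1,3) Suc.prems m unfolding superadditive_on_def by blast
  ultimately show ?case by simp
qed

lemma mono_chain_cell:
  assumes "mono (x :: nat \<Rightarrow> real)" "x 0 \<le> z" "z \<le> x n" "z \<notin> x ` {..n}"
  obtains i where "i < n" "x i < z" "z < x (Suc i)"
proof -
  have "\<exists>i<n. x i < z \<and> z < x (Suc i)"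
    using assms(3,4)
  proof (induction n)
    case 0
    then show ?case using assms(2) by auto
  next
    case (Suc n)
    have "z \<noteq> x n" "z \<noteq> x (Suc n)" using Suc.prems by auto
    then consider "z \<le> x n" | "x n < z" "z < x (Suc n)" using Suc.prems by linarith
    then show ?case
    proof cases
      case 1
      moreover have "z \<notin> x ` {..n}" using Suc.prems(2) by auto
      ultimately show ?thesis using Suc.IH less_SucI by blast
    qed auto
  qed
  then show ?thesis using that by blast
qed

text \<open>A difference quotient is symmetric in its two points, so a nearby \<open>y\<close> on
  either side of \<open>x\<close> gives an interval having \<open>x\<close> as an endpoint. The
  predicate \<open>P\<close> allows for upper, lower and absolute slope bounds at once.\<close>

lemma slope_interval:
  fixes f :: "real \<Rightarrow> real"
  assumes "\<exists>\<^sub>F y in at x. P ((f y - f x) / (y - x))" "l < x" "x < r"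
  obtains u v where "l < u" "u < v" "v < r" "v \<le> u + 1" "u \<le> x" "x \<le> v" "P ((f v - f u) / (v - u))"
proof -
  let ?d = "min 1 (min (x - l) (r - x))"
  have "\<exists>y. y \<noteq> x \<and> dist y x < ?d \<and> P ((f y - f x) / (y - x))"
    using assms(1)[unfolded frequently_def eventually_at] assms(2,3)
    by (auto simp del: min_less_iff_conj dest: spec[of _ ?d])
  then obtain y where y: "y \<noteq> x" "\<bar>y - x\<bar> < ?d" "P ((f y - f x) / (y - x))"
    by (auto simp: dist_real_def)
  show ?thesis
  proof (cases "x < y")
    case True then show ?thesis using y assms by (intro that[of x y]) auto
  next
    case False
    moreover have "(f y - f x) / (y - x) = (f x - f y) / (x - y)"
      by (metis minus_diff_eq minus_divide_divide)
    ultimately show ?thesis using y assms by (intro that[of y x]) auto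
  qed
qed

text \<open>Austin's argument: on each cell of a nearly optimal partition, excise intervals on which the
  slope has the sign opposite to that of the increment over the cell. This increases the variation
  by a fixed amount depending only on the outer measure of the exceptional set.\<close>

lemma negligible_slopes_oscillate_symmetric:
  fixes f :: "real \<Rightarrow> real"
  assumes bdd: "bdd_above (var_sums f a b)" and "a \<le> b" and s: "s > 0"
  defines "E \<equiv> {x \<in> {a<..<b}. (\<exists>\<^sub>F y in at x. (f y - f x) / (y - x) < - s) \<and>
                               (\<exists>\<^sub>F y in at x. s < (f y - f x) / (y - x))}"
  shows "negligible E"
proof (rule ccontr)
  assume "\<not> negligible E"
  from Vitali_finite_intervals[OF this] obtain \<kappa> where \<kappa>: "\<kappa> > 0" and
    cov: "\<forall>Q P. negligible P \<longrightarrow> (\<forall>x\<in>E - P. \<exists>u v. Q u v \<and> u < v \<and> v \<le> u + 1 \<and> u \<le> x \<and> x \<le> v) \<longrightarrow>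
       (\<exists>F. finite F \<and> (\<forall>(u, v)\<in>F. u < v \<and> Q u v) \<and>
           pairwise (\<lambda>i j. disjnt {fst i..snd i} {fst j..snd j}) F \<and> \<kappa> < (\<Sum>(u, v)\<in>F. v - u))"
    by (elim exE conjE) (rule that)
  have "var_sums f a b \<noteq> {}" using abs_diff_in_var_sums[OF \<open>a \<le> b\<close>] by blast
  \<comment> \<open>\<open>s * \<kappa>\<close> is the amount by which the excision below raises the
    variation, so a partition this close to the supremum leads to a contradiction.\<close>
  then obtain p where p: "p \<in> var_sums f a b" "total_var f a b - s * \<kappa> < p"
    using less_cSup_iff[OF _ bdd, of "total_var f a b - s * \<kappa>"] s \<kappa>
    by (auto simp: total_var_def[symmetric])
  then obtain x n where x: "p = (\<Sum>i<n. \<bar>f (x (Suc i)) - f (x i)\<bar>)" "mono x" "x 0 = a" "x n = b"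
    unfolding var_sums_def by blast
  define up where "up = (\<lambda>i. f (x i) \<le> f (x (Suc i)))"
  \<comment> \<open>The admissible intervals lie strictly inside one cell and have slope of the sign
    opposite to the cell's increment.\<close>
  define Q where "Q = (\<lambda>u v. \<exists>i<n. x i < u \<and> v < x (Suc i) \<and>
    (if up i then f v - f u \<le> - s * (v - u) else s * (v - u) \<le> f v - f u))"
  have "\<exists>u v. Q u v \<and> u < v \<and> v \<le> u + 1 \<and> u \<le> z \<and> z \<le> v" if z: "z \<in> E - x ` {..n}" for z
  proof -
    obtain i where i: "i < n" "x i < z" "z < x (Suc i)"
    proof (rule mono_chain_cell[OF x(2), of z n])
      show "x 0 \<le> z" "z \<le> x n" "z \<notin> x ` {..n}" using z x(3,4) by (auto simp: E_def)
    qed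
    have fr: "\<exists>\<^sub>F y in at z. (f y - f z) / (y - z) < - s" "\<exists>\<^sub>F y in at z. s < (f y - f z) / (y - z)"
      using z by (auto simp: E_def)
    show ?thesis
    proof (cases "up i")
      case True
      obtain u v where uv: "x i < u" "u < v" "v < x (Suc i)" "v \<le> u + 1" "u \<le> z" "z \<le> v"
        "(f v - f u) / (v - u) < - s"
        by (rule slope_interval[OF fr(1) i(2,3)])
      then have "f v - f u \<le> - s * (v - u)" by (simp add: divide_less_eq)
      then have "Q u v" using True uv i(1) unfolding Q_def by (intro exI[of _ i]) simp
      then show ?thesis using uv by blast
    next
      case False
      obtain u v where uv: "x i < u" "u < v" "v < x (Suc i)" "v \<le> u + 1" "u \<le> z" "z \<le> v"
        "s < (f v - f u) / (v - u)"
        by (rule slope_interval[OF fr(2) i(2,3)])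
      then have "s * (v - u) \<le> f v - f u" by (simp add: less_divide_eq)
      then have "Q u v" using False uv i(1) unfolding Q_def by (intro exI[of _ i]) simp
      then show ?thesis using uv by blast
    qed
  qed
  \<comment> \<open>The finitely many partition points play the part of the negligible set
    \<open>P\<close>.\<close>
  then have "\<exists>F. finite F \<and> (\<forall>(u, v)\<in>F. u < v \<and> Q u v) \<and>
      pairwise (\<lambda>i j. disjnt {fst i..snd i} {fst j..snd j}) F \<and> \<kappa> < (\<Sum>(u, v)\<in>F. v - u)"
    by (intro cov[THEN spec, THEN spec, THEN mp, THEN mp, of "x ` {..n}" Q] ballI) (simp_all only: negligible_finite finite_imageI finite_atMost negligible_empty)
  then obtain F where F: "finite F" "\<forall>(u, v)\<in>F. u < v \<and> Q u v"
    "pairwise (\<lambda>i j. disjnt {fst i..snd i} {fst j..snd j}) F" "\<kappa> < (\<Sum>(u, v)\<in>F. v - u)"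
    by (elim exE conjE) (rule that)
  have F2: "u < v" "Q u v" if "(u, v) \<in> F" for u v
    using bspec[OF F(2) that] by auto
  define G where "G = (\<lambda>i. {(u, v) \<in> F. x i < u \<and> v < x (Suc i) \<and>
    (if up i then f v - f u \<le> - s * (v - u) else s * (v - u) \<le> f v - f u)})"
  have G: "finite (G i)" "pairwise (\<lambda>i j. disjnt {fst i..snd i} {fst j..snd j}) (G i)"
    "\<And>l r. (l, r) \<in> G i \<Longrightarrow> x i \<le> l \<and> l < r \<and> r \<le> x (Suc i)" for i
  proof -
    have sub: "G i \<subseteq> F" by (auto simp: G_def)
    show "finite (G i)" using F(1) sub finite_subset by blast
    show "pairwise (\<lambda>i j. disjnt {fst i..snd i} {fst j..snd j}) (G i)"
      using F(3) sub pairwise_subset by blast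
    show "x i \<le> l \<and> l < r \<and> r \<le> x (Suc i)" if "(l, r) \<in> G i" for l r
      using that F2(1)[of l r] by (auto simp: G_def)
  qed
  \<comment> \<open>In a rising cell, an excised interval has
    \<open>total_var f u v - (f v - f u) \<ge> s * (v - u)\<close>. Superadditivity transfers the
    sum of these excesses to the cell, where the subtracted increment is the absolute one. Falling
    cells are treated with the opposite sign.\<close>
  have cell: "\<bar>f (x (Suc i)) - f (x i)\<bar> + s * (\<Sum>(u, v)\<in>G i. v - u) \<le> total_var f (x i) (x (Suc i))"
    if "i < n" for i
  proof -
    have xi: "a \<le> x i" "x i \<le> x (Suc i)" "x (Suc i) \<le> b"
      using that monoD[OF x(2), of 0 i] monoD[OF x(2), of i "Suc i"] monoD[OF x(2), of "Suc i" n] x(3,4)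
      by auto
    have bd: "\<bar>f r - f l\<bar> \<le> total_var f l r" if "(l, r) \<in> G i" for l r
      using abs_diff_le_total_var[OF bdd, of l r] G(3)[OF that] xi by auto
    note sup = superadditive_total_var(2,3)[OF bdd, THEN superadditive_on_subset, OF xi(1,3)]
    note sm = superadditive_sum_disjoint[OF _ G(1) xi(2) G(3) G(2)]
    show ?thesis
    proof (cases "up i")
      case True
      have "s * (\<Sum>(u, v)\<in>G i. v - u) \<le> (\<Sum>(u, v)\<in>G i. total_var f u v - (f v - f u))"
        unfolding sum_distrib_left
      proof (rule sum_mono, clarify)
        fix u v assume uv: "(u, v) \<in> G i"
        then have "f v - f u \<le> - s * (v - u)" "0 \<le> s * (v - u)"
          using True s G(3)[OF uv] by (auto simp: G_def)
        then show "s * (v - u) \<le> total_var f u v - (f v - f u)"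
          using bd[OF uv] by simp
      qed
      also have "\<dots> \<le> total_var f (x i) (x (Suc i)) - (f (x (Suc i)) - f (x i))"
        by (rule sm[OF sup(1)])
      finally show ?thesis using True by (simp add: up_def)
    next
      case False
      have "s * (\<Sum>(u, v)\<in>G i. v - u) \<le> (\<Sum>(u, v)\<in>G i. total_var f u v + (f v - f u))"
        unfolding sum_distrib_left
      proof (rule sum_mono, clarify)
        fix u v assume uv: "(u, v) \<in> G i"
        then have "s * (v - u) \<le> f v - f u" "0 \<le> s * (v - u)"
          using False s G(3)[OF uv] by (auto simp: G_def)
        then show "s * (v - u) \<le> total_var f u v + (f v - f u)"
          using bd[OF uv] by simp
      qed
      also have "\<dots> \<le> total_var f (x i) (x (Suc i)) + (f (x (Suc i)) - f (x i))"
        by (rule sm[OF sup(2)])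
      finally show ?thesis using False by (simp add: up_def)
    qed
  qed
  have "F \<subseteq> (\<Union>i<n. G i)"
  proof clarify
    fix u v assume uv: "(u, v) \<in> F"
    from F2(2)[OF this] show "(u, v) \<in> (\<Union>i<n. G i)"
      unfolding Q_def by (elim exE conjE) (auto simp: G_def uv)
  qed
  have "(\<Sum>(u, v)\<in>F. v - u) \<le> (\<Sum>(u, v)\<in>(\<Union>i<n. G i). v - u)"
    using F(1) G \<open>F \<subseteq> _\<close> by (intro sum_mono2) (auto dest: G(3))
  also have "\<dots> \<le> (\<Sum>i<n. \<Sum>(u, v)\<in>G i. v - u)"
  proof -
    have "(\<Sum>(u, v)\<in>(\<Union>i<n. G i). v - u) = (\<Sum>i<n. \<Sum>(u, v)\<in>G i. v - u)"
    proof (rule sum.UNION_disjoint)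
      show "\<forall>i\<in>{..<n}. \<forall>j\<in>{..<n}. i \<noteq> j \<longrightarrow> G i \<inter> G j = {}"
      proof (intro ballI impI)
        fix i j :: nat assume "i \<noteq> j"
        then have "Suc i \<le> j \<or> Suc j \<le> i" by auto
        then have "x (Suc i) \<le> x j \<or> x (Suc j) \<le> x i" using x(2) by (auto dest: monoD)
        then have "r \<le> x j \<or> x (Suc j) \<le> l" if "(l, r) \<in> G i" for l r
          using G(3)[OF that] by auto
        then show "G i \<inter> G j = {}" using G(3)[of _ _ j] by fastforce
      qed
    qed (use G in auto)
    then show ?thesis by simp
  qed
  finally have "s * \<kappa> < s * (\<Sum>i<n. \<Sum>(u, v)\<in>G i. v - u)" using F(4) s by auto
  also have "p + \<dots> = (\<Sum>i<n. \<bar>f (x (Suc i)) - f (x i)\<bar> + s * (\<Sum>(u, v)\<in>G i. v - u))"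
    by (simp add: x(1) sum.distrib sum_distrib_left)
  also have "\<dots> \<le> (\<Sum>i<n. total_var f (x i) (x (Suc i)))"
    by (intro sum_mono cell) simp
  also have "\<dots> \<le> total_var f a b"
    using chain_sum_le_superadditive[OF superadditive_total_var(1)[OF bdd] x(2), of n] x(3,4) by simp
  finally show False using p(2) by simp
qed

text \<open>Disjoint intervals of total length \<kappa> on which the slope exceeds \<open>N\<close>
  force a variation of at least \<open>N * \<kappa>\<close>, which the choice of \<open>N\<close>
  makes larger than the total variation by 1.\<close>

lemma negligible_slopes_unbounded:
  fixes f :: "real \<Rightarrow> real"
  assumes bdd: "bdd_above (var_sums f a b)" and "a \<le> b"
  shows "negligible {x \<in> {a<..<b}. \<forall>N. \<exists>\<^sub>F y in at x. N < \<bar>(f y - f x) / (y - x)\<bar>}" (is "negligible ?E")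
proof (rule ccontr)
  assume "\<not> negligible ?E"
  from Vitali_finite_intervals[OF this] obtain \<kappa> where \<kappa>: "\<kappa> > 0" and
    cov: "\<forall>Q P. negligible P \<longrightarrow> (\<forall>x\<in>?E - P. \<exists>u v. Q u v \<and> u < v \<and> v \<le> u + 1 \<and> u \<le> x \<and> x \<le> v) \<longrightarrow>
       (\<exists>F. finite F \<and> (\<forall>(u, v)\<in>F. u < v \<and> Q u v) \<and>
           pairwise (\<lambda>i j. disjnt {fst i..snd i} {fst j..snd j}) F \<and> \<kappa> < (\<Sum>(u, v)\<in>F. v - u))"
    by (elim exE conjE) (rule that)
  have nn: "0 \<le> total_var f a b" using abs_diff_le_total_var[OF bdd, of a b] \<open>a \<le> b\<close> by simp
  define N where "N = (total_var f a b + 1) / \<kappa>"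
  have "N > 0" using nn \<kappa> by (simp add: N_def)
  define Q where "Q = (\<lambda>u v. a < u \<and> v < b \<and> N * (v - u) \<le> \<bar>f v - f u\<bar>)"
  have "\<exists>u v. Q u v \<and> u < v \<and> v \<le> u + 1 \<and> u \<le> z \<and> z \<le> v" if z: "z \<in> ?E - {}" for z
  proof -
    have fr: "\<exists>\<^sub>F y in at z. N < \<bar>(f y - f z) / (y - z)\<bar>" and "a < z" "z < b"
      using z by simp_all
    then obtain u v where uv: "a < u" "u < v" "v < b" "v \<le> u + 1" "u \<le> z" "z \<le> v"
        "N < \<bar>(f v - f u) / (v - u)\<bar>"
      by (rule slope_interval)
    then have "N * (v - u) \<le> \<bar>f v - f u\<bar>" by (simp add: less_divide_eq)
    then have "Q u v" using uv by (simp add: Q_def)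
    then show ?thesis using uv by blast
  qed
  then have "\<exists>F. finite F \<and> (\<forall>(u, v)\<in>F. u < v \<and> Q u v) \<and>
      pairwise (\<lambda>i j. disjnt {fst i..snd i} {fst j..snd j}) F \<and> \<kappa> < (\<Sum>(u, v)\<in>F. v - u)"
    by (intro cov[THEN spec, THEN spec, THEN mp, THEN mp, of "{}" Q] ballI) (simp_all only: negligible_finite finite_imageI finite_atMost negligible_empty)
  then obtain F where F: "finite F" "\<forall>(u, v)\<in>F. u < v \<and> Q u v"
    "pairwise (\<lambda>i j. disjnt {fst i..snd i} {fst j..snd j}) F" "\<kappa> < (\<Sum>(u, v)\<in>F. v - u)"
    by (elim exE conjE) (rule that)
  have F2: "u < v" "Q u v" if "(u, v) \<in> F" for u v
    using bspec[OF F(2) that] by auto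
  have "N * \<kappa> \<le> N * (\<Sum>(u, v)\<in>F. v - u)" using F(4) \<open>N > 0\<close> by simp
  also have "\<dots> \<le> (\<Sum>(u, v)\<in>F. total_var f u v)"
    unfolding sum_distrib_left
  proof (rule sum_mono, clarify)
    fix u v assume uv: "(u, v) \<in> F"
    have "a \<le> u" "u \<le> v" "v \<le> b" "N * (v - u) \<le> \<bar>f v - f u\<bar>" using F2[OF uv] by (simp_all add: Q_def)
    then show "N * (v - u) \<le> total_var f u v"
      using abs_diff_le_total_var[OF bdd, of u v] by linarith
  qed
  also have "\<dots> \<le> total_var f a b"
  proof (rule superadditive_sum_disjoint[OF superadditive_total_var(1)[OF bdd] F(1) \<open>a \<le> b\<close> _ F(3)])
    show "a \<le> l \<and> l < r \<and> r \<le> b" if "(l, r) \<in> F" for l r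
      using F2[OF that] by (simp add: Q_def)
  qed
  finally show False using \<kappa> by (simp add: N_def)
qed

text \<open>Subtracting the linear function whose slope is the midpoint of \<open>r\<close> and
  \<open>s\<close> keeps the variation bounded and makes the two thresholds symmetric about
  0.\<close>

lemma negligible_slopes_oscillate:
  fixes f :: "real \<Rightarrow> real"
  assumes bdd: "bdd_above (var_sums f a b)" and "a \<le> b" and "r < s"
  shows "negligible {x \<in> {a<..<b}. (\<exists>\<^sub>F y in at x. (f y - f x) / (y - x) < r) \<and>
                                   (\<exists>\<^sub>F y in at x. s < (f y - f x) / (y - x))}" (is "negligible ?E")
proof -
  define m where "m = (r + s) / 2"
  define g where "g = (\<lambda>x. f x - m * x)"
  obtain A where A: "\<And>p. p \<in> var_sums f a b \<Longrightarrow> p \<le> A"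
    using bdd by (auto simp: bdd_above_def)
  have "p \<le> A + \<bar>m\<bar> * (b - a)" if p: "p \<in> var_sums g a b" for p
  proof -
    obtain x n where x: "p = (\<Sum>i<n. \<bar>g (x (Suc i)) - g (x i)\<bar>)" "mono x" "x 0 = a" "x n = b"
      using p unfolding var_sums_def by blast
    have "p \<le> (\<Sum>i<n. \<bar>f (x (Suc i)) - f (x i)\<bar> + \<bar>m\<bar> * (x (Suc i) - x i))"
      unfolding x(1)
    proof (rule sum_mono)
      fix i
      have "g (x (Suc i)) - g (x i) = (f (x (Suc i)) - f (x i)) - m * (x (Suc i) - x i)"
        by (simp add: g_def algebra_simps)
      moreover have "\<bar>m * (x (Suc i) - x i)\<bar> = \<bar>m\<bar> * (x (Suc i) - x i)"
        using monoD[OF x(2), of i "Suc i"] by (simp add: abs_mult)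
      ultimately show "\<bar>g (x (Suc i)) - g (x i)\<bar> \<le> \<bar>f (x (Suc i)) - f (x i)\<bar> + \<bar>m\<bar> * (x (Suc i) - x i)"
        using abs_triangle_ineq4[of "f (x (Suc i)) - f (x i)" "m * (x (Suc i) - x i)"] by linarith
    qed
    also have "\<dots> = (\<Sum>i<n. \<bar>f (x (Suc i)) - f (x i)\<bar>) + \<bar>m\<bar> * (b - a)"
      using x(3,4) by (simp add: sum.distrib sum_distrib_left[symmetric] sum_lessThan_telescope)
    also have "\<dots> \<le> A + \<bar>m\<bar> * (b - a)"
      using A var_sumsI[OF x(2-4), of f] by simp
    finally show ?thesis .
  qed
  then have "bdd_above (var_sums g a b)" by (auto simp: bdd_above_def)
  from negligible_slopes_oscillate_symmetric[OF this \<open>a \<le> b\<close>, of "(s - r) / 2"] \<open>r < s\<close>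
  have "negligible {x \<in> {a<..<b}. (\<exists>\<^sub>F y in at x. (g y - g x) / (y - x) < - ((s - r) / 2)) \<and>
                                   (\<exists>\<^sub>F y in at x. (s - r) / 2 < (g y - g x) / (y - x))}" (is "negligible ?G")
    by simp
  moreover have "?E \<subseteq> ?G"
  proof (rule subsetI)
    fix x assume "x \<in> ?E"
    then have "x \<in> {a<..<b} \<and> (\<exists>\<^sub>F y in at x. (f y - f x) / (y - x) < r) \<and>
      (\<exists>\<^sub>F y in at x. s < (f y - f x) / (y - x))" by (rule CollectD)
    then have x: "x \<in> {a<..<b}" and lo: "\<exists>\<^sub>F y in at x. (f y - f x) / (y - x) < r"
      and hi: "\<exists>\<^sub>F y in at x. s < (f y - f x) / (y - x)" by blast+
    have sl: "(g y - g x) / (y - x) = (f y - f x) / (y - x) - m" if "y \<noteq> x" for y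
    proof -
      have "g y - g x = (f y - f x) - m * (y - x)" by (simp add: g_def algebra_simps)
      then show ?thesis using that by (simp add: diff_divide_distrib)
    qed
    have slg: "(f y - f x) / (y - x) < r \<longrightarrow> (g y - g x) / (y - x) < - ((s - r) / 2)"
      "s < (f y - f x) / (y - x) \<longrightarrow> (s - r) / 2 < (g y - g x) / (y - x)" if "y \<noteq> x" for y
    proof -
      have "q < r \<longrightarrow> q - m < - ((s - r) / 2)" "s < q \<longrightarrow> (s - r) / 2 < q - m" for q
        unfolding m_def by (simp_all add: field_simps)
      then show "(f y - f x) / (y - x) < r \<longrightarrow> (g y - g x) / (y - x) < - ((s - r) / 2)"
        "s < (f y - f x) / (y - x) \<longrightarrow> (s - r) / 2 < (g y - g x) / (y - x)"
        unfolding sl[OF that] by this+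
    qed
    have ev: "\<forall>\<^sub>F y in at x. y \<noteq> x" by (simp add: eventually_at_filter)
    have "\<exists>\<^sub>F y in at x. (g y - g x) / (y - x) < - ((s - r) / 2)"
      by (rule frequently_rev_mp[OF lo], rule eventually_mono[OF ev], rule slg(1))
    moreover have "\<exists>\<^sub>F y in at x. (s - r) / 2 < (g y - g x) / (y - x)"
      by (rule frequently_rev_mp[OF hi], rule eventually_mono[OF ev], rule slg(2))
    ultimately show "x \<in> ?G"
      using x by (intro CollectI conjI)
  qed
  ultimately show ?thesis by (rule negligible_subset)
qed

text \<open>Thresholds are rational because only countably many exceptional sets can be discarded. A
  gap between lower and upper limit would contain two rationals \<open>r < s\<close>, and
  boundedness makes the common value finite.\<close>

lemma bounded_nonoscillating_tendsto:
  fixes q :: "real \<Rightarrow> real"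
  assumes F: "F \<noteq> bot" and bd: "\<forall>\<^sub>F y in F. \<bar>q y\<bar> \<le> N"
    and osc: "\<And>r s :: rat. r < s \<Longrightarrow> (\<forall>\<^sub>F y in F. of_rat r \<le> q y) \<or> (\<forall>\<^sub>F y in F. q y \<le> of_rat s)"
  shows "\<exists>D. (q \<longlongrightarrow> D) F"
proof -
  let ?q = "\<lambda>y. ereal (q y)"
  have le: "Limsup F ?q \<le> Liminf F ?q"
  proof (rule ccontr)
    assume "\<not> ?thesis"
    then have lt: "Liminf F ?q < Limsup F ?q" by simp
    obtain r :: rat where r: "Liminf F ?q < ereal (of_rat r)" "ereal (of_rat r) < Limsup F ?q"
      using ereal_dense3[OF lt] by auto
    obtain s :: rat where s: "ereal (of_rat r) < ereal (of_rat s)" "ereal (of_rat s) < Limsup F ?q"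
      using ereal_dense3[OF r(2)] by auto
    have "r < s" using s by (simp add: of_rat_less)
    from osc[OF this] show False
    proof
      assume "\<forall>\<^sub>F y in F. of_rat r \<le> q y"
      then have "ereal (of_rat r) \<le> Liminf F ?q" by (intro Liminf_bounded) simp
      then show False using r by simp
    next
      assume "\<forall>\<^sub>F y in F. q y \<le> of_rat s"
      then have "Limsup F ?q \<le> ereal (of_rat s)" by (intro Limsup_bounded) simp
      then show False using s by simp
    qed
  qed
  then have eq: "Liminf F ?q = Limsup F ?q" using Liminf_le_Limsup[OF F, of ?q] by simp
  have "Limsup F ?q \<le> ereal N" "ereal (- N) \<le> Liminf F ?q"
    using bd by (auto intro!: Limsup_bounded Liminf_bounded elim: eventually_mono)
  then have "Limsup F ?q \<noteq> \<infinity>" "Limsup F ?q \<noteq> - \<infinity>" using eq by auto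
  then obtain D where "Limsup F ?q = ereal D" by (cases "Limsup F ?q") auto
  then have "(?q \<longlongrightarrow> ereal D) F" using eq tendsto_iff_Liminf_eq_Limsup[OF F] by metis
  then show ?thesis by auto
qed

lemma bdd_var_differentiable_ae:
  fixes f :: "real \<Rightarrow> real"
  assumes bdd: "bdd_above (var_sums f a b)" and "a \<le> b"
  shows "negligible {x \<in> {a..b}. \<not> (\<exists>D. (f has_real_derivative D) (at x))}"
proof -
  define O1 where "O1 = (\<lambda>r s. {x \<in> {a<..<b}. (\<exists>\<^sub>F y in at x. (f y - f x) / (y - x) < r) \<and>
                                   (\<exists>\<^sub>F y in at x. s < (f y - f x) / (y - x))})"
  define O2 where "O2 = {x \<in> {a<..<b}. \<forall>N. \<exists>\<^sub>F y in at x. N < \<bar>(f y - f x) / (y - x)\<bar>}"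
  define I where "I = {p :: rat \<times> rat. fst p < snd p}"
  have "negligible (\<Union>p\<in>I. O1 (of_rat (fst p)) (of_rat (snd p)))"
  proof (rule negligible_countable_Union)
    show "countable ((\<lambda>p. O1 (of_rat (fst p)) (of_rat (snd p))) ` I)" by simp
    show "negligible S" if "S \<in> (\<lambda>p. O1 (of_rat (fst p)) (of_rat (snd p))) ` I" for S
      using that negligible_slopes_oscillate[OF bdd \<open>a \<le> b\<close>]
      by (auto simp: O1_def I_def of_rat_less)
  qed
  moreover have "negligible O2"
    unfolding O2_def by (rule negligible_slopes_unbounded[OF bdd \<open>a \<le> b\<close>])
  moreover have "negligible {a, b}" by simp
  ultimately have "negligible ((\<Union>p\<in>I. O1 (of_rat (fst p)) (of_rat (snd p))) \<union> O2 \<union> {a, b})"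
    by (intro negligible_Un)
  moreover have "{x \<in> {a..b}. \<not> (\<exists>D. (f has_real_derivative D) (at x))} \<subseteq>
      (\<Union>p\<in>I. O1 (of_rat (fst p)) (of_rat (snd p))) \<union> O2 \<union> {a, b}"
  proof (rule subsetI, rule ccontr)
    fix x assume x: "x \<in> {x \<in> {a..b}. \<not> (\<exists>D. (f has_real_derivative D) (at x))}"
      and n: "x \<notin> (\<Union>p\<in>I. O1 (of_rat (fst p)) (of_rat (snd p))) \<union> O2 \<union> {a, b}"
    have xab: "x \<in> {a<..<b}" using x n by auto
    obtain N where "\<not> (\<exists>\<^sub>F y in at x. N < \<bar>(f y - f x) / (y - x)\<bar>)"
      using n xab unfolding O2_def by blast
    then have N: "\<forall>\<^sub>F y in at x. \<bar>(f y - f x) / (y - x)\<bar> \<le> N"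
      by (simp only: not_frequently not_less)
    have "\<exists>D. ((\<lambda>y. (f y - f x) / (y - x)) \<longlongrightarrow> D) (at x)"
    proof (rule bounded_nonoscillating_tendsto[OF _ N])
      fix r s :: rat assume "r < s"
      then have "x \<notin> O1 (of_rat r) (of_rat s)" using n unfolding I_def by force
      then have "\<not> (\<exists>\<^sub>F y in at x. (f y - f x) / (y - x) < of_rat r) \<or>
         \<not> (\<exists>\<^sub>F y in at x. of_rat s < (f y - f x) / (y - x))"
        using xab unfolding O1_def by blast
      then show "(\<forall>\<^sub>F y in at x. of_rat r \<le> (f y - f x) / (y - x)) \<or>
        (\<forall>\<^sub>F y in at x. (f y - f x) / (y - x) \<le> of_rat s)"
        by (simp only: not_frequently not_less)
    qed simp
    then show False using x by (auto simp: has_field_derivative_iff)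
  qed
  ultimately show ?thesis by (rule negligible_subset)
qed

section \<open>Absolutely continuous curves and the fundamental theorem of calculus\<close>

lemma abs_continuous_on_dominated:
  assumes "abs_continuous_on a b f"
    and "\<And>u v. a \<le> u \<Longrightarrow> u \<le> v \<Longrightarrow> v \<le> b \<Longrightarrow> norm (g v - g u) \<le> norm (f v - f u)"
  shows "abs_continuous_on a b g"
  unfolding abs_continuous_on_def
proof (intro allI impI)
  fix e :: real assume "e > 0"
  then obtain d where d: "d > 0" "\<And>(n::nat) u v. \<forall>i<n. a \<le> u i \<and> u i \<le> v i \<and> v i \<le> b \<Longrightarrow>
      disjoint_family_on (\<lambda>i. {u i<..<v i}) {..<n} \<Longrightarrow> (\<Sum>i<n. v i - u i) < d \<Longrightarrow>
      (\<Sum>i<n. norm (f (v i) - f (u i))) < e"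
    using assms(1)[unfolded abs_continuous_on_def, rule_format, of e] by blast
  show "\<exists>d>0. \<forall>(n::nat) u v. (\<forall>i<n. a \<le> u i \<and> u i \<le> v i \<and> v i \<le> b) \<longrightarrow>
      disjoint_family_on (\<lambda>i. {u i<..<v i}) {..<n} \<longrightarrow> (\<Sum>i<n. v i - u i) < d \<longrightarrow>
      (\<Sum>i<n. norm (g (v i) - g (u i))) < e"
  proof (intro exI[of _ d] conjI allI impI d(1))
    fix n :: nat and u v :: "nat \<Rightarrow> real"
    assume 1: "\<forall>i<n. a \<le> u i \<and> u i \<le> v i \<and> v i \<le> b"
      and 2: "disjoint_family_on (\<lambda>i. {u i<..<v i}) {..<n}" "(\<Sum>i<n. v i - u i) < d"
    have "(\<Sum>i<n. norm (g (v i) - g (u i))) \<le> (\<Sum>i<n. norm (f (v i) - f (u i)))"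
      using 1 by (intro sum_mono assms(2)) auto
    also have "\<dots> < e" by (rule d(2)[OF 1 2])
    finally show "(\<Sum>i<n. norm (g (v i) - g (u i))) < e" .
  qed
qed

lemma abs_continuous_on_subset:
  assumes "abs_continuous_on a b f" "a \<le> c" "d \<le> b"
  shows "abs_continuous_on c d f"
  unfolding abs_continuous_on_def
proof (intro allI impI)
  fix e :: real assume "e > 0"
  then obtain \<delta> where \<delta>: "\<delta> > 0" "\<And>(n::nat) u v. \<forall>i<n. a \<le> u i \<and> u i \<le> v i \<and> v i \<le> b \<Longrightarrow>
      disjoint_family_on (\<lambda>i. {u i<..<v i}) {..<n} \<Longrightarrow> (\<Sum>i<n. v i - u i) < \<delta> \<Longrightarrow>
      (\<Sum>i<n. norm (f (v i) - f (u i))) < e"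
    using assms(1)[unfolded abs_continuous_on_def, rule_format, of e] by blast
  show "\<exists>\<delta>>0. \<forall>(n::nat) u v. (\<forall>i<n. c \<le> u i \<and> u i \<le> v i \<and> v i \<le> d) \<longrightarrow>
      disjoint_family_on (\<lambda>i. {u i<..<v i}) {..<n} \<longrightarrow> (\<Sum>i<n. v i - u i) < \<delta> \<longrightarrow>
      (\<Sum>i<n. norm (f (v i) - f (u i))) < e"
  proof (intro exI[of _ \<delta>] conjI allI impI \<delta>(1))
    fix n :: nat and u v :: "nat \<Rightarrow> real"
    assume 1: "\<forall>i<n. c \<le> u i \<and> u i \<le> v i \<and> v i \<le> d"
      and 2: "disjoint_family_on (\<lambda>i. {u i<..<v i}) {..<n}" "(\<Sum>i<n. v i - u i) < \<delta>"
    have "\<forall>i<n. a \<le> u i \<and> u i \<le> v i \<and> v i \<le> b" using 1 assms(2,3) by (meson order_trans)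
    then show "(\<Sum>i<n. norm (f (v i) - f (u i))) < e" by (rule \<delta>(2)[OF _ 2])
  qed
qed

lemma lipschitz_imp_abs_continuous_on:
  assumes "L-lipschitz_on {a..b} f"
  shows "abs_continuous_on a b f"
  unfolding abs_continuous_on_def
proof (intro allI impI)
  fix e :: real assume "e > 0"
  have L: "L \<ge> 0" using assms by (rule lipschitz_on_nonneg)
  show "\<exists>\<delta>>0. \<forall>(n::nat) u v. (\<forall>i<n. a \<le> u i \<and> u i \<le> v i \<and> v i \<le> b) \<longrightarrow>
      disjoint_family_on (\<lambda>i. {u i<..<v i}) {..<n} \<longrightarrow> (\<Sum>i<n. v i - u i) < \<delta> \<longrightarrow>
      (\<Sum>i<n. norm (f (v i) - f (u i))) < e"
  proof (intro exI[of _ "e / (L + 1)"] conjI allI impI)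
    fix n :: nat and u v :: "nat \<Rightarrow> real"
    assume 1: "\<forall>i<n. a \<le> u i \<and> u i \<le> v i \<and> v i \<le> b"
      and 2: "(\<Sum>i<n. v i - u i) < e / (L + 1)"
    have "(\<Sum>i<n. norm (f (v i) - f (u i))) \<le> (\<Sum>i<n. L * (v i - u i))"
    proof (rule sum_mono)
      fix i assume "i \<in> {..<n}"
      then have "u i \<in> {a..b}" "v i \<in> {a..b}" "u i \<le> v i" using 1 by (auto intro: order_trans)
      then show "norm (f (v i) - f (u i)) \<le> L * (v i - u i)"
        using lipschitz_onD[OF assms, of "v i" "u i"] by (simp add: dist_norm)
    qed
    also have "\<dots> \<le> (L + 1) * (\<Sum>i<n. v i - u i)"
      unfolding sum_distrib_left using 1 L by (intro sum_mono mult_right_mono) auto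
    also have "\<dots> < e" using 2 L by (simp add: pos_less_divide_eq mult.commute)
    finally show "(\<Sum>i<n. norm (f (v i) - f (u i))) < e" .
  qed (use \<open>e > 0\<close> L in auto)
qed

lemma abs_continuous_on_glue:
  fixes f g :: "real \<Rightarrow> 'a::real_normed_vector"
  assumes f: "abs_continuous_on a c f" and g: "abs_continuous_on c b g" and eq: "f c = g c"
    and "a \<le> c" "c \<le> b"
  shows "abs_continuous_on a b (\<lambda>s. if s \<le> c then f s else g s)" (is "abs_continuous_on a b ?h")
  unfolding abs_continuous_on_def
proof (intro allI impI)
  fix e :: real assume "e > 0"
  then have e2: "e / 2 > 0" by simp
  obtain d1 where d1: "d1 > 0" "\<And>(n::nat) u v. \<forall>i<n. a \<le> u i \<and> u i \<le> v i \<and> v i \<le> c \<Longrightarrow>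
      disjoint_family_on (\<lambda>i. {u i<..<v i}) {..<n} \<Longrightarrow> (\<Sum>i<n. v i - u i) < d1 \<Longrightarrow>
      (\<Sum>i<n. norm (f (v i) - f (u i))) < e / 2"
    using f[unfolded abs_continuous_on_def, rule_format, OF e2] by blast
  obtain d2 where d2: "d2 > 0" "\<And>(n::nat) u v. \<forall>i<n. c \<le> u i \<and> u i \<le> v i \<and> v i \<le> b \<Longrightarrow>
      disjoint_family_on (\<lambda>i. {u i<..<v i}) {..<n} \<Longrightarrow> (\<Sum>i<n. v i - u i) < d2 \<Longrightarrow>
      (\<Sum>i<n. norm (g (v i) - g (u i))) < e / 2"
    using g[unfolded abs_continuous_on_def, rule_format, OF e2] by blast
  show "\<exists>\<delta>>0. \<forall>(n::nat) u v. (\<forall>i<n. a \<le> u i \<and> u i \<le> v i \<and> v i \<le> b) \<longrightarrow>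
      disjoint_family_on (\<lambda>i. {u i<..<v i}) {..<n} \<longrightarrow> (\<Sum>i<n. v i - u i) < \<delta> \<longrightarrow>
      (\<Sum>i<n. norm (?h (v i) - ?h (u i))) < e"
  proof (intro exI[of _ "min d1 d2"] conjI allI impI)
    show "min d1 d2 > 0" using d1 d2 by simp
    fix n :: nat and u v :: "nat \<Rightarrow> real"
    assume 1: "\<forall>i<n. a \<le> u i \<and> u i \<le> v i \<and> v i \<le> b"
      and 2: "disjoint_family_on (\<lambda>i. {u i<..<v i}) {..<n}" and 3: "(\<Sum>i<n. v i - u i) < min d1 d2"
    have "(\<Sum>i<n. norm (f (min (v i) c) - f (min (u i) c))) < e / 2"
    proof (rule d1(2))
      show "\<forall>i<n. a \<le> min (u i) c \<and> min (u i) c \<le> min (v i) c \<and> min (v i) c \<le> c"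
        using 1 \<open>a \<le> c\<close> by auto
      show "disjoint_family_on (\<lambda>i. {min (u i) c<..<min (v i) c}) {..<n}"
        using 2 unfolding disjoint_family_on_def by fastforce
      have "(\<Sum>i<n. min (v i) c - min (u i) c) \<le> (\<Sum>i<n. v i - u i)"
        using 1 by (intro sum_mono) (auto simp: min_def)
      then show "(\<Sum>i<n. min (v i) c - min (u i) c) < d1" using 3 by simp
    qed
    moreover have "(\<Sum>i<n. norm (g (max (v i) c) - g (max (u i) c))) < e / 2"
    proof (rule d2(2))
      show "\<forall>i<n. c \<le> max (u i) c \<and> max (u i) c \<le> max (v i) c \<and> max (v i) c \<le> b"
        using 1 \<open>c \<le> b\<close> by auto
      show "disjoint_family_on (\<lambda>i. {max (u i) c<..<max (v i) c}) {..<n}"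
        using 2 unfolding disjoint_family_on_def by fastforce
      have "(\<Sum>i<n. max (v i) c - max (u i) c) \<le> (\<Sum>i<n. v i - u i)"
        using 1 by (intro sum_mono) (auto simp: max_def)
      then show "(\<Sum>i<n. max (v i) c - max (u i) c) < d2" using 3 by simp
    qed
    moreover have "(\<Sum>i<n. norm (?h (v i) - ?h (u i))) \<le>
        (\<Sum>i<n. norm (f (min (v i) c) - f (min (u i) c)) + norm (g (max (v i) c) - g (max (u i) c)))"
    proof (rule sum_mono)
      fix i
      \<comment> \<open>This identity splits every increment of the glued curve into an increment of
        \<open>f\<close> and one of \<open>g\<close> over clipped intervals, which stay disjoint and
        do not get longer.\<close>
      have "?h s = f (min s c) + (g (max s c) - g c)" for s
        using eq by (auto simp: min_def max_def)
      then have "?h (v i) - ?h (u i) =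
          (f (min (v i) c) - f (min (u i) c)) + (g (max (v i) c) - g (max (u i) c))"
        by simp
      then show "norm (?h (v i) - ?h (u i)) \<le>
        norm (f (min (v i) c) - f (min (u i) c)) + norm (g (max (v i) c) - g (max (u i) c))"
        by (metis norm_triangle_ineq)
    qed
    ultimately show "(\<Sum>i<n. norm (?h (v i) - ?h (u i))) < e"
      by (simp add: sum.distrib)
  qed
qed

lemma abs_continuous_on_imp_continuous_on:
  assumes "abs_continuous_on a b f"
  shows "continuous_on {a..b} f"
  unfolding continuous_on_iff
proof (intro ballI allI impI)
  fix x e :: real assume x: "x \<in> {a..b}" and "e > 0"
  then obtain d where d: "d > 0" "\<And>(n::nat) u v. \<forall>i<n. a \<le> u i \<and> u i \<le> v i \<and> v i \<le> b \<Longrightarrow>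
      disjoint_family_on (\<lambda>i. {u i<..<v i}) {..<n} \<Longrightarrow> (\<Sum>i<n. v i - u i) < d \<Longrightarrow>
      (\<Sum>i<n. norm (f (v i) - f (u i))) < e"
    using assms[unfolded abs_continuous_on_def, rule_format, of e] by blast
  have "norm (f y - f x) < e" if "y \<in> {a..b}" "\<bar>y - x\<bar> < d" for y
  proof -
    have "norm (f (max x y) - f (min x y)) < e"
      using d(2)[of 1 "\<lambda>_. min x y" "\<lambda>_. max x y"] that x by (auto simp: disjoint_family_on_def)
    then show ?thesis by (cases "x \<le> y") (auto simp: norm_minus_commute)
  qed
  then show "\<exists>d>0. \<forall>x'\<in>{a..b}. dist x' x < d \<longrightarrow> dist (f x') (f x) < e"
    using d(1) by (intro exI[of _ d]) (auto simp: dist_norm)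
qed

text \<open>Reindexing, so that the pairs of a tagged division can serve directly as the index
  set.\<close>

lemma abs_continuous_on_finite_family:
  assumes "abs_continuous_on a b f" "e > 0"
  obtains d where "d > 0" "\<And>(I :: 'i set) u v. finite I \<Longrightarrow>
      \<forall>i\<in>I. a \<le> u i \<and> u i \<le> v i \<and> v i \<le> b \<Longrightarrow> disjoint_family_on (\<lambda>i. {u i<..<v i}) I \<Longrightarrow>
      (\<Sum>i\<in>I. v i - u i) < d \<Longrightarrow> (\<Sum>i\<in>I. norm (f (v i) - f (u i))) < e"
proof -
  obtain d where d: "d > 0" "\<And>(n::nat) u v. \<forall>i<n. a \<le> u i \<and> u i \<le> v i \<and> v i \<le> b \<Longrightarrow>
      disjoint_family_on (\<lambda>i. {u i<..<v i}) {..<n} \<Longrightarrow> (\<Sum>i<n. v i - u i) < d \<Longrightarrow>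
      (\<Sum>i<n. norm (f (v i) - f (u i))) < e"
    using assms(1)[unfolded abs_continuous_on_def, rule_format, OF assms(2)] by blast
  show ?thesis
  proof (rule that[OF d(1)])
    fix I :: "'i set" and u v
    assume I: "finite I" and 1: "\<forall>i\<in>I. a \<le> u i \<and> u i \<le> v i \<and> v i \<le> b"
      and 2: "disjoint_family_on (\<lambda>i. {u i<..<v i}) I" and 3: "(\<Sum>i\<in>I. v i - u i) < d"
    obtain h where h: "bij_betw h {..<card I} I"
      using ex_bij_betw_nat_finite[OF I] by (auto simp: atLeast0LessThan)
    have hI: "h i \<in> I" if "i < card I" for i using h that by (auto dest: bij_betwE)
    have "(\<Sum>i<card I. norm (f (v (h i)) - f (u (h i)))) < e"
    proof (rule d(2))
      show "\<forall>i<card I. a \<le> u (h i) \<and> u (h i) \<le> v (h i) \<and> v (h i) \<le> b" using 1 hI by auto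
      show "disjoint_family_on (\<lambda>i. {u (h i)<..<v (h i)}) {..<card I}"
        unfolding disjoint_family_on_def
      proof (intro ballI impI)
        fix i j assume ij: "i \<in> {..<card I}" "j \<in> {..<card I}" "i \<noteq> j"
        then have "h i \<noteq> h j" using h by (auto simp: bij_betw_def inj_on_def)
        then show "{u (h i)<..<v (h i)} \<inter> {u (h j)<..<v (h j)} = {}"
          using 2 hI ij unfolding disjoint_family_on_def by simp
      qed
      show "(\<Sum>i<card I. v (h i) - u (h i)) < d"
        using 3 sum.reindex_bij_betw[OF h, of "\<lambda>i. v i - u i"] by simp
    qed
    then show "(\<Sum>i\<in>I. norm (f (v i) - f (u i))) < e"
      using sum.reindex_bij_betw[OF h, of "\<lambda>i. norm (f (v i) - f (u i))"] by simp
  qed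
qed

text \<open>The straddle lemma: the error estimates at \<open>u\<close> and at \<open>v\<close> add
  up because \<open>x\<close> lies between them.\<close>

lemma has_vector_derivative_interval_error:
  assumes "(f has_vector_derivative D) (at x within S)" "e > 0"
  obtains d where "d > 0" "\<And>u v. u \<in> S \<Longrightarrow> v \<in> S \<Longrightarrow> u \<le> x \<Longrightarrow> x \<le> v \<Longrightarrow> \<bar>u - x\<bar> < d \<Longrightarrow> \<bar>v - x\<bar> < d \<Longrightarrow>
     norm ((v - u) *\<^sub>R D - (f v - f u)) \<le> e * (v - u)"
proof -
  obtain d where d: "d > 0" "\<And>y. y \<in> S \<Longrightarrow> norm (y - x) < d \<Longrightarrow> norm (f y - f x - (y - x) *\<^sub>R D) \<le> e * norm (y - x)"
    using assms unfolding has_vector_derivative_def has_derivative_within_alt by blast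
  show ?thesis
  proof (rule that[OF d(1)])
    fix u v assume uv: "u \<in> S" "v \<in> S" "u \<le> x" "x \<le> v" "\<bar>u - x\<bar> < d" "\<bar>v - x\<bar> < d"
    have eq: "(v - u) *\<^sub>R D - (f v - f u) = (f u - f x - (u - x) *\<^sub>R D) - (f v - f x - (v - x) *\<^sub>R D)"
      by (simp add: algebra_simps)
    have "norm (f u - f x - (u - x) *\<^sub>R D) \<le> e * norm (u - x)"
      "norm (f v - f x - (v - x) *\<^sub>R D) \<le> e * norm (v - x)"
      using d(2)[OF uv(1)] d(2)[OF uv(2)] uv(5,6) unfolding real_norm_def by blast+
    then have "norm ((v - u) *\<^sub>R D - (f v - f u)) \<le> e * norm (u - x) + e * norm (v - x)"
      unfolding eq by (rule order_trans[OF norm_triangle_ineq4 add_mono])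
    also have "\<dots> = e * (v - u)" using uv by (simp add: algebra_simps)
    finally show "norm ((v - u) *\<^sub>R D - (f v - f u)) \<le> e * (v - u)" .
  qed
qed

text \<open>A direct gauge argument. Tags outside \<open>N\<close> are handled by the straddle
  lemma. Tags in \<open>N\<close> are forced into an open set of measure below \<delta>; there
  absolute continuity makes the increments of \<open>f\<close> small, while the Riemann terms vanish
  because the integrand is redefined as 0 on \<open>N\<close>.\<close>

theorem abs_continuous_on_has_integral:
  fixes f :: "real \<Rightarrow> 'a::real_normed_vector"
  assumes ac: "abs_continuous_on a b f" and "a \<le> b" and N: "negligible N"
    and der: "\<And>x. x \<in> {a..b} - N \<Longrightarrow> (f has_vector_derivative g x) (at x within {a..b})"
  shows "(g has_integral (f b - f a)) {a..b}"
proof -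
  define g0 where "g0 = (\<lambda>x. if x \<in> N then 0 else g x)"
  have "(g0 has_integral (f b - f a)) {a..b}"
    unfolding has_integral_real
  proof (intro allI impI)
    fix e :: real assume "e > 0"
    \<comment> \<open>The \<open>+ 1\<close> keeps the denominator positive when
      \<open>a = b\<close>.\<close>
    define e1 where "e1 = e / (2 * (b - a + 1))"
    have e1: "e1 > 0" "e1 * (b - a) < e / 2"
      using \<open>e > 0\<close> \<open>a \<le> b\<close> by (auto simp: e1_def field_simps)
    obtain \<delta> where \<delta>: "\<delta> > 0" "\<And>(I :: (real \<times> real set) set) u v. finite I \<Longrightarrow>
      \<forall>i\<in>I. a \<le> u i \<and> u i \<le> v i \<and> v i \<le> b \<Longrightarrow> disjoint_family_on (\<lambda>i. {u i<..<v i}) I \<Longrightarrow>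
      (\<Sum>i\<in>I. v i - u i) < \<delta> \<Longrightarrow> (\<Sum>i\<in>I. norm (f (v i) - f (u i))) < e / 2"
      by (rule abs_continuous_on_finite_family[OF ac, of "e / 2"]) (use \<open>e > 0\<close> in auto)
    obtain U where U: "open U" "N \<subseteq> U" "U \<in> lmeasurable" "measure lebesgue U < \<delta>"
    proof -
      have NL: "N \<in> lmeasurable" using N by (rule negligible_imp_measurable)
      obtain T where T: "open T" "N \<subseteq> T" "T - N \<in> lmeasurable" "emeasure lebesgue (T - N) < ennreal \<delta>"
        using sets_lebesgue_outer_open[OF fmeasurableD[OF NL] \<delta>(1)] by blast
      have eq: "T = (T - N) \<union> N" using T(2) by blast
      have "measure lebesgue T \<le> measure lebesgue (T - N) + measure lebesgue N"
        by (subst eq, rule measure_Un_le) (use T(3) NL in auto)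
      also have "\<dots> < \<delta>"
        using T(4) negligible_imp_measure0[OF N] \<delta>(1) by (simp add: emeasure_eq_measure2[OF T(3)] ennreal_less_iff)
      finally have "measure lebesgue T < \<delta>" .
      moreover have "T \<in> lmeasurable" by (subst eq, rule fmeasurable.Un[OF T(3) NL])
      ultimately show ?thesis using T that by blast
    qed
    have "\<exists>d>0. \<forall>u v. u \<in> {a..b} \<longrightarrow> v \<in> {a..b} \<longrightarrow> u \<le> x \<longrightarrow> x \<le> v \<longrightarrow> \<bar>u - x\<bar> < d \<longrightarrow> \<bar>v - x\<bar> < d \<longrightarrow>
        norm ((v - u) *\<^sub>R g x - (f v - f u)) \<le> e1 * (v - u)" if "x \<in> {a..b} - N" for x
      by (rule has_vector_derivative_interval_error[OF der[OF that] e1(1)]) blast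
    then have "\<forall>x\<in>{a..b} - N. \<exists>d>0. \<forall>u v. u \<in> {a..b} \<longrightarrow> v \<in> {a..b} \<longrightarrow> u \<le> x \<longrightarrow> x \<le> v \<longrightarrow> \<bar>u - x\<bar> < d \<longrightarrow> \<bar>v - x\<bar> < d \<longrightarrow>
        norm ((v - u) *\<^sub>R g x - (f v - f u)) \<le> e1 * (v - u)" by (rule ballI)
    from bchoice[OF this] obtain d where d: "\<And>x. x \<in> {a..b} - N \<Longrightarrow> d x > 0"
      "\<And>x u v. x \<in> {a..b} - N \<Longrightarrow> u \<in> {a..b} \<Longrightarrow> v \<in> {a..b} \<Longrightarrow> u \<le> x \<Longrightarrow> x \<le> v \<Longrightarrow> \<bar>u - x\<bar> < d x \<Longrightarrow>
        \<bar>v - x\<bar> < d x \<Longrightarrow> norm ((v - u) *\<^sub>R g x - (f v - f u)) \<le> e1 * (v - u)"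
      by blast
    define \<gamma> where "\<gamma> = (\<lambda>x. if x \<in> N then U else if x \<in> {a..b} then ball x (d x) else ball x 1)"
    have gau: "gauge \<gamma>"
      unfolding gauge_def
    proof
      show "x \<in> \<gamma> x \<and> open (\<gamma> x)" for x
        using U(1,2) d(1)[of x] by (cases "x \<in> N"; cases "x \<in> {a..b}") (auto simp: \<gamma>_def)
    qed
    have close: "norm ((\<Sum>(x, K)\<in>p. measure lborel K *\<^sub>R g0 x) - (f b - f a)) < e"
      if p: "p tagged_division_of {a..b}" "\<gamma> fine p" for p
    proof -
      note pD = tagged_division_ofD[OF p(1)]
      have K: "\<exists>u v. K = {u..v} \<and> u \<le> v \<and> u \<in> {a..b} \<and> v \<in> {a..b} \<and> u \<le> x \<and> x \<le> v \<and> Inf K = u \<and> Sup K = v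
           \<and> measure lborel K = v - u" if xK: "(x, K) \<in> p" for x K
      proof -
        obtain u v where uv: "K = {u..v}" using pD(4)[OF xK] by auto
        then have "u \<le> x" "x \<le> v" using pD(2)[OF xK] by auto
        moreover have "u \<in> K" "v \<in> K" using uv calculation by auto
        then have "u \<in> {a..b}" "v \<in> {a..b}" using pD(3)[OF xK] by blast+
        ultimately show ?thesis using uv by auto
      qed
      define pN where "pN = {(x, K) \<in> p. x \<in> N}"
      have pN: "pN \<subseteq> p" "finite pN"
        using finite_subset[OF _ pD(1), of pN] by (auto simp: pN_def)
      have inp: "(fst i, snd i) \<in> p" if "i \<in> pN" for i
        using that pN(1) by auto
      have dis: "disjoint_family_on (\<lambda>i. {Inf (snd i)<..<Sup (snd i)}) pN"
        unfolding disjoint_family_on_def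
      proof (intro ballI impI)
        fix i j assume ij: "i \<in> pN" "j \<in> pN" "i \<noteq> j"
        then have "interior (snd i) \<inter> interior (snd j) = {}"
          using pD(5)[of "fst i" "snd i" "fst j" "snd j"] pN(1) by (auto simp: prod_eq_iff)
        moreover have "{Inf (snd k)<..<Sup (snd k)} = interior (snd k)" if kp: "k \<in> pN" for k
        proof -
          obtain u v where "snd k = {u..v}" "u \<le> v"
            using K[OF inp[OF kp]] by blast
          then show ?thesis by simp
        qed
        ultimately show "{Inf (snd i)<..<Sup (snd i)} \<inter> {Inf (snd j)<..<Sup (snd j)} = {}"
          using ij by simp
      qed
      have "(\<Sum>i\<in>pN. Sup (snd i) - Inf (snd i)) = (\<Sum>i\<in>pN. measure lebesgue {Inf (snd i)<..<Sup (snd i)})"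
      proof (rule sum.cong[OF refl])
        fix i assume i: "i \<in> pN"
        obtain u v where "snd i = {u..v}" "u \<le> v"
          using K[OF inp[OF i]] by blast
        then show "Sup (snd i) - Inf (snd i) = measure lebesgue {Inf (snd i)<..<Sup (snd i)}" by simp
      qed
      also have "\<dots> = measure lebesgue (\<Union>i\<in>pN. {Inf (snd i)<..<Sup (snd i)})"
      proof (rule measure_finite_Union[symmetric])
        have "emeasure lebesgue {u<..<v} \<noteq> \<infinity>" for u v :: real by (cases "u \<le> v") auto
        then show "emeasure lebesgue {Inf (snd i)<..<Sup (snd i)} \<noteq> \<infinity>" for i :: "real \<times> real set" .
      qed (simp_all add: pN(2) dis image_subset_iff)
      also have "\<dots> \<le> measure lebesgue U"
      proof (rule measure_mono_fmeasurable)
        show "(\<Union>i\<in>pN. {Inf (snd i)<..<Sup (snd i)}) \<subseteq> U"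
        proof (rule UN_least)
          fix i assume i: "i \<in> pN"
          then have "snd i \<subseteq> \<gamma> (fst i)" using p(2) pN(1) by (force simp: fine_def)
          then have "snd i \<subseteq> U" using i by (auto simp: \<gamma>_def pN_def)
          moreover have "{Inf (snd i)<..<Sup (snd i)} \<subseteq> snd i"
          proof -
            obtain u v where "snd i = {u..v}" "u \<le> v"
              using K[OF inp[OF i]] by blast
            then show ?thesis by (simp add: subset_iff)
          qed
          ultimately show "{Inf (snd i)<..<Sup (snd i)} \<subseteq> U" by blast
        qed
      qed (use U(3) pN(2) in auto)
      finally have small: "(\<Sum>i\<in>pN. Sup (snd i) - Inf (snd i)) < \<delta>" using U(4) by simp
      have "(\<Sum>i\<in>pN. norm (f (Sup (snd i)) - f (Inf (snd i)))) < e / 2"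
      proof (rule \<delta>(2)[OF pN(2) _ dis small])
        show "\<forall>i\<in>pN. a \<le> Inf (snd i) \<and> Inf (snd i) \<le> Sup (snd i) \<and> Sup (snd i) \<le> b"
        proof
          fix i assume i: "i \<in> pN"
          obtain u v where "u \<in> {a..b}" "v \<in> {a..b}" "u \<le> v" "Inf (snd i) = u" "Sup (snd i) = v"
            using K[OF inp[OF i]] by blast
          then show "a \<le> Inf (snd i) \<and> Inf (snd i) \<le> Sup (snd i) \<and> Sup (snd i) \<le> b" by simp
        qed
      qed
      moreover have "(\<Sum>i\<in>pN. norm (measure lborel (snd i) *\<^sub>R g0 (fst i) - (f (Sup (snd i)) - f (Inf (snd i))))) =
          (\<Sum>i\<in>pN. norm (f (Sup (snd i)) - f (Inf (snd i))))"
        by (intro sum.cong refl) (auto simp: pN_def g0_def norm_minus_commute)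
      moreover have "(\<Sum>i\<in>p - pN. norm (measure lborel (snd i) *\<^sub>R g0 (fst i) - (f (Sup (snd i)) - f (Inf (snd i))))) \<le>
          e1 * (b - a)"
      proof -
        have "norm (measure lborel (snd i) *\<^sub>R g0 (fst i) - (f (Sup (snd i)) - f (Inf (snd i)))) \<le> e1 * measure lborel (snd i)"
          if i: "i \<in> p - pN" for i
        proof -
          obtain x K where xK: "i = (x, K)" "(x, K) \<in> p" "x \<notin> N" using i by (cases i) (auto simp: pN_def)
          obtain u v where uv: "K = {u..v}" "u \<le> v" "u \<in> {a..b}" "v \<in> {a..b}" "u \<le> x" "x \<le> v" "Inf K = u"
            "Sup K = v" "measure lborel K = v - u" using K[OF xK(2)] by blast
          have x: "x \<in> {a..b} - N" using uv xK by auto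
          have "K \<subseteq> ball x (d x)"
          proof -
            have "K \<subseteq> \<gamma> x" using p(2) xK(2) unfolding fine_def by blast
            then show ?thesis using x by (simp add: \<gamma>_def)
          qed
          moreover have "u \<in> K" "v \<in> K" using uv by auto
          ultimately have "\<bar>u - x\<bar> < d x" "\<bar>v - x\<bar> < d x" by (auto simp: dist_real_def abs_minus_commute)
          from d(2)[OF x uv(3-6) this] show ?thesis
            using xK uv by (simp add: g0_def)
        qed
        then have "(\<Sum>i\<in>p - pN. norm (measure lborel (snd i) *\<^sub>R g0 (fst i) - (f (Sup (snd i)) - f (Inf (snd i))))) \<le>
            (\<Sum>i\<in>p - pN. e1 * measure lborel (snd i))" by (rule sum_mono)
        also have "\<dots> \<le> (\<Sum>i\<in>p. e1 * measure lborel (snd i))"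
          using pD(1) e1 by (intro sum_mono2) auto
        also have "\<dots> = e1 * (\<Sum>(x, K)\<in>p. measure lborel K)"
          by (simp add: sum_distrib_left case_prod_unfold)
        also have "(\<Sum>(x, K)\<in>p. measure lborel K) = b - a"
          using additive_content_tagged_division[of p a b] p(1) \<open>a \<le> b\<close> by simp
        finally show ?thesis .
      qed
      moreover have eq: "(\<Sum>(x, K)\<in>p. measure lborel K *\<^sub>R g0 x) - (f b - f a) =
          (\<Sum>i\<in>p. measure lborel (snd i) *\<^sub>R g0 (fst i) - (f (Sup (snd i)) - f (Inf (snd i))))"
        using additive_tagged_division_1[OF \<open>a \<le> b\<close> p(1), of f]
        by (simp add: sum_subtractf case_prod_unfold)
      moreover have "norm \<dots> \<le> (\<Sum>i\<in>p. norm (measure lborel (snd i) *\<^sub>R g0 (fst i) - (f (Sup (snd i)) - f (Inf (snd i)))))"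
        by (rule norm_sum)
      moreover have "\<dots> = (\<Sum>i\<in>p - pN. norm (measure lborel (snd i) *\<^sub>R g0 (fst i) - (f (Sup (snd i)) - f (Inf (snd i))))) +
         (\<Sum>i\<in>pN. norm (measure lborel (snd i) *\<^sub>R g0 (fst i) - (f (Sup (snd i)) - f (Inf (snd i)))))"
        by (rule sum.subset_diff[OF pN(1) pD(1)])
      ultimately show ?thesis unfolding eq using e1(2) by linarith
    qed
    show "\<exists>\<gamma>. gauge \<gamma> \<and> (\<forall>p. p tagged_division_of {a..b} \<and> \<gamma> fine p \<longrightarrow>
        norm ((\<Sum>(x, K)\<in>p. measure lborel K *\<^sub>R g0 x) - (f b - f a)) < e)"
      by (intro exI[of _ \<gamma>] conjI allI impI gau) (elim conjE, rule close)
  qed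
  then show ?thesis
    by (rule has_integral_spike[OF N, rotated]) (simp add: g0_def)
qed

text \<open>Each coordinate is dominated by the curve itself and so has bounded variation. The
  endpoints are put into \<open>N\<close> for later use, so that one-sided and two-sided derivatives
  agree off \<open>N\<close>.\<close>

theorem abs_continuous_on_differentiable_ae:
  fixes f :: "real \<Rightarrow> 'a::euclidean_space"
  assumes ac: "abs_continuous_on a b f" and "a \<le> b"
  obtains N where "negligible N" "a \<in> N" "b \<in> N"
    "\<And>x. x \<in> {a..b} - N \<Longrightarrow> (f has_vector_derivative vector_derivative f (at x)) (at x)"
proof -
  define B where "B = (\<lambda>i. {x \<in> {a..b}. \<not> (\<exists>D. ((\<lambda>x. f x \<bullet> i) has_real_derivative D) (at x))})"
  have "negligible (B i)" if "i \<in> Basis" for i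
    unfolding B_def
  proof (intro bdd_var_differentiable_ae abs_continuous_on_bdd_var \<open>a \<le> b\<close>)
    show "abs_continuous_on a b (\<lambda>x. f x \<bullet> i)"
    proof (rule abs_continuous_on_dominated[OF ac])
      fix u v show "norm (f v \<bullet> i - f u \<bullet> i) \<le> norm (f v - f u)"
        using Basis_le_norm[OF that, of "f v - f u"] by (simp add: inner_diff_left)
    qed
  qed
  then have "negligible ((\<Union>i\<in>Basis. B i) \<union> {a, b})"
    by (intro negligible_Un negligible_Union) auto
  moreover have "(f has_vector_derivative vector_derivative f (at x)) (at x)"
    if x: "x \<in> {a..b} - ((\<Union>i\<in>Basis. B i) \<union> {a, b})" for x
  proof -
    have "\<forall>i\<in>Basis. \<exists>D. ((\<lambda>x. f x \<bullet> i) has_real_derivative D) (at x)"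
      using x unfolding B_def by auto
    then obtain D where D: "\<And>i. i \<in> Basis \<Longrightarrow> ((\<lambda>x. f x \<bullet> i) has_real_derivative D i) (at x)"
      by metis
    have "(f has_vector_derivative (\<Sum>i\<in>Basis. D i *\<^sub>R i)) (at x)"
      unfolding has_vector_derivative_def
    proof (subst has_derivative_componentwise_within, rule ballI)
      fix i :: 'a assume i: "i \<in> Basis"
      have "((\<lambda>x. f x \<bullet> i) has_derivative (\<lambda>h. h * D i)) (at x)"
        using D[OF i] by (simp add: has_field_derivative_def mult_commute_abs)
      then show "((\<lambda>x. f x \<bullet> i) has_derivative (\<lambda>h. h *\<^sub>R (\<Sum>i\<in>Basis. D i *\<^sub>R i) \<bullet> i)) (at x)"
        using i by simp
    qed
    then show ?thesis using vector_derivative_works differentiableI_vector by blast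
  qed
  ultimately show ?thesis by (intro that[of "(\<Union>i\<in>Basis. B i) \<union> {a, b}"]) auto
qed

section \<open>One-dimensional trajectories\<close>

text \<open>With \<open>M = y powr \<theta>\<close>, add \<open>ln z \<le> z - 1\<close> at
  \<open>z = 1 / M\<close> and \<open>z = y / M\<close> with weights 1 - \<theta> and \<theta>: the
  weighted logarithms cancel. Equality in the sum forces equality in the first term, hence
  \<open>M = 1\<close>.\<close>

lemma powr_le_tangent:
  fixes y \<theta> :: real
  assumes "0 < y" "0 < \<theta>" "\<theta> < 1"
  shows "y powr \<theta> \<le> 1 - \<theta> + \<theta> * y" "y powr \<theta> = 1 - \<theta> + \<theta> * y \<Longrightarrow> y = 1"
proof -
  define M where "M = y powr \<theta>"
  have M: "M > 0" "ln M = \<theta> * ln y" using assms by (simp_all add: M_def)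
  have 1: "ln (1 / M) \<le> 1 / M - 1" "ln (y / M) \<le> y / M - 1"
    using M assms by (auto intro!: ln_le_minus_one)
  have eq: "(1 - \<theta>) * ln (1 / M) + \<theta> * ln (y / M) = 0"
    using M assms by (simp add: ln_div algebra_simps)
  have 2: "(1 - \<theta>) * ln (1 / M) \<le> (1 - \<theta>) * (1 / M - 1)" "\<theta> * ln (y / M) \<le> \<theta> * (y / M - 1)"
    using 1 assms by (auto intro!: mult_left_mono)
  have 3: "(1 - \<theta>) * (1 / M - 1) + \<theta> * (y / M - 1) = (1 - \<theta> + \<theta> * y) / M - 1"
    using M by (simp add: field_simps)
  have "1 \<le> (1 - \<theta> + \<theta> * y) / M" using 2 3 eq by linarith
  then show "y powr \<theta> \<le> 1 - \<theta> + \<theta> * y" using M by (simp add: M_def[symmetric] pos_le_divide_eq)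
  assume "y powr \<theta> = 1 - \<theta> + \<theta> * y"
  then have "(1 - \<theta> + \<theta> * y) / M = 1" using M by (simp add: M_def)
  then have "(1 - \<theta>) * ln (1 / M) = (1 - \<theta>) * (1 / M - 1)" using 2 3 eq by linarith
  then have "ln (1 / M) = 1 / M - 1" using assms by simp
  then have "1 / M = 1" using M ln_eq_minus_one[of "1 / M"] by simp
  then have "\<theta> * ln y = 0" using M by simp
  then show "y = 1" using assms by simp
qed

text \<open>Division by \<open>a powr \<beta>\<close> reduces this to the tangent inequality at
  \<open>y = (b / a) powr \<beta>\<close> with \<theta> = 1/\<beta>. The equality case is what later
  identifies the velocity of a free minimizer.\<close>

lemma powr_Young:
  fixes a b \<beta> :: real
  assumes "1 < \<beta>" "0 \<le> a" "0 \<le> b"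
  shows "a powr (\<beta> - 1) * b \<le> (1 - 1 / \<beta>) * a powr \<beta> + 1 / \<beta> * b powr \<beta>"
    "a powr (\<beta> - 1) * b = (1 - 1 / \<beta>) * a powr \<beta> + 1 / \<beta> * b powr \<beta> \<Longrightarrow> a = b"
proof -
  have pos: "1 - 1 / \<beta> > 0" "1 / \<beta> > 0" "1 / \<beta> < 1" using assms by auto
  consider "a = 0" | "b = 0" "a > 0" | "a > 0" "b > 0" using assms by fastforce
  then have "a powr (\<beta> - 1) * b \<le> (1 - 1 / \<beta>) * a powr \<beta> + 1 / \<beta> * b powr \<beta> \<and>
    (a powr (\<beta> - 1) * b = (1 - 1 / \<beta>) * a powr \<beta> + 1 / \<beta> * b powr \<beta> \<longrightarrow> a = b)"
  proof cases
    case 1 then show ?thesis using assms by auto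
  next
    case 2 then show ?thesis using assms pos by auto
  next
    case 3
    define y where "y = (b / a) powr \<beta>"
    have y: "y > 0" "y powr (1 / \<beta>) = b / a" using 3 assms by (simp_all add: y_def powr_powr)
    have ay: "a powr \<beta> * y = b powr \<beta>" using 3 by (simp add: y_def powr_divide)
    have ab: "a powr (\<beta> - 1) * b = a powr \<beta> * (b / a)" using 3 by (simp add: powr_diff)
    have r: "(1 - 1 / \<beta>) * a powr \<beta> + 1 / \<beta> * b powr \<beta> = a powr \<beta> * (1 - 1 / \<beta> + 1 / \<beta> * y)"
      unfolding ay[symmetric] by (simp add: algebra_simps)
    have apos: "a powr \<beta> > 0" using 3 by simp
    have "b / a \<le> 1 - 1 / \<beta> + 1 / \<beta> * y" using powr_le_tangent(1)[OF y(1) pos(2,3)] y(2) by simp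
    then have "a powr \<beta> * (b / a) \<le> a powr \<beta> * (1 - 1 / \<beta> + 1 / \<beta> * y)"
      using apos by (intro mult_left_mono) auto
    moreover have "a = b" if "a powr \<beta> * (b / a) = a powr \<beta> * (1 - 1 / \<beta> + 1 / \<beta> * y)"
    proof -
      have "b / a = 1 - 1 / \<beta> + 1 / \<beta> * y"
        using that apos by (metis mult_left_cancel less_irrefl)
      then have "y = 1" using powr_le_tangent(2)[OF y(1) pos(2,3)] y(2) by simp
      then show "a = b" using y 3 by simp
    qed
    ultimately show ?thesis unfolding ab r by blast
  qed
  then show "a powr (\<beta> - 1) * b \<le> (1 - 1 / \<beta>) * a powr \<beta> + 1 / \<beta> * b powr \<beta>"
    "a powr (\<beta> - 1) * b = (1 - 1 / \<beta>) * a powr \<beta> + 1 / \<beta> * b powr \<beta> \<Longrightarrow> a = b"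
    by blast+
qed

definition momentum :: "real \<Rightarrow> real \<Rightarrow> real" where
  "momentum \<beta> u = u powr (\<beta> - 1)"

definition energy :: "real \<Rightarrow> real \<Rightarrow> real" where
  "energy \<beta> u = (1 - 1 / \<beta>) * u powr \<beta>"

lemma momentum_nonneg: "0 \<le> momentum \<beta> u"
  by (simp add: momentum_def)

lemma energy_nonneg: "1 < \<beta> \<Longrightarrow> 0 \<le> energy \<beta> u"
  by (simp add: energy_def)

lemma momentum_0: "momentum \<beta> 0 = 0"
  by (simp add: momentum_def)

lemma energy_0: "energy \<beta> 0 = 0"
  by (simp add: energy_def)

lemma momentum_strict_mono: "1 < \<beta> \<Longrightarrow> 0 \<le> u \<Longrightarrow> u < w \<Longrightarrow> momentum \<beta> u < momentum \<beta> w"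
  unfolding momentum_def by (intro powr_less_mono2) auto

text \<open>The line with slope \<open>momentum \<beta> u\<close> and intercept
  \<open>- energy \<beta> u\<close> is the tangent at \<open>u\<close> of the convex function
  \<open>1 / \<beta> * \<bar>w\<bar> powr \<beta>\<close>.\<close>

lemma Young_momentum:
  assumes "1 < \<beta>" "0 \<le> u"
  shows "momentum \<beta> u * w - energy \<beta> u \<le> 1 / \<beta> * \<bar>w\<bar> powr \<beta>"
proof -
  have "momentum \<beta> u * w \<le> momentum \<beta> u * \<bar>w\<bar>" by (intro mult_left_mono momentum_nonneg) simp
  then show ?thesis using powr_Young(1)[OF assms, of "\<bar>w\<bar>"] by (simp add: momentum_def energy_def)
qed

lemma Young_momentum_eq:
  assumes "1 < \<beta>" "0 \<le> u"
  shows "1 / \<beta> * \<bar>u\<bar> powr \<beta> = momentum \<beta> u * u - energy \<beta> u"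
proof -
  have "u powr (\<beta> - 1) * u = u powr \<beta>"
    using assms by (cases "u = 0") (auto simp: powr_diff)
  then show ?thesis using assms by (simp add: momentum_def energy_def algebra_simps)
qed

section \<open>Scalar trajectories of finite action and lower bounds for it\<close>

text \<open>The velocity is a separate datum, tied to \<open>h\<close> only through integrals.
  Unlike \<open>velocity\<close>, it does not change when the time interval is cut or
  shortened.\<close>

definition traj :: "real \<Rightarrow> real \<Rightarrow> real \<Rightarrow> (real \<Rightarrow> real) \<Rightarrow> (real \<Rightarrow> real) \<Rightarrow> bool" where
  "traj \<beta> a b h v \<longleftrightarrow> (\<forall>s\<in>{a..b}. (v has_integral (h s - h a)) {a..s}) \<and>
     (\<lambda>s. \<bar>v s\<bar> powr \<beta>) integrable_on {a..b}"

definition act :: "real \<Rightarrow> (real \<Rightarrow> real \<Rightarrow> real) \<Rightarrow> real \<Rightarrow> real \<Rightarrow> (real \<Rightarrow> real) \<Rightarrow> (real \<Rightarrow> real) \<Rightarrow> real" where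
  "act \<beta> V a b h v = integral {a..b} (\<lambda>s. 1 / \<beta> * \<bar>v s\<bar> powr \<beta> - V (h s) s)"

lemma trajD:
  assumes "traj \<beta> a b h v" "a \<le> c" "c \<le> d" "d \<le> b"
  shows "(v has_integral (h d - h c)) {c..d}"
proof -
  have 1: "(v has_integral (h d - h a)) {a..d}" "(v has_integral (h c - h a)) {a..c}"
    using assms unfolding traj_def by auto
  then have i: "v integrable_on {c..d}"
    using integrable_on_subinterval[OF has_integral_integrable[OF 1(1)], of c d] assms(2) by simp
  have "integral {a..c} v + integral {c..d} v = integral {a..d} v"
    by (rule Henstock_Kurzweil_Integration.integral_combine[OF assms(2,3) has_integral_integrable[OF 1(1)]])
  then have "integral {c..d} v = h d - h c"
    using 1 by (simp add: integral_unique)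
  then show ?thesis using i by (simp add: has_integral_iff)
qed

lemma traj_subset:
  assumes "traj \<beta> a b h v" "a \<le> c" "c \<le> d" "d \<le> b"
  shows "traj \<beta> c d h v"
  unfolding traj_def
proof (intro conjI ballI)
  show "(v has_integral (h s - h c)) {c..s}" if "s \<in> {c..d}" for s
    using trajD[OF assms(1,2), of s] that assms by auto
  show "(\<lambda>s. \<bar>v s\<bar> powr \<beta>) integrable_on {c..d}"
    using integrable_on_subinterval[of "\<lambda>s. \<bar>v s\<bar> powr \<beta>" "{a..b}" c d] assms unfolding traj_def by simp
qed

lemma traj_continuous:
  assumes "traj \<beta> a b h v"
  shows "continuous_on {a..b} h"
proof (cases "a \<le> b")
  case True
  have "v integrable_on {a..b}"
    using assms True unfolding traj_def by (intro has_integral_integrable[of v "h b - h a"]) auto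
  then have "continuous_on {a..b} (\<lambda>s. h a + integral {a..s} v)"
    by (intro continuous_intros indefinite_integral_continuous_1)
  moreover have "h a + integral {a..s} v = h s" if "s \<in> {a..b}" for s
    using integral_unique[OF trajD[OF assms, of a s]] that by simp
  ultimately show ?thesis by (rule continuous_on_eq)
qed simp

lemma continuous_on_along_path:
  assumes "continuous_on UNIV (\<lambda>(x, t). V x t)" "continuous_on S h"
  shows "continuous_on S (\<lambda>s::real. V (h s) s :: real)"
proof -
  have "continuous_on S (\<lambda>s. (\<lambda>(x, t). V x t) (h s, s))"
    by (intro continuous_on_compose2[OF assms(1)] continuous_intros assms(2)) auto
  then show ?thesis by simp
qed

lemma act_integrable:
  assumes "traj \<beta> a b h v" "continuous_on UNIV (\<lambda>(x, t). V x t)"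
  shows "(\<lambda>s. V (h s) s) integrable_on {a..b}" "(\<lambda>s. 1 / \<beta> * \<bar>v s\<bar> powr \<beta>) integrable_on {a..b}"
    "(\<lambda>s. 1 / \<beta> * \<bar>v s\<bar> powr \<beta> - V (h s) s) integrable_on {a..b}"
proof -
  show 1: "(\<lambda>s. V (h s) s) integrable_on {a..b}"
    by (intro integrable_continuous_real continuous_on_along_path[OF assms(2)] traj_continuous[OF assms(1)])
  show 2: "(\<lambda>s. 1 / \<beta> * \<bar>v s\<bar> powr \<beta>) integrable_on {a..b}"
    using assms(1) integrable_on_mult_right[of "\<lambda>s. \<bar>v s\<bar> powr \<beta>" "{a..b}" "1 / \<beta>"]
    by (simp add: traj_def)
  show "(\<lambda>s. 1 / \<beta> * \<bar>v s\<bar> powr \<beta> - V (h s) s) integrable_on {a..b}"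
    by (rule integrable_diff[OF 2 1])
qed

lemma act_split:
  assumes "traj \<beta> a c h v" "continuous_on UNIV (\<lambda>(x, t). V x t)" "a \<le> b" "b \<le> c"
  shows "act \<beta> V a c h v = act \<beta> V a b h v + act \<beta> V b c h v"
  unfolding act_def
  by (rule Henstock_Kurzweil_Integration.integral_combine[symmetric, OF assms(3,4)])
    (rule act_integrable(3)[OF assms(1,2)])

lemma act_cong:
  assumes "\<And>s. s \<in> {a..b} \<Longrightarrow> h s = h' s" "\<And>s. s \<in> {a..b} \<Longrightarrow> v s = v' s"
    "\<And>s x. s \<in> {a..b} \<Longrightarrow> V x s = V' x s"
  shows "act \<beta> V a b h v = act \<beta> V' a b h' v'"
  unfolding act_def using assms by (intro integral_cong) auto

text \<open>Young's inequality with slope \<open>momentum \<beta> u\<close>, integrated along the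
  trajectory; any \<open>u\<close> may be chosen, whatever the actual speed. The choice
  \<open>u = 0\<close> gives the crude bound by the potential alone.\<close>

lemma act_ge_momentum:
  assumes \<beta>: "1 < \<beta>" and tr: "traj \<beta> a b h v" and V: "continuous_on UNIV (\<lambda>(x, t). V x t)"
    and "a \<le> b" and u: "0 \<le> u" and m: "\<And>s. s \<in> {a..b} \<Longrightarrow> V (h s) s \<le> m"
  shows "momentum \<beta> u * (h b - h a) - (energy \<beta> u + m) * (b - a) \<le> act \<beta> V a b h v"
proof -
  have vi: "(v has_integral (h b - h a)) {a..b}" using trajD[OF tr, of a b] \<open>a \<le> b\<close> by simp
  have "((\<lambda>s. momentum \<beta> u * v s - (energy \<beta> u + m)) has_integral
      (momentum \<beta> u * (h b - h a) - (energy \<beta> u + m) * (b - a))) {a..b}"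
    using has_integral_diff[OF has_integral_mult_right[OF vi, of "momentum \<beta> u"]
        has_integral_const_real[of "energy \<beta> u + m" a b]] \<open>a \<le> b\<close>
    by (simp add: mult.commute)
  then show ?thesis
    unfolding act_def
  proof (rule has_integral_le)
    show "((\<lambda>s. 1 / \<beta> * \<bar>v s\<bar> powr \<beta> - V (h s) s) has_integral
       integral {a..b} (\<lambda>s. 1 / \<beta> * \<bar>v s\<bar> powr \<beta> - V (h s) s)) {a..b}"
      using act_integrable(3)[OF tr V] by (rule integrable_integral)
    show "momentum \<beta> u * v s - (energy \<beta> u + m) \<le> 1 / \<beta> * \<bar>v s\<bar> powr \<beta> - V (h s) s"
      if "s \<in> {a..b}" for s
      using Young_momentum[OF \<beta> u, of "v s"] m[OF that] by linarith
  qed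
qed

text \<open>Truncating the linear profile on the right keeps it a lower bound on the whole line, so that
  trajectories coming from far away need no separate treatment.\<close>

lemma act_ge_truncated:
  assumes \<beta>: "1 < \<beta>" and tr: "traj \<beta> a b h v" and V: "continuous_on UNIV (\<lambda>(x, t). V x t)"
    and "a \<le> b" and u: "0 \<le> u" and m: "\<And>s. s \<in> {a..b} \<Longrightarrow> V (h s) s \<le> m"
  shows "momentum \<beta> u * min (h b) R - (energy \<beta> u + m) * (b - a) \<le>
    momentum \<beta> u * min (h a) R + act \<beta> V a b h v"
proof (cases "h a \<le> R")
  case True
  have "momentum \<beta> u * min (h b) R \<le> momentum \<beta> u * h b"
    by (intro mult_left_mono momentum_nonneg) simp
  then show ?thesis using True act_ge_momentum[OF assms] by (simp add: algebra_simps)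
next
  \<comment> \<open>Here the start lies beyond \<open>R\<close> and already has the full truncated
    value, so the remaining action only has to be bounded through the potential, that is, with
    \<open>u = 0\<close>.\<close>
  case False
  have "0 \<le> energy \<beta> u * (b - a)" using energy_nonneg[OF \<beta>] \<open>a \<le> b\<close> by simp
  moreover have "- m * (b - a) \<le> act \<beta> V a b h v"
    using act_ge_momentum[OF \<beta> tr V \<open>a \<le> b\<close> order.refl m] by (simp add: momentum_0 energy_0)
  moreover have "momentum \<beta> u * min (h b) R \<le> momentum \<beta> u * R"
    by (intro mult_left_mono momentum_nonneg) simp
  ultimately show ?thesis using False by (simp add: algebra_simps)
qed

section \<open>Piecewise linear competitors\<close>

text \<open>The extra conditions are those needed to lift \<open>h\<close> to an admissible curve:
  the Lipschitz bound gives absolute continuity, and the derivative off a finite set identifies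
  \<open>velocity\<close> with \<open>v\<close> up to a null set.\<close>

definition competitor :: "real \<Rightarrow> real \<Rightarrow> real \<Rightarrow> (real \<Rightarrow> real) \<Rightarrow> (real \<Rightarrow> real) \<Rightarrow> bool" where
  "competitor \<beta> a b h v \<longleftrightarrow> traj \<beta> a b h v \<and>
     (\<exists>S. finite S \<and> (\<forall>s\<in>{a<..<b} - S. (h has_real_derivative v s) (at s))) \<and>
     (\<exists>L. L-lipschitz_on {a..b} h)"

lemma competitor_const:
  assumes "1 < \<beta>"
  shows "competitor \<beta> a b (\<lambda>_. x) (\<lambda>_. 0)"
proof -
  have "0-lipschitz_on {a..b} (\<lambda>_. x)" by (rule lipschitz_onI) auto
  then show ?thesis
    using assms unfolding competitor_def traj_def
    by (auto intro!: exI[of _ "{}"] exI[of _ "0::real"] integrable_0)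
qed

lemma competitor_extend:
  fixes w :: real
  assumes \<beta>: "1 < \<beta>" and c: "competitor \<beta> a b h v" and ab: "a \<le> b" "b \<le> c"
  defines "h' \<equiv> (\<lambda>s. if s \<le> b then h s else h b + w * (s - b))"
    and "v' \<equiv> (\<lambda>s. if s \<le> b then v s else w)"
  shows "competitor \<beta> a c h' v'"
proof -
  have tr: "traj \<beta> a b h v" using c by (simp add: competitor_def)
  have w: "((\<lambda>s. F (v' s)) has_integral F w * (s - b)) {b..s}" if "b \<le> s" for s and F :: "real \<Rightarrow> real"
  proof -
    have "((\<lambda>s. F w) has_integral F w * (s - b)) {b..s}"
      using has_integral_const_real[of "F w" b s] that by (simp add: mult.commute)
    then show ?thesis
      by (rule has_integral_spike[of "{b}", rotated 2]) (auto simp: v'_def)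
  qed
  have v: "((\<lambda>s. F (v' s)) has_integral i) {a..s}" if "((\<lambda>s. F (v s)) has_integral i) {a..s}" "s \<le> b"
    for s i and F :: "real \<Rightarrow> real"
    using that by (subst has_integral_cong[of _ _ "\<lambda>s. F (v s)"]) (auto simp: v'_def)
  have "traj \<beta> a c h' v'"
    unfolding traj_def
  proof (intro conjI ballI)
    fix s assume s: "s \<in> {a..c}"
    show "(v' has_integral (h' s - h' a)) {a..s}"
    proof (cases "s \<le> b")
      case True
      then show ?thesis
        using v[of "\<lambda>x. x" "h s - h a" s] trajD[OF tr, of a s] s ab by (auto simp: h'_def)
    next
      case False
      have "(v' has_integral (h b - h a)) {a..b}"
        using v[of "\<lambda>x. x" "h b - h a" b] trajD[OF tr, of a b] ab by auto
      from has_integral_combine[OF ab(1) _ this w[of s "\<lambda>x. x"]] False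
      show ?thesis using ab by (simp add: h'_def algebra_simps)
    qed
  next
    have "((\<lambda>s. \<bar>v s\<bar> powr \<beta>) has_integral integral {a..b} (\<lambda>s. \<bar>v s\<bar> powr \<beta>)) {a..b}"
      using tr unfolding traj_def by (intro integrable_integral) auto
    then have "((\<lambda>s. \<bar>v' s\<bar> powr \<beta>) has_integral integral {a..b} (\<lambda>s. \<bar>v s\<bar> powr \<beta>)) {a..b}"
      by (intro v[of "\<lambda>x. \<bar>x\<bar> powr \<beta>"]) auto
    from has_integral_combine[OF ab this w[of c "\<lambda>x. \<bar>x\<bar> powr \<beta>"]] ab
    show "(\<lambda>s. \<bar>v' s\<bar> powr \<beta>) integrable_on {a..c}"
      by auto
  qed
  moreover have "\<exists>S. finite S \<and> (\<forall>s\<in>{a<..<c} - S. (h' has_real_derivative v' s) (at s))"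
  proof -
    obtain S where S: "finite S" "\<And>s. s \<in> {a<..<b} - S \<Longrightarrow> (h has_real_derivative v s) (at s)"
      using c unfolding competitor_def by blast
    have "(h' has_real_derivative v' s) (at s)" if s: "s \<in> {a<..<c} - insert b S" for s
    proof (cases "s < b")
      case True
      have "(h has_real_derivative v' s) (at s)" using S(2)[of s] s True by (simp add: v'_def)
      then show ?thesis
        by (rule has_field_derivative_transform_within_open[of _ _ _ "{..<b}"])
          (use True in \<open>auto simp: h'_def\<close>)
    next
      case False
      have "((\<lambda>s. h b + w * (s - b)) has_real_derivative v' s) (at s)"
        using False s by (auto intro!: derivative_eq_intros simp: v'_def)
      then show ?thesis
        by (rule has_field_derivative_transform_within_open[of _ _ _ "{b<..}"])
          (use False s in \<open>auto simp: h'_def\<close>)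
    qed
    then show ?thesis using S(1) by (intro exI[of _ "insert b S"]) auto
  qed
  moreover have "\<exists>L. L-lipschitz_on {a..c} h'"
  proof -
    obtain L where L: "L-lipschitz_on {a..b} h" using c unfolding competitor_def by blast
    have "(max L \<bar>w\<bar>)-lipschitz_on {b..c} (\<lambda>s. h b + w * (s - b))"
    proof (rule lipschitz_onI)
      fix x y
      have "dist (h b + w * (x - b)) (h b + w * (y - b)) = \<bar>w\<bar> * dist x y"
        by (simp add: dist_real_def abs_mult[symmetric] algebra_simps)
      also have "\<dots> \<le> max L \<bar>w\<bar> * dist x y" by (intro mult_right_mono) auto
      finally show "dist (h b + w * (x - b)) (h b + w * (y - b)) \<le> max L \<bar>w\<bar> * dist x y" .
    qed simp
    then have "(max L \<bar>w\<bar>)-lipschitz_on {a..c} h'"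
      unfolding h'_def by (intro lipschitz_on_concat lipschitz_on_le[OF L]) auto
    then show ?thesis by blast
  qed
  ultimately show ?thesis unfolding competitor_def by blast
qed

lemma competitor_extend_act:
  fixes w :: real
  assumes \<beta>: "1 < \<beta>" and c: "competitor \<beta> a b h v" and ab: "a \<le> b" "b \<le> c"
    and V: "continuous_on UNIV (\<lambda>(x, t). V x t)"
  obtains h' v' where "competitor \<beta> a c h' v'" "h' c = h b + w * (c - b)"
    "act \<beta> V a c h' v' = act \<beta> V a b h v + 1 / \<beta> * \<bar>w\<bar> powr \<beta> * (c - b) -
       integral {b..c} (\<lambda>s. V (h b + w * (s - b)) s)"
proof -
  define h' where "h' = (\<lambda>s. if s \<le> b then h s else h b + w * (s - b))"
  define v' where "v' = (\<lambda>s. if s \<le> b then v s else w)"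
  have c': "competitor \<beta> a c h' v'"
    unfolding h'_def v'_def by (rule competitor_extend[OF \<beta> c ab])
  have "act \<beta> V a c h' v' = act \<beta> V a b h' v' + act \<beta> V b c h' v'"
    using c' by (intro act_split[OF _ V ab]) (simp add: competitor_def)
  also have "act \<beta> V a b h' v' = act \<beta> V a b h v"
    by (rule act_cong) (auto simp: h'_def v'_def)
  also have "act \<beta> V b c h' v' = integral {b..c} (\<lambda>s. 1 / \<beta> * \<bar>w\<bar> powr \<beta> - V (h b + w * (s - b)) s)"
    unfolding act_def by (rule integral_spike[of "{b}"]) (auto simp: h'_def v'_def)
  also have "\<dots> = 1 / \<beta> * \<bar>w\<bar> powr \<beta> * (c - b) - integral {b..c} (\<lambda>s. V (h b + w * (s - b)) s)"
  proof (subst Henstock_Kurzweil_Integration.integral_diff)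
    show "(\<lambda>s. V (h b + w * (s - b)) s) integrable_on {b..c}"
      by (intro integrable_continuous_real continuous_on_along_path[OF V] continuous_intros)
  qed (use ab in \<open>auto simp: mult.commute\<close>)
  finally show ?thesis using c' ab by (intro that[of h' v']) (auto simp: h'_def)
qed

section \<open>Accelerating layers\<close>

text \<open>A quadratic spline descending from 1 to 0 on [0, 1]: it is 1 - 2 x^2 up to 1/2 and 2 (1
  - x)^2 afterwards. Its slope is at most 2 in absolute value, so height C/2 keeps the gradient
  within C.\<close>

definition bump :: "real \<Rightarrow> real" where
  "bump x = 1 - 2 * (max 0 x)\<^sup>2 + 4 * (max 0 (x - 1 / 2))\<^sup>2 - 2 * (max 0 (x - 1))\<^sup>2"

definition bump_deriv :: "real \<Rightarrow> real" where
  "bump_deriv x = - 4 * max 0 x + 8 * max 0 (x - 1 / 2) - 4 * max 0 (x - 1)"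

lemma DERIV_pos_part_square:
  "((\<lambda>x::real. (max 0 x)\<^sup>2) has_real_derivative 2 * max 0 x) (at x)"
proof -
  consider "x > 0" | "x < 0" | "x = 0" by linarith
  then show ?thesis
  proof cases
    case 1
    have "((\<lambda>x::real. x\<^sup>2) has_real_derivative 2 * max 0 x) (at x)"
      using 1 by (auto intro!: derivative_eq_intros)
    then show ?thesis
      by (rule has_field_derivative_transform_within_open[of _ _ _ "{0<..}"]) (use 1 in auto)
  next
    case 2
    have "((\<lambda>x::real. 0) has_real_derivative 2 * max 0 x) (at x)"
      using 2 by (auto intro!: derivative_eq_intros)
    then show ?thesis
      by (rule has_field_derivative_transform_within_open[of _ _ _ "{..<0}"]) (use 2 in auto)
  next
    case 3
    have "((\<lambda>y::real. max 0 y) \<longlongrightarrow> max 0 0) (at 0)"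
      by (intro tendsto_intros)
    then have "((\<lambda>y::real. max 0 y) \<longlongrightarrow> 0) (at 0)" by simp
    then have "((\<lambda>y::real. ((max 0 y)\<^sup>2 - (max 0 0)\<^sup>2) / (y - 0)) \<longlongrightarrow> 0) (at 0)"
      by (rule Lim_transform_eventually)
        (auto simp: eventually_at_filter max_def power2_eq_square)
    then show ?thesis using 3 by (simp add: has_field_derivative_iff)
  qed
qed

lemma DERIV_bump: "(bump has_real_derivative bump_deriv x) (at x)"
proof -
  have *: "((\<lambda>x::real. (max 0 (x - c))\<^sup>2) has_real_derivative 2 * max 0 (x - c)) (at x)" for c
  proof -
    have "((\<lambda>x. x - c) has_real_derivative 1) (at x)" by (auto intro!: derivative_eq_intros)
    from DERIV_chain2[OF DERIV_pos_part_square this] show ?thesis by simp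
  qed
  have "((\<lambda>x. 1 - 2 * (max 0 x)\<^sup>2 + 4 * (max 0 (x - 1 / 2))\<^sup>2 - 2 * (max 0 (x - 1))\<^sup>2)
      has_real_derivative bump_deriv x) (at x)"
    unfolding bump_deriv_def
    by (rule derivative_eq_intros DERIV_pos_part_square * refl)+ simp
  then show ?thesis unfolding bump_def[abs_def] .
qed

lemma bump_left: "x \<le> 0 \<Longrightarrow> bump x = 1"
  by (simp add: bump_def max_def)

lemma bump_right: "1 \<le> x \<Longrightarrow> bump x = 0"
  by (simp add: bump_def max_def power2_eq_square algebra_simps)

lemma bump_bounds: "0 \<le> bump x" "bump x \<le> 1"
proof -
  consider "x \<le> 0" | "0 < x" "x \<le> 1 / 2" | "1 / 2 < x" "x < 1" | "1 \<le> x" by linarith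
  then have "0 \<le> bump x \<and> bump x \<le> 1"
  proof cases
    case 2
    have "x\<^sup>2 \<le> (1 / 2)\<^sup>2" using 2 by (intro power_mono) auto
    moreover have "max 0 x = x" "max 0 (x - 1 / 2) = 0" "max 0 (x - 1) = 0" using 2 by auto
    then have "bump x = 1 - 2 * x\<^sup>2" by (simp add: bump_def)
    ultimately show ?thesis by (simp add: power2_eq_square)
  next
    case 3
    have "bump x = 2 * (1 - x)\<^sup>2" using 3 by (simp add: bump_def max_def power2_eq_square algebra_simps)
    moreover have "(1 - x)\<^sup>2 \<le> (1 / 2)\<^sup>2" using 3 by (intro power_mono) auto
    ultimately show ?thesis by (simp add: power2_eq_square)
  qed (auto simp: bump_left bump_right)
  then show "0 \<le> bump x" "bump x \<le> 1" by auto
qed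

lemma bump_deriv_bound: "\<bar>bump_deriv x\<bar> \<le> 2"
  by (auto simp: bump_deriv_def max_def)

text \<open>A trapezoid with ramps of length \<delta>. Vanishing at both ends lets layers be joined
  continuously in time; the ramps shorten the action of the potential, a loss accounted for in the
  choice of \<delta>.\<close>

definition cutoff :: "real \<Rightarrow> real \<Rightarrow> real \<Rightarrow> real \<Rightarrow> real" where
  "cutoff \<delta> a b t = max 0 (min 1 (min ((t - a) / \<delta>) ((b - t) / \<delta>)))"

lemma cutoff_bounds: "0 \<le> cutoff \<delta> a b t" "cutoff \<delta> a b t \<le> 1"
  by (auto simp: cutoff_def)

lemma cutoff_eq_0:
  assumes "\<delta> > 0" "t \<notin> {a<..<b}"
  shows "cutoff \<delta> a b t = 0"
proof -
  have "(t - a) / \<delta> \<le> 0 \<or> (b - t) / \<delta> \<le> 0" using assms by (auto simp: divide_le_0_iff)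
  then show ?thesis by (auto simp: cutoff_def)
qed

lemma cutoff_eq_1:
  assumes "\<delta> > 0" "a + \<delta> \<le> t" "t \<le> b - \<delta>"
  shows "cutoff \<delta> a b t = 1"
proof -
  have "1 \<le> (t - a) / \<delta>" "1 \<le> (b - t) / \<delta>" using assms by (simp_all add: le_divide_eq)
  then show ?thesis by (simp add: cutoff_def)
qed

lemma continuous_on_cutoff: "\<delta> > 0 \<Longrightarrow> continuous_on S (cutoff \<delta> a b)"
  unfolding cutoff_def[abs_def] by (intro continuous_intros) auto

section \<open>Potentials supported in a time interval\<close>

definition potential_on :: "real \<Rightarrow> real \<Rightarrow> real \<Rightarrow> (real \<Rightarrow> real \<Rightarrow> real) \<Rightarrow> (real \<Rightarrow> real \<Rightarrow> real) \<Rightarrow> bool" where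
  "potential_on C a b V DV \<longleftrightarrow> continuous_on UNIV (\<lambda>(x, t). V x t) \<and>
     (\<forall>x t. ((\<lambda>y. V y t) has_real_derivative DV x t) (at x)) \<and>
     (\<forall>t. continuous_on UNIV (\<lambda>x. DV x t)) \<and>
     (\<forall>x t. 0 \<le> V x t \<and> V x t \<le> C \<and> \<bar>DV x t\<bar> \<le> C) \<and>
     (\<forall>x t. t \<notin> {a<..<b} \<longrightarrow> V x t = 0 \<and> DV x t = 0)"

lemma potential_on_0: "0 \<le> C \<Longrightarrow> potential_on C a b (\<lambda>_ _. 0) (\<lambda>_ _. 0)"
  by (simp add: potential_on_def case_prod_unfold)

text \<open>At each time at most one summand is nonzero, so the bounds by \<open>C\<close> are not
  added.\<close>

lemma potential_on_concat:
  assumes V: "potential_on C a b V DV" and W: "potential_on C b c W DW" and "a \<le> b" "b \<le> c"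
  shows "potential_on C a c (\<lambda>x t. V x t + W x t) (\<lambda>x t. DV x t + DW x t)"
  unfolding potential_on_def
proof (intro conjI allI impI)
  have "continuous_on UNIV (\<lambda>p. (\<lambda>(x, t). V x t) p + (\<lambda>(x, t). W x t) p)"
    using V W unfolding potential_on_def by (intro continuous_intros) auto
  then show "continuous_on UNIV (\<lambda>(x, t). V x t + W x t)" by (simp add: case_prod_unfold)
  show "((\<lambda>y. V y t + W y t) has_real_derivative DV x t + DW x t) (at x)" for x t
    using V W unfolding potential_on_def by (intro DERIV_add) auto
  show "continuous_on UNIV (\<lambda>x. DV x t + DW x t)" for t
    using V W unfolding potential_on_def by (intro continuous_intros) auto
  fix x t
  have V': "0 \<le> V x t" "V x t \<le> C" "\<bar>DV x t\<bar> \<le> C" "t \<notin> {a<..<b} \<longrightarrow> V x t = 0 \<and> DV x t = 0"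
    and W': "0 \<le> W x t" "W x t \<le> C" "\<bar>DW x t\<bar> \<le> C" "t \<notin> {b<..<c} \<longrightarrow> W x t = 0 \<and> DW x t = 0"
    using V W unfolding potential_on_def by blast+
  show "0 \<le> V x t + W x t" using V' W' by simp
  show "V x t + W x t \<le> C" "\<bar>DV x t + DW x t\<bar> \<le> C"
    using V' W' by (cases "t < b"; auto)+
  show "V x t + W x t = 0" "DV x t + DW x t = 0" if "t \<notin> {a<..<c}"
    using V' W' that assms(3,4) by auto
qed

lemma potential_on_layer:
  assumes "0 \<le> C" "\<delta> > 0"
  shows "potential_on C a b (\<lambda>x t. C / 2 * cutoff \<delta> a b t * bump (x - z))
     (\<lambda>x t. C / 2 * cutoff \<delta> a b t * bump_deriv (x - z))"
  unfolding potential_on_def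
proof (intro conjI allI impI)
  have cb: "continuous_on UNIV bump" unfolding bump_def[abs_def] by (intro continuous_intros)
  have "continuous_on UNIV (\<lambda>p::real \<times> real. C / 2 * cutoff \<delta> a b (snd p) * bump (fst p - z))"
    by (intro continuous_intros continuous_on_compose2[OF continuous_on_cutoff[OF assms(2), of UNIV]]
      continuous_on_compose2[OF cb]) auto
  then show "continuous_on UNIV (\<lambda>(x, t). C / 2 * cutoff \<delta> a b t * bump (x - z))"
    by (simp add: case_prod_unfold)
  show "((\<lambda>y. C / 2 * cutoff \<delta> a b t * bump (y - z)) has_real_derivative
      C / 2 * cutoff \<delta> a b t * bump_deriv (x - z)) (at x)" for x t
  proof -
    have "((\<lambda>x. x - z) has_real_derivative 1) (at x)" by (auto intro!: derivative_eq_intros)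
    from DERIV_cmult[OF DERIV_chain2[OF DERIV_bump this], of "C / 2 * cutoff \<delta> a b t"]
    show ?thesis by (simp only: mult_1_right)
  qed
  show "continuous_on UNIV (\<lambda>x. C / 2 * cutoff \<delta> a b t * bump_deriv (x - z))" for t
    unfolding bump_deriv_def by (intro continuous_intros)
  fix x t
  have k: "0 \<le> C / 2 * cutoff \<delta> a b t" "C / 2 * cutoff \<delta> a b t \<le> C / 2"
    using assms cutoff_bounds[of \<delta> a b t] by (auto intro: mult_left_le)
  show "0 \<le> C / 2 * cutoff \<delta> a b t * bump (x - z)"
    by (intro mult_nonneg_nonneg k bump_bounds)
  have "C / 2 * cutoff \<delta> a b t * bump (x - z) \<le> C / 2 * 1"
    using assms by (intro mult_mono k bump_bounds) auto
  then show "C / 2 * cutoff \<delta> a b t * bump (x - z) \<le> C" using assms by simp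
  have "\<bar>C / 2 * cutoff \<delta> a b t\<bar> * \<bar>bump_deriv (x - z)\<bar> \<le> C / 2 * 2"
    using k assms by (intro mult_mono bump_deriv_bound) auto
  then show "\<bar>C / 2 * cutoff \<delta> a b t * bump_deriv (x - z)\<bar> \<le> C" by (simp add: abs_mult)
  show "C / 2 * cutoff \<delta> a b t * bump (x - z) = 0" "C / 2 * cutoff \<delta> a b t * bump_deriv (x - z) = 0"
    if "t \<notin> {a<..<b}"
    using cutoff_eq_0[OF assms(2) that] by simp_all
qed

text \<open>Up to an additive constant and an error bounded by the momentum, the value function at time
  \<open>b\<close> is at least \<open>p * min x R\<close> everywhere and at most \<open>p * x\<close> on \<open>[-R, R]\<close>, where \<open>p\<close> is the
  momentum of a particle with speed \<open>u\<close>.\<close>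

definition steers :: "real \<Rightarrow> real \<Rightarrow> real \<Rightarrow> real \<Rightarrow> (real \<Rightarrow> real \<Rightarrow> real) \<Rightarrow> real \<Rightarrow> bool" where
  "steers \<beta> u a b V R \<longleftrightarrow> (\<exists>c.
     (\<forall>h v. traj \<beta> a b h v \<longrightarrow> c + momentum \<beta> u * min (h b) R - momentum \<beta> u \<le> act \<beta> V a b h v) \<and>
     (\<forall>x\<in>{-R..R}. \<exists>h v. competitor \<beta> a b h v \<and> h b = x \<and>
        act \<beta> V a b h v \<le> c + momentum \<beta> u * x + momentum \<beta> u))"

section \<open>Induction over the layers\<close>

text \<open>\<open>R\<close> and \<open>b\<close> are universally quantified because adding a layer
  invokes the property at an earlier time and on a wider interval. The clause
  \<open>a \<le> b - 1\<close> makes every block last at least a unit of time, so that infinitely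
  many of them exhaust the negative axis.\<close>

definition steerable :: "real \<Rightarrow> real \<Rightarrow> real \<Rightarrow> bool" where
  "steerable \<beta> C u \<longleftrightarrow> (\<forall>R b. 0 < R \<longrightarrow>
     (\<exists>a V DV. a \<le> b - 1 \<and> potential_on C a b V DV \<and> steers \<beta> u a b V R))"

lemma steerable_0:
  assumes "1 < \<beta>" "0 \<le> C"
  shows "steerable \<beta> C 0"
  unfolding steerable_def
proof (intro allI impI)
  fix R b :: real assume "0 < R"
  have "steers \<beta> 0 (b - 1) b (\<lambda>_ _. 0) R"
    unfolding steers_def
  proof (intro exI[of _ 0] conjI allI impI ballI)
    fix h v assume "traj \<beta> (b - 1) b h v"
    from act_ge_momentum[OF assms(1) this, of "\<lambda>_ _. 0" 0 0]
    show "0 + momentum \<beta> 0 * min (h b) R - momentum \<beta> 0 \<le> act \<beta> (\<lambda>_ _. 0) (b - 1) b h v"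
      by (simp add: momentum_0 energy_0 case_prod_unfold)
  next
    fix x
    show "\<exists>h v. competitor \<beta> (b - 1) b h v \<and> h b = x \<and>
        act \<beta> (\<lambda>_ _. 0) (b - 1) b h v \<le> 0 + momentum \<beta> 0 * x + momentum \<beta> 0"
      using assms by (intro exI[of _ "\<lambda>_. x"] exI[of _ "\<lambda>_. 0"])
        (simp add: competitor_const act_def momentum_0)
  qed
  then show "\<exists>a V DV. a \<le> b - 1 \<and> potential_on C a b V DV \<and> steers \<beta> 0 a b V R"
    using potential_on_0[OF assms(2)] by (intro exI[of _ "b - 1"] exI[of _ "\<lambda>_ _. 0"]) auto
qed

lemma last_visit:
  fixes h :: "real \<Rightarrow> real"
  assumes "continuous_on {a..b} h" "t \<in> {a..b}" "h t \<le> z" "z < h b"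
  obtains s where "s \<in> {a..b}" "h s = z" "\<And>r. r \<in> {s..b} \<Longrightarrow> z \<le> h r"
proof -
  let ?S = "{s \<in> {a..b}. h s \<le> z}"
  have "?S = {a..b} \<inter> h -` {..z}" by auto
  then have "closed ?S"
    using continuous_closed_preimage[OF assms(1), of "{..z}"] by simp
  moreover have "bounded ?S" by (rule bounded_subset[OF bounded_closed_interval[of a b]]) auto
  ultimately have "compact ?S" by (simp only: compact_eq_bounded_closed)
  moreover have "?S \<noteq> {}" using assms by auto
  ultimately obtain s where s: "s \<in> ?S" "\<And>r. r \<in> ?S \<Longrightarrow> r \<le> s"
    using compact_attains_sup[of ?S] by blast
  have c: "continuous_on {s..b} h" using assms(1) s(1) by (auto intro: continuous_on_subset)
  then obtain r where r: "s \<le> r" "r \<le> b" "h r = z"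
    using IVT'[of h s z b] s(1) assms(4) by auto
  then have "r = s" using s(2)[of r] s(1) by auto
  show ?thesis
  proof (rule that[of s])
    show "s \<in> {a..b}" "h s = z" using s r \<open>r = s\<close> by auto
    fix r' assume "r' \<in> {s..b}"
    moreover have "r' = s" if "h r' < z"
      using s(2)[of r'] s(1) that calculation by auto
    ultimately show "z \<le> h r'" using r \<open>r = s\<close> by fastforce
  qed
qed

text \<open>Cut at the last visit to \<open>- R\<close>. Before it, the slope for \<open>u\<close>
  and the potential bound \<open>c\<close> lose action at rate \<open>energy \<beta> u + c\<close>;
  after it, the slope for \<open>w\<close> without potential loses \<open>energy \<beta> w\<close>.
  The rates are equal, so the crossing time cancels. A trajectory always to the right of
  \<open>- R\<close> loses only \<open>energy \<beta> u\<close> per unit of time, and the saved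
  \<open>c * S\<close> covers the difference of the linear profiles.\<close>

lemma layer_lower_bound:
  assumes \<beta>: "1 < \<beta>" and V: "continuous_on UNIV (\<lambda>(x, t). V x t)"
    and Vc: "\<And>x t. V x t \<le> c" and V0: "\<And>x t. - R \<le> x \<Longrightarrow> V x t \<le> 0"
    and u: "0 \<le> u" "u < w" and E: "energy \<beta> w = energy \<beta> u + c"
    and R: "0 < R" "R \<le> R0" and S: "0 \<le> S" "2 * (momentum \<beta> w - momentum \<beta> u) * R \<le> c * S"
    and tr: "traj \<beta> a (a + S) h v"
  shows "(momentum \<beta> w - momentum \<beta> u) * R + momentum \<beta> w * min (h (a + S)) R - energy \<beta> w * S
     \<le> momentum \<beta> u * min (h a) R0 + act \<beta> V a (a + S) h v"
proof -
  let ?p = "momentum \<beta> u" and ?q = "momentum \<beta> w" and ?b = "a + S"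
  have pq: "0 \<le> ?p" "?p < ?q" using momentum_nonneg momentum_strict_mono[OF \<beta> u] by auto
  have ab: "a \<le> ?b" using S by simp
  have q: "?q * min (h ?b) R \<le> ?q * h ?b" using pq by (intro mult_left_mono) auto
  consider (left) "h ?b \<le> - R" | (cross) s where "s \<in> {a..?b}" "h s = - R" "\<And>r. r \<in> {s..?b} \<Longrightarrow> - R \<le> h r"
    | (right) "\<And>s. s \<in> {a..?b} \<Longrightarrow> - R < h s"
  proof -
    have "thesis" if nl: "- R < h ?b" and t: "t \<in> {a..?b}" "h t \<le> - R" for t
      by (rule last_visit[OF traj_continuous[OF tr] t nl]) (rule cross)
    then show thesis using left right by (meson not_le)
  qed
  then show ?thesis
  proof cases
    case left
    have m: "min (h ?b) R0 = h ?b" "min (h ?b) R = h ?b" using left R by auto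
    have "(?q - ?p) * (R + h ?b) \<le> 0" using left pq by (simp add: mult_le_0_iff)
    then show ?thesis
      using act_ge_truncated[OF \<beta> tr V ab u(1) Vc, of R0] E unfolding m by (simp add: algebra_simps)
  next
    case (cross s)
    have as: "a \<le> s" "s \<le> ?b" using cross by auto
    have m: "min (- R) R0 = - R" using R by auto
    have "- (?p * R) - energy \<beta> w * (s - a) \<le> ?p * min (h a) R0 + act \<beta> V a s h v"
      using act_ge_truncated[OF \<beta> traj_subset[OF tr order.refl as] V as(1) u(1) Vc, of R0]
      unfolding cross(2) m E by simp
    moreover have "?q * (h ?b + R) - energy \<beta> w * (?b - s) \<le> act \<beta> V s ?b h v"
      using act_ge_momentum[OF \<beta> traj_subset[OF tr as order.refl] V as(2), of w 0] u V0 cross by simp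
    moreover have "act \<beta> V a ?b h v = act \<beta> V a s h v + act \<beta> V s ?b h v"
      by (rule act_split[OF tr V as])
    ultimately show ?thesis using q by (simp add: algebra_simps)
  next
    case right
    have "?p * min (h ?b) R0 - energy \<beta> u * S \<le> ?p * min (h a) R0 + act \<beta> V a ?b h v"
      using act_ge_truncated[OF \<beta> tr V ab u(1), of 0 R0] V0 right by (force simp: less_imp_le)
    moreover have "?p * min (h ?b) R \<le> ?p * min (h ?b) R0"
      using R pq by (intro mult_left_mono) auto
    moreover have "(?q - ?p) * (R + min (h ?b) R) \<le> (?q - ?p) * (2 * R)"
      using pq by (intro mult_left_mono) auto
    ultimately show ?thesis using S(2) E by (simp add: algebra_simps)
  qed
qed

text \<open>The curve proceeds with speed \<open>u\<close> until it reaches \<open>z\<close> at time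
  \<open>b + S - \<tau>\<close>, collecting \<open>c\<close> from the potential, and then with speed
  \<open>w\<close> to \<open>x\<close>. The loss \<open>c * \<delta>\<close> comes from the initial
  ramp; the final ramp falls into the second phase, in which nothing is collected from the potential
  in the estimate.\<close>

lemma layer_competitor:
  assumes \<beta>: "1 < \<beta>" and V: "continuous_on UNIV (\<lambda>(x, t). V x t)" and Vn: "\<And>x t. 0 \<le> V x t"
    and V1: "\<And>x t. x \<le> z \<Longrightarrow> b + \<delta> \<le> t \<Longrightarrow> t \<le> b + S - \<delta> \<Longrightarrow> V x t = c"
    and u: "0 \<le> u" "0 < w" and E: "energy \<beta> w = energy \<beta> u + c"
    and \<tau>: "x = z + w * \<tau>" "\<delta> \<le> \<tau>" "\<tau> + \<delta> \<le> S" "0 \<le> \<delta>" and "a \<le> b"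
    and cp: "competitor \<beta> a b h v" "h b = z - u * (S - \<tau>)"
  obtains h' v' where "competitor \<beta> a (b + S) h' v'" "h' (b + S) = x"
    "act \<beta> V a (b + S) h' v' \<le> act \<beta> V a b h v + momentum \<beta> u * (z - h b) + momentum \<beta> w * (x - z)
       - energy \<beta> w * S + c * \<delta>"
proof -
  define s where "s = b + S - \<tau>"
  have s: "b + \<delta> \<le> s" "s \<le> b + S - \<delta>" "b \<le> s" "a \<le> s" "s \<le> b + S"
    using \<tau> \<open>a \<le> b\<close> by (auto simp: s_def)
  obtain h1 v1 where 1: "competitor \<beta> a s h1 v1" "h1 s = h b + u * (s - b)"
    "act \<beta> V a s h1 v1 = act \<beta> V a b h v + 1 / \<beta> * \<bar>u\<bar> powr \<beta> * (s - b) -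
       integral {b..s} (\<lambda>t. V (h b + u * (t - b)) t)"
    by (rule competitor_extend_act[OF \<beta> cp(1) \<open>a \<le> b\<close> s(3) V])
  obtain h2 v2 where 2: "competitor \<beta> a (b + S) h2 v2" "h2 (b + S) = h1 s + w * (b + S - s)"
    "act \<beta> V a (b + S) h2 v2 = act \<beta> V a s h1 v1 + 1 / \<beta> * \<bar>w\<bar> powr \<beta> * (b + S - s) -
       integral {s..b + S} (\<lambda>t. V (h1 s + w * (t - s)) t)"
    by (rule competitor_extend_act[OF \<beta> 1(1) s(4,5) V])
  have z: "h1 s = z" using 1(2) cp(2) by (simp add: s_def)
  have x: "h2 (b + S) = x" using 2(2) z \<tau>(1) by (simp add: s_def)
  have i1: "c * (s - b - \<delta>) \<le> integral {b..s} (\<lambda>t. V (h b + u * (t - b)) t)"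
  proof -
    have cont: "continuous_on A (\<lambda>t. V (h b + u * (t - b)) t)" for A
      by (intro continuous_on_along_path[OF V] continuous_intros)
    have "c * (s - b - \<delta>) = integral {b + \<delta>..s} (\<lambda>t. c)" using s by (simp add: mult.commute)
    also have "\<dots> = integral {b + \<delta>..s} (\<lambda>t. V (h b + u * (t - b)) t)"
    proof (rule integral_cong)
      fix t assume t: "t \<in> {b + \<delta>..s}"
      have "u * (t - b) \<le> u * (s - b)" using t u by (intro mult_left_mono) auto
      then have "h b + u * (t - b) \<le> z" using 1(2) z by simp
      then show "c = V (h b + u * (t - b)) t" using t s by (intro V1[symmetric]) auto
    qed
    also have "\<dots> \<le> integral {b..s} (\<lambda>t. V (h b + u * (t - b)) t)"
      using \<tau>(4) by (intro integral_subset_le integrable_continuous_real cont) (auto simp: Vn)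
    finally show ?thesis .
  qed
  have i2: "0 \<le> integral {s..b + S} (\<lambda>t. V (h1 s + w * (t - s)) t)"
    by (intro integral_nonneg integrable_continuous_real continuous_on_along_path[OF V] continuous_intros Vn)
  have "act \<beta> V a (b + S) h2 v2 \<le> act \<beta> V a b h v + (momentum \<beta> u * u - energy \<beta> u) * (s - b)
     - c * (s - b - \<delta>) + (momentum \<beta> w * w - energy \<beta> w) * (b + S - s)"
    using 1(3)[unfolded Young_momentum_eq[OF \<beta> u(1)]]
      2(3)[unfolded Young_momentum_eq[OF \<beta> less_imp_le[OF u(2)]]] i1 i2 by linarith
  also have "\<dots> = act \<beta> V a b h v + momentum \<beta> u * (u * (s - b)) + momentum \<beta> w * (w * \<tau>)
      - energy \<beta> w * S + c * \<delta>"
    unfolding E s_def by (simp add: algebra_simps)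
  also have "u * (s - b) = z - h b" using 1(2) z by simp
  also have "w * \<tau> = x - z" using \<tau>(1) by simp
  finally show ?thesis using that[OF 2(1) x] by simp
qed

lemma steerable_step:
  assumes \<beta>: "1 < \<beta>" and C: "0 < C" and u: "0 \<le> u" "u < w"
    and E: "energy \<beta> w = energy \<beta> u + C / 2" and st: "steerable \<beta> C u"
  shows "steerable \<beta> C w"
  unfolding steerable_def
proof (intro allI impI)
  fix R b :: real assume R: "0 < R"
  let ?p = "momentum \<beta> u" and ?q = "momentum \<beta> w" and ?c = "C / 2"
  have pq: "0 \<le> ?p" "?p < ?q" using momentum_nonneg momentum_strict_mono[OF \<beta> u] by auto
  have w: "0 < w" using u by simp
  \<comment> \<open>The bound \<open>1 / w\<close> makes the phase of speed \<open>w\<close>, which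
    covers a distance of at least 1, outlast the final ramp. The other bound keeps the ramp loss
    within the increment of the momentum.\<close>
  define \<delta> where "\<delta> = min (1 / w) ((?q - ?p) / ?c)"
  have \<delta>: "0 < \<delta>" "\<delta> \<le> 1 / w" "?c * \<delta> \<le> ?q - ?p"
  proof -
    show "0 < \<delta>" "\<delta> \<le> 1 / w" using w pq C by (auto simp: \<delta>_def)
    have "?c * \<delta> \<le> ?c * ((?q - ?p) / ?c)" using C by (intro mult_left_mono) (auto simp: \<delta>_def)
    then show "?c * \<delta> \<le> ?q - ?p" using C by simp
  qed
  \<comment> \<open>The first term leaves time to travel from \<open>z\<close> to any point of
    \<open>[-R, R]\<close> with speed \<open>w\<close> after the initial ramp; the second is the
    duration after which the old branch has lost.\<close>
  define S where "S = max ((2 * R + 1) / w + \<delta>) (2 * (?q - ?p) * R / ?c)"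
  have S: "(2 * R + 1) / w + \<delta> \<le> S" "2 * (?q - ?p) * R \<le> ?c * S" "0 \<le> S"
  proof -
    show 1: "(2 * R + 1) / w + \<delta> \<le> S" by (simp add: S_def)
    have "0 \<le> (2 * R + 1) / w" using R w by simp
    then show "0 \<le> S" using 1 \<delta>(1) by linarith
    have "?c * (2 * (?q - ?p) * R / ?c) \<le> ?c * S" using C by (intro mult_left_mono) (auto simp: S_def)
    then show "2 * (?q - ?p) * R \<le> ?c * S" using C by simp
  qed
  define bs where "bs = b - S"
  have b: "b = bs + S" by (simp add: bs_def)
  define z where "z = - R - 1"
  \<comment> \<open>The competitor may have to enter the layer as far left as
    \<open>z - u * S\<close>, hence the wider interval for the preceding layers.\<close>
  define R0 where "R0 = R + 1 + u * S"
  have uS: "0 \<le> u * S" using u S by simp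
  have R0: "0 < R0" "R \<le> R0" using R uS by (auto simp: R0_def)
  obtain a V0 DV0 where a: "a \<le> bs - 1" and V0: "potential_on C a bs V0 DV0" and s0: "steers \<beta> u a bs V0 R0"
    using st R0(1) unfolding steerable_def by blast
  have abs: "a \<le> bs" "bs \<le> b" using a S b by auto
  obtain c0 where lo: "\<And>h v. traj \<beta> a bs h v \<Longrightarrow> c0 + ?p * min (h bs) R0 - ?p \<le> act \<beta> V0 a bs h v"
    and up: "\<And>y. y \<in> {-R0..R0} \<Longrightarrow> \<exists>h v. competitor \<beta> a bs h v \<and> h bs = y \<and>
        act \<beta> V0 a bs h v \<le> c0 + ?p * y + ?p"
    using s0 unfolding steers_def by blast
  define V1 where "V1 = (\<lambda>x t. C / 2 * cutoff \<delta> bs b t * bump (x - z))"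
  define DV1 where "DV1 = (\<lambda>x t. C / 2 * cutoff \<delta> bs b t * bump_deriv (x - z))"
  have V1: "potential_on C bs b V1 DV1"
    unfolding V1_def DV1_def using C \<delta>(1) by (intro potential_on_layer) auto
  define V where "V = (\<lambda>x t. V0 x t + V1 x t)"
  have V: "potential_on C a b V (\<lambda>x t. DV0 x t + DV1 x t)"
    unfolding V_def by (rule potential_on_concat[OF V0 V1 abs])
  have Vc: "continuous_on UNIV (\<lambda>(x, t). V x t)" and Vn: "\<And>x t. 0 \<le> V x t"
    using V unfolding potential_on_def by blast+
  have V1c: "continuous_on UNIV (\<lambda>(x, t). V1 x t)"
    using V1 unfolding potential_on_def by blast
  have VV0: "V x t = V0 x t" if "t \<le> bs" for x t
    using V1 that unfolding potential_on_def V_def by auto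
  have VV1: "V x t = V1 x t" if "bs \<le> t" for x t
    using V0 that unfolding potential_on_def V_def by auto
  have V1le: "V1 x t \<le> ?c" for x t
  proof -
    have "C / 2 * cutoff \<delta> bs b t * bump (x - z) \<le> C / 2 * 1 * 1"
      using C by (intro mult_mono bump_bounds cutoff_bounds mult_nonneg_nonneg) auto
    then show ?thesis by (simp add: V1_def)
  qed
  have V1r: "V1 x t \<le> 0" if "- R \<le> x" for x t
    using bump_right[of "x - z"] that by (simp add: V1_def z_def)
  \<comment> \<open>The two linear profiles are matched at \<open>z\<close>:
    \<open>c1 + ?q * z = c0 + ?p * z - energy \<beta> w * S\<close>. The step lies between
    \<open>z\<close> and \<open>z + 1 = - R\<close>; this unit of width uses up the increment
    \<open>?q - ?p\<close> allowed in the lower bound.\<close>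
  define c1 where "c1 = c0 + (?p - ?q) * z - energy \<beta> w * S"
  have "steers \<beta> w a b V R"
    unfolding steers_def
  proof (intro exI[of _ c1] conjI allI impI ballI)
    fix h v assume tr: "traj \<beta> a b h v"
    have "act \<beta> V a b h v = act \<beta> V a bs h v + act \<beta> V bs b h v"
      by (rule act_split[OF tr Vc abs])
    moreover have "act \<beta> V a bs h v = act \<beta> V0 a bs h v"
      by (rule act_cong) (auto simp: VV0)
    moreover have "act \<beta> V bs b h v = act \<beta> V1 bs b h v"
      by (rule act_cong) (auto simp: VV1)
    moreover have "c0 + ?p * min (h bs) R0 - ?p \<le> act \<beta> V0 a bs h v"
      by (rule lo[OF traj_subset[OF tr order.refl abs]])
    moreover have "(?q - ?p) * R + ?q * min (h b) R - energy \<beta> w * S \<le> ?p * min (h bs) R0 + act \<beta> V1 bs b h v"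
      using layer_lower_bound[OF \<beta> V1c V1le V1r u E R R0(2) S(3,2), of bs h v] traj_subset[OF tr abs order.refl]
      by (simp add: b[symmetric])
    ultimately show "c1 + ?q * min (h b) R - ?q \<le> act \<beta> V a b h v"
      by (simp add: c1_def z_def algebra_simps)
  next
    fix x assume x: "x \<in> {-R..R}"
    define \<tau> where "\<tau> = (x - z) / w"
    have \<tau>: "x = z + w * \<tau>" "\<delta> \<le> \<tau>" "\<tau> + \<delta> \<le> S"
    proof -
      show "x = z + w * \<tau>" using w by (simp add: \<tau>_def)
      have "1 / w \<le> \<tau>" unfolding \<tau>_def using x w by (intro divide_right_mono) (auto simp: z_def)
      then show "\<delta> \<le> \<tau>" using \<delta>(2) by simp
      have "\<tau> \<le> (2 * R + 1) / w" unfolding \<tau>_def using x w by (intro divide_right_mono) (auto simp: z_def)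
      then show "\<tau> + \<delta> \<le> S" using S(1) by simp
    qed
    define y where "y = z - u * (S - \<tau>)"
    have "0 \<le> u * (S - \<tau>)" "u * (S - \<tau>) \<le> u * S"
      using u \<tau> \<delta>(1) by (auto intro!: mult_left_mono)
    then have "y \<in> {-R0..R0}" using R by (auto simp: y_def z_def R0_def)
    from up[OF this] obtain h v where hv: "competitor \<beta> a bs h v" "h bs = y"
      "act \<beta> V0 a bs h v \<le> c0 + ?p * y + ?p" by blast
    have V1eq: "V x t = ?c" if "x \<le> z" "bs + \<delta> \<le> t" "t \<le> bs + S - \<delta>" for x t
    proof -
      have "V x t = V1 x t" using that \<delta>(1) by (intro VV1) simp
      then show ?thesis using that \<delta>(1) bump_left[of "x - z"] cutoff_eq_1[of \<delta> bs t b] b by (simp add: V1_def)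
    qed
    obtain h' v' where h': "competitor \<beta> a (bs + S) h' v'" "h' (bs + S) = x"
      "act \<beta> V a (bs + S) h' v' \<le> act \<beta> V a bs h v + ?p * (z - h bs) + ?q * (x - z)
       - energy \<beta> w * S + ?c * \<delta>"
      by (rule layer_competitor[OF \<beta> Vc Vn V1eq u(1) w E \<tau> less_imp_le[OF \<delta>(1)] abs(1) hv(1)])
        (use hv(2) y_def in auto)
    have "act \<beta> V a bs h v = act \<beta> V0 a bs h v"
      by (rule act_cong) (auto simp: VV0)
    then have "act \<beta> V a b h' v' \<le> c1 + ?q * x + ?q"
      using h'(3) hv(2,3) \<delta>(3) unfolding b[symmetric] c1_def by (simp add: algebra_simps)
    then show "\<exists>h v. competitor \<beta> a b h v \<and> h b = x \<and> act \<beta> V a b h v \<le> c1 + ?q * x + ?q"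
      using h'(1,2) unfolding b[symmetric] by blast
  qed
  then show "\<exists>a V DV. a \<le> b - 1 \<and> potential_on C a b V DV \<and> steers \<beta> w a b V R"
    using V a S(3) b by (intro exI[of _ a] exI[of _ V] exI[of _ "\<lambda>x t. DV0 x t + DV1 x t"]) auto
qed

lemma energy_inverse:
  assumes "1 < \<beta>" "0 \<le> e"
  obtains u where "0 \<le> u" "energy \<beta> u = e"
proof (rule that[of "(e / (1 - 1 / \<beta>)) powr (1 / \<beta>)"])
  show "energy \<beta> ((e / (1 - 1 / \<beta>)) powr (1 / \<beta>)) = e"
    using assms by (simp add: energy_def powr_powr)
qed simp

lemma energy_mono:
  assumes "1 < \<beta>" "0 \<le> u" "energy \<beta> u < energy \<beta> w" "0 \<le> w"
  shows "u < w"
proof (rule ccontr)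
  assume "\<not> u < w"
  then have "w powr \<beta> \<le> u powr \<beta>" using assms by (intro powr_mono2) auto
  then have "energy \<beta> w \<le> energy \<beta> u" unfolding energy_def using assms by (intro mult_left_mono) auto
  then show False using assms by simp
qed

text \<open>Every layer adds \<open>C / 2\<close> to the energy, so \<open>k\<close> layers reach
  energy \<open>k * (C / 2)\<close>, which exceeds that of any prescribed speed.\<close>

lemma steerable_arbitrarily_fast:
  assumes \<beta>: "1 < \<beta>" and C: "0 < C"
  obtains u where "K < u" "0 \<le> u" "steerable \<beta> C u"
proof -
  have st: "\<exists>u\<ge>0. energy \<beta> u = of_nat k * (C / 2) \<and> steerable \<beta> C u" for k
  proof (induction k)
    case 0
    show ?case using steerable_0[OF \<beta>, of C] C energy_0 by (intro exI[of _ 0]) auto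
  next
    case (Suc k)
    then obtain u where u: "0 \<le> u" "energy \<beta> u = of_nat k * (C / 2)" "steerable \<beta> C u" by blast
    have "0 \<le> energy \<beta> u + C / 2" using energy_nonneg[OF \<beta>, of u] C by simp
    then obtain w where w: "0 \<le> w" "energy \<beta> w = energy \<beta> u + C / 2"
      by (rule energy_inverse[OF \<beta>])
    have "energy \<beta> u < energy \<beta> w" using w(2) C by simp
    then have "u < w" using energy_mono[OF \<beta> u(1) _ w(1)] by simp
    then have "steerable \<beta> C w" by (intro steerable_step[OF \<beta> C u(1) _ w(2) u(3)])
    then show ?case using w u by (intro exI[of _ w]) (auto simp: algebra_simps)
  qed
  obtain k where "energy \<beta> (max K 0) / (C / 2) < of_nat k" using reals_Archimedean2 by blast
  then have k: "energy \<beta> (max K 0) < of_nat k * (C / 2)" using C by (simp add: pos_divide_less_eq)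
  obtain u where u: "u \<ge> 0" "energy \<beta> u = of_nat k * (C / 2)" "steerable \<beta> C u" using st by blast
  have "max K 0 < u" by (rule energy_mono[OF \<beta> _ _ u(1)]) (simp_all only: u(2) k max.cobounded2)
  then show ?thesis using u that by auto
qed

section \<open>Accelerating blocks and their infinite concatenation\<close>

text \<open>Minimality is asked for only against competitors, the curves that can be lifted to the
  original space.\<close>

definition minimal_traj :: "real \<Rightarrow> (real \<Rightarrow> real \<Rightarrow> real) \<Rightarrow> real \<Rightarrow> real \<Rightarrow> (real \<Rightarrow> real) \<Rightarrow> (real \<Rightarrow> real) \<Rightarrow> bool" where
  "minimal_traj \<beta> V a b h v \<longleftrightarrow> traj \<beta> a b h v \<and>
     (\<forall>h' v'. competitor \<beta> a b h' v' \<and> h' b = h b \<longrightarrow> act \<beta> V a b h v \<le> act \<beta> V a b h' v')"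

text \<open>Straight motion with speed \<open>u\<close> after the block reaches \<open>h 0\<close>
  with action at most \<open>c + ?p * h 0 + ?p - ?E * T\<close>. A displacement below
  \<open>M\<close> in the last unit of time would force at least
  \<open>c - ?p + ?p * (h 0 - M) - (?E + C) * (T - 1)\<close>. Comparison gives
  \<open>?E \<le> 2 * ?p + ?p * M + C * (T - 1)\<close>, contrary to the choice of
  \<open>u\<close>.\<close>

lemma accelerating_block:
  assumes \<beta>: "1 < \<beta>" and C: "0 < C" and T: "1 \<le> T" and W: "potential_on C (- T) (- 1) W DW" and M: "0 \<le> M"
  obtains T' V DV where "T + 1 \<le> T'" "potential_on C (- T') (- T) V DV"
    "\<And>h v. minimal_traj \<beta> (\<lambda>x t. V x t + W x t) (- T') 0 h v \<Longrightarrow> \<bar>h 0\<bar> \<le> M \<Longrightarrow> M \<le> h 0 - h (- 1)"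
proof -
  have \<theta>: "0 < 1 - 1 / \<beta>" using \<beta> by simp
  \<comment> \<open>Since \<open>?E = ?p * ((1 - 1 / \<beta>) * u)\<close>, the threshold yields
    \<open>?p * (3 + M + C * T) \<le> ?E\<close>; the \<open>max 1\<close> ensures
    \<open>1 \<le> ?p\<close>, so that \<open>C * T\<close> may be replaced by
    \<open>?p * (C * T)\<close>.\<close>
  obtain u where u: "max 1 ((3 + M + C * T) / (1 - 1 / \<beta>)) < u" "0 \<le> u" and st: "steerable \<beta> C u"
    by (rule steerable_arbitrarily_fast[OF \<beta> C])
  let ?p = "momentum \<beta> u" and ?E = "energy \<beta> u"
  have "1 \<le> ?p" using u \<beta> by (simp add: momentum_def ge_one_powr_ge_zero)
  have "3 + M + C * T \<le> (1 - 1 / \<beta>) * u" using u \<theta> by (simp add: pos_divide_less_eq mult.commute)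
  moreover have "?E = ?p * ((1 - 1 / \<beta>) * u)"
    using u by (simp add: energy_def momentum_def powr_diff)
  ultimately have "?p * (3 + M + C * T) \<le> ?E" using \<open>1 \<le> ?p\<close> by (simp add: mult_left_mono)
  moreover have "C * T \<le> ?p * (C * T)" using \<open>1 \<le> ?p\<close> C T by simp
  ultimately have E: "3 * ?p + ?p * M + C * T \<le> ?E" by (simp add: algebra_simps)
  define R where "R = M + u * T + 1"
  have uT: "0 \<le> u * T" using u T by simp
  have R: "0 < R" "M \<le> R" using M uT by (auto simp: R_def)
  obtain a V DV where a: "a \<le> - T - 1" and V: "potential_on C a (- T) V DV" and s: "steers \<beta> u a (- T) V R"
    using st R(1) unfolding steerable_def by blast
  obtain c where lo: "\<And>h v. traj \<beta> a (- T) h v \<Longrightarrow> c + ?p * min (h (- T)) R - ?p \<le> act \<beta> V a (- T) h v"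
    and up: "\<And>y. y \<in> {-R..R} \<Longrightarrow> \<exists>h v. competitor \<beta> a (- T) h v \<and> h (- T) = y \<and>
        act \<beta> V a (- T) h v \<le> c + ?p * y + ?p"
    using s unfolding steers_def by blast
  define U where "U = (\<lambda>x t. V x t + W x t)"
  have U: "potential_on C a (- 1) U (\<lambda>x t. DV x t + DW x t)"
    unfolding U_def using a T by (intro potential_on_concat[OF V W]) auto
  then have Uc: "continuous_on UNIV (\<lambda>(x, t). U x t)" and Un: "0 \<le> U x t" and UC: "U x t \<le> C"
    and U0: "- 1 \<le> t \<Longrightarrow> U x t = 0" for x t
    unfolding potential_on_def by auto
  have UV: "U x t = V x t" if "t \<le> - T" for x t
    using W that unfolding potential_on_def U_def by auto
  have "M \<le> h 0 - h (- 1)" if min: "minimal_traj \<beta> U a 0 h v" and x: "\<bar>h 0\<bar> \<le> M" for h v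
  proof (rule ccontr)
    assume "\<not> M \<le> h 0 - h (- 1)"
    then have far: "h 0 - M < h (- 1)" by simp
    have tr: "traj \<beta> a 0 h v" using min by (simp add: minimal_traj_def)
    have t1: "traj \<beta> a (- 1) h v" and t2: "traj \<beta> (- T) (- 1) h v" and t3: "traj \<beta> (- 1) 0 h v"
      and t4: "traj \<beta> a (- T) h v"
      using a T by (auto intro!: traj_subset[OF tr])
    have "act \<beta> U a 0 h v = act \<beta> U a (- 1) h v + act \<beta> U (- 1) 0 h v"
      using a T by (intro act_split[OF tr Uc]) auto
    moreover have "act \<beta> U a (- 1) h v = act \<beta> U a (- T) h v + act \<beta> U (- T) (- 1) h v"
      using a T by (intro act_split[OF t1 Uc]) auto
    moreover have "act \<beta> U a (- T) h v = act \<beta> V a (- T) h v"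
      by (rule act_cong) (auto simp: UV)
    moreover have "?p * min (h (- 1)) R - (?E + C) * (T - 1) \<le> ?p * min (h (- T)) R + act \<beta> U (- T) (- 1) h v"
      using act_ge_truncated[OF \<beta> t2 Uc _ u(2) UC, of R] T by simp
    moreover have "0 \<le> act \<beta> U (- 1) 0 h v"
      using act_ge_momentum[OF \<beta> t3 Uc, of 0 0] by (simp add: U0 momentum_0 energy_0)
    \<comment> \<open>The truncation at \<open>R\<close> is harmless:
      \<open>h 0 - M \<le> 0 < R\<close>.\<close>
    moreover have "?p * (h 0 - M) \<le> ?p * min (h (- 1)) R"
      using far x R M \<open>1 \<le> ?p\<close> by (intro mult_left_mono) auto
    ultimately have lower: "c - 2 * ?p + ?p * (h 0 - M) + ?p - (?E + C) * (T - 1) \<le> act \<beta> U a 0 h v"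
      using lo[OF t4] by linarith
    define y where "y = h 0 - u * T"
    have "y \<in> {-R..R}" using x uT unfolding y_def R_def atLeastAtMost_iff by linarith
    from up[OF this] obtain h1 v1 where h1: "competitor \<beta> a (- T) h1 v1" "h1 (- T) = y"
      "act \<beta> V a (- T) h1 v1 \<le> c + ?p * y + ?p" by blast
    have aT: "a \<le> - T" "- T \<le> 0" using a T by auto
    obtain h2 v2 where h2: "competitor \<beta> a 0 h2 v2" "h2 0 = h1 (- T) + u * (0 - (- T))"
      "act \<beta> U a 0 h2 v2 = act \<beta> U a (- T) h1 v1 + 1 / \<beta> * \<bar>u\<bar> powr \<beta> * (0 - (- T)) -
         integral {- T..0} (\<lambda>s. U (h1 (- T) + u * (s - (- T))) s)"
      by (rule competitor_extend_act[OF \<beta> h1(1) aT Uc])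
    have "0 \<le> integral {- T..0} (\<lambda>s. U (h1 (- T) + u * (s - (- T))) s)"
      by (intro integral_nonneg integrable_continuous_real continuous_on_along_path[OF Uc] continuous_intros Un)
    moreover have "act \<beta> U a (- T) h1 v1 = act \<beta> V a (- T) h1 v1"
      by (rule act_cong) (auto simp: UV)
    ultimately have "act \<beta> U a 0 h2 v2 \<le> c + ?p * y + ?p + (?p * u - ?E) * T"
      using h2(3)[unfolded Young_momentum_eq[OF \<beta> u(2)]] h1(3) by simp
    moreover have "act \<beta> U a 0 h v \<le> act \<beta> U a 0 h2 v2"
      using min h2(1,2) h1(2) unfolding minimal_traj_def by (auto simp: y_def)
    ultimately have "c - 2 * ?p + ?p * (h 0 - M) + ?p - (?E + C) * (T - 1) \<le> c + ?p * y + ?p + (?p * u - ?E) * T"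
      using lower by linarith
    then have "?E \<le> 2 * ?p + ?p * M + C * (T - 1)" by (simp add: y_def algebra_simps)
    then show False using E C \<open>1 \<le> ?p\<close> by (simp add: algebra_simps)
  qed
  then show ?thesis using a V by (intro that[of "- a" V DV]) (auto simp: U_def)
qed

text \<open>Blocks are prepended in backward time by dependent choice, each chosen after everything
  later is fixed. Earlier blocks never change the potential on \<open>[- T n, 0]\<close>, so the
  property obtained at each step survives in the limit.\<close>

lemma exists_accelerating_potential:
  assumes \<beta>: "1 < \<beta>" and C: "0 < C"
  obtains W DW :: "real \<Rightarrow> real \<Rightarrow> real" and T :: "nat \<Rightarrow> real" where
    "continuous_on UNIV (\<lambda>(x, t). W x t)"
    "\<And>x t. ((\<lambda>y. W y t) has_real_derivative DW x t) (at x)" "\<And>t. continuous_on UNIV (\<lambda>x. DW x t)"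
    "\<And>x t. 0 \<le> W x t" "\<And>x t. W x t \<le> C" "\<And>x t. \<bar>DW x t\<bar> \<le> C" "\<And>x t. - 1 \<le> t \<Longrightarrow> W x t = 0"
    "\<And>n. real n + 1 \<le> T n"
    "\<And>n h v. minimal_traj \<beta> W (- T n) 0 h v \<Longrightarrow> \<bar>h 0\<bar> \<le> real n \<Longrightarrow> real n \<le> h 0 - h (- 1)"
proof -
  define P where "P = (\<lambda>n::nat. \<lambda>(T, W, DW). real n + 1 \<le> T \<and> potential_on C (- T) (- 1) W DW)"
  define Q where "Q = (\<lambda>n::nat. \<lambda>(T, W, DW) (T', W', DW' :: real \<Rightarrow> real \<Rightarrow> real). T \<le> T' \<and>
     (\<forall>x t. - T \<le> t \<longrightarrow> W' x t = W x t \<and> DW' x t = DW x t) \<and>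
     (\<forall>h v. minimal_traj \<beta> W' (- T') 0 h v \<longrightarrow> \<bar>h 0\<bar> \<le> real n \<longrightarrow> real n \<le> h 0 - h (- 1)))"
  have "\<exists>f. \<forall>n. P n (f n) \<and> Q n (f n) (f (Suc n))"
  proof (rule dependent_nat_choice)
    show "\<exists>s. P 0 s"
      using potential_on_0[of C "- 1" "- 1"] C
      by (intro exI[of _ "(1, \<lambda>_ _. 0, \<lambda>_ _. 0)"]) (simp add: P_def)
  next
    fix s n assume "P n s"
    then obtain T W DW where s: "s = (T, W, DW)" and T: "real n + 1 \<le> T" and W: "potential_on C (- T) (- 1) W DW"
      by (cases s) (auto simp: P_def)
    have T1: "1 \<le> T" using T by simp
    obtain T' V DV where T': "T + 1 \<le> T'" and V: "potential_on C (- T') (- T) V DV" and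
      min: "\<And>h v. minimal_traj \<beta> (\<lambda>x t. V x t + W x t) (- T') 0 h v \<Longrightarrow> \<bar>h 0\<bar> \<le> real n \<Longrightarrow> real n \<le> h 0 - h (- 1)"
      by (rule accelerating_block[OF \<beta> C T1 W, of "real n"]) auto
    have "potential_on C (- T') (- 1) (\<lambda>x t. V x t + W x t) (\<lambda>x t. DV x t + DW x t)"
      using T1 T' by (intro potential_on_concat[OF V W]) auto
    then have "P (Suc n) (T', \<lambda>x t. V x t + W x t, \<lambda>x t. DV x t + DW x t)"
      using T T' by (simp add: P_def)
    moreover have "V x t = 0 \<and> DV x t = 0" if "- T \<le> t" for x t
      using V that unfolding potential_on_def by auto
    then have "Q n s (T', \<lambda>x t. V x t + W x t, \<lambda>x t. DV x t + DW x t)"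
      using T' min unfolding s Q_def by auto
    ultimately show "\<exists>s'. P (Suc n) s' \<and> Q n s s'" by blast
  qed
  then obtain f where f: "\<And>n. P n (f n)" "\<And>n. Q n (f n) (f (Suc n))" by blast
  define T where "T = (\<lambda>n. fst (f n))"
  define W where "W = (\<lambda>n. fst (snd (f n)))"
  define DW where "DW = (\<lambda>n. snd (snd (f n)))"
  have fn: "f n = (T n, W n, DW n)" for n by (simp add: T_def W_def DW_def)
  have T: "real n + 1 \<le> T n" and pot: "potential_on C (- T n) (- 1) (W n) (DW n)" for n
    using f(1)[of n] by (simp_all add: fn P_def)
  have TS: "T n \<le> T (Suc n)" and WS: "- T n \<le> t \<Longrightarrow> W (Suc n) x t = W n x t \<and> DW (Suc n) x t = DW n x t"
    and minS: "minimal_traj \<beta> (W (Suc n)) (- T (Suc n)) 0 h v \<Longrightarrow> \<bar>h 0\<bar> \<le> real n \<Longrightarrow> real n \<le> h 0 - h (- 1)"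
    for n x t h v
    using f(2)[of n] unfolding fn Q_def by auto
  have "T n \<le> T m" if "n \<le> m" for n m
    using lift_Suc_mono_le[of T, OF TS that] .
  have Wle: "W m x t = W n x t \<and> DW m x t = DW n x t" if "n \<le> m" "- T n \<le> t" for n m x t
    using that(1)
  proof (induction m rule: dec_induct)
    case (step k)
    then show ?case using WS[of k t x] \<open>\<And>m n. n \<le> m \<Longrightarrow> T n \<le> T m\<close>[of n k] that(2) by auto
  qed simp
  \<comment> \<open>An index at which the potential at time \<open>t\<close> has already reached its
    final value.\<close>
  define N where "N = (\<lambda>t::real. nat \<lceil>- t\<rceil>)"
  have N: "- T (N t) \<le> t" for t
  proof -
    have "- t \<le> real (N t)" unfolding N_def by linarith
    then show ?thesis using T[of "N t"] by linarith
  qed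
  define U where "U = (\<lambda>x t. W (N t) x t)"
  define DU where "DU = (\<lambda>x t. DW (N t) x t)"
  have UW: "U x t = W n x t" "DU x t = DW n x t" if "- T n \<le> t" for x t n
  proof -
    have "W (N t) x t = W n x t \<and> DW (N t) x t = DW n x t"
      using Wle[of n "N t" t x] Wle[of "N t" n t x] N[of t] that by (metis nat_le_linear)
    then show "U x t = W n x t" "DU x t = DW n x t" by (simp_all add: U_def DU_def)
  qed
  note p = pot[unfolded potential_on_def]
  show ?thesis
  \<comment> \<open>The shift to \<open>Suc n\<close> occurs because the block added in step
    \<open>n\<close> begins at time \<open>- T (Suc n)\<close>.\<close>
  proof (rule that[of U DU "\<lambda>n. T (Suc n)"])
    \<comment> \<open>Joint continuity is local: on each of the open strips that exhaust the plane,
      \<open>U\<close> coincides with one of the \<open>W n\<close>.\<close>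
    have "continuous_on (UNIV \<times> {- T n<..}) (\<lambda>(x, t). U x t)" for n
    proof -
      have "continuous_on (UNIV \<times> {- T n<..}) (\<lambda>(x, t). W n x t)"
        using p[of n] by (auto intro: continuous_on_subset)
      then show ?thesis
        by (rule continuous_on_eq) (auto simp: UW(1)[OF less_imp_le])
    qed
    then have "continuous_on (\<Union>n. UNIV \<times> {- T n<..}) (\<lambda>(x, t). U x t)"
      by (intro continuous_on_open_UN) (auto intro!: open_Times)
    moreover have "(\<Union>n. UNIV \<times> {- T n<..}) = (UNIV :: (real \<times> real) set)"
    proof -
      have "\<exists>n. - T n < t" for t
      proof -
        obtain n where "- t < real n" using reals_Archimedean2 by blast
        then show ?thesis using T[of n] by (intro exI[of _ n]) linarith
      qed
      then show ?thesis by auto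
    qed
    ultimately show "continuous_on UNIV (\<lambda>(x, t). U x t)" by simp
    show "((\<lambda>y. U y t) has_real_derivative DU x t) (at x)" for x t
      using p[of "N t"] by (simp add: U_def DU_def)
    show "continuous_on UNIV (\<lambda>x. DU x t)" for t
      using p[of "N t"] by (simp add: DU_def)
    show "0 \<le> U x t" "U x t \<le> C" "\<bar>DU x t\<bar> \<le> C" for x t
      using p[of "N t"] by (simp_all add: U_def DU_def)
    show "U x t = 0" if "- 1 \<le> t" for x t
      using p[of "N t"] that by (simp add: U_def)
    show "real n + 1 \<le> T (Suc n)" for n using T[of n] TS[of n] by linarith
    show "real n \<le> h 0 - h (- 1)" if "minimal_traj \<beta> U (- T (Suc n)) 0 h v" "\<bar>h 0\<bar> \<le> real n" for n h v
    proof (rule minS[of n h v, OF _ that(2)])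
      have "act \<beta> (W (Suc n)) (- T (Suc n)) 0 h v = act \<beta> U (- T (Suc n)) 0 h v" for h v
        by (rule act_cong) (auto simp: UW)
      then show "minimal_traj \<beta> (W (Suc n)) (- T (Suc n)) 0 h v"
        using that(1) unfolding minimal_traj_def by simp
    qed
  qed
qed

section \<open>Reduction to one dimension\<close>

lemma set_nn_integral_lebesgue_on:
  "(\<integral>\<^sup>+s\<in>{a..b::real}. f s \<partial>lebesgue) = (\<integral>\<^sup>+s. f s \<partial>lebesgue_on {a..b})"
  by (subst nn_integral_restrict_space) auto

lemma action_eq_integral:
  assumes "lagrangian \<beta> U a b \<gamma> absolutely_integrable_on {a..b}"
  shows "action \<beta> U a b \<gamma> = ereal (integral {a..b} (lagrangian \<beta> U a b \<gamma>))"
proof -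
  let ?L = "lagrangian \<beta> U a b \<gamma>" and ?M = "lebesgue_on {a..b}"
  have i: "integrable ?M ?L"
    using assms by (simp add: integrable_restrict_space set_integrable_def)
  have A: "(\<integral>\<^sup>+s. ennreal (?L s) \<partial>?M) \<noteq> \<infinity>" and B: "(\<integral>\<^sup>+s. ennreal (- ?L s) \<partial>?M) \<noteq> \<infinity>"
    using i by (auto simp: real_integrable_def)
  have "enn2ereal x = ereal (enn2real x)" if "x \<noteq> \<infinity>" for x
    using that by (cases x rule: ennreal_cases) (auto simp: enn2ereal_ennreal)
  then have "action \<beta> U a b \<gamma> = ereal (integral\<^sup>L ?M ?L)"
    using A B unfolding action_def set_nn_integral_lebesgue_on real_lebesgue_integral_def[OF i] by simp
  also have "integral\<^sup>L ?M ?L = integral {a..b} ?L"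
    using set_lebesgue_integral_eq_integral(2)[OF assms]
    by (simp add: integral_restrict_space set_lebesgue_integral_def)
  finally show ?thesis .
qed

text \<open>The kinetic term is nonnegative, so its gauge integrability is already Lebesgue
  integrability; the potential term is continuous along the curve.\<close>

lemma action_finite:
  fixes \<gamma> :: "real \<Rightarrow> 'a::euclidean_space"
  assumes "1 < \<beta>" and U: "continuous_on {a..b} (\<lambda>s. U (\<gamma> s) s)"
    and v: "(\<lambda>s. norm (velocity a b \<gamma> s) powr \<beta>) integrable_on {a..b}"
  shows "lagrangian \<beta> U a b \<gamma> integrable_on {a..b}"
    "action \<beta> U a b \<gamma> = ereal (integral {a..b} (lagrangian \<beta> U a b \<gamma>))"
proof -
  have 1: "(\<lambda>s. 1 / \<beta> * norm (velocity a b \<gamma> s) powr \<beta>) absolutely_integrable_on {a..b}"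
    using assms(1) integrable_on_mult_right[OF v, of "1 / \<beta>"]
    by (intro nonnegative_absolutely_integrable_1) auto
  have 2: "lagrangian \<beta> U a b \<gamma> absolutely_integrable_on {a..b}"
    unfolding lagrangian_def[abs_def]
    by (rule set_integral_diff(1)[OF 1 absolutely_integrable_continuous_real[OF U]])
  show "lagrangian \<beta> U a b \<gamma> integrable_on {a..b}"
    by (rule set_lebesgue_integral_eq_integral(1)[OF 2])
  show "action \<beta> U a b \<gamma> = ereal (integral {a..b} (lagrangian \<beta> U a b \<gamma>))"
    by (rule action_eq_integral[OF 2])
qed

text \<open>The negative part of the Lagrangian is bounded by the absolute value of the potential
  along the curve, hence has finite integral. Finite action then forces the positive part to have
  finite integral as well.\<close>

lemma integrable_of_action_finite:
  fixes \<gamma> :: "real \<Rightarrow> 'a::euclidean_space"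
  assumes \<beta>: "1 < \<beta>" and U: "continuous_on {a..b} (\<lambda>s. U (\<gamma> s) s)"
    and m: "velocity a b \<gamma> \<in> borel_measurable (lebesgue_on {a..b})"
    and fin: "action \<beta> U a b \<gamma> < \<infinity>"
  shows "(\<lambda>s. norm (velocity a b \<gamma> s) powr \<beta>) integrable_on {a..b}"
proof -
  let ?L = "lagrangian \<beta> U a b \<gamma>" and ?M = "lebesgue_on {a..b}"
  let ?K = "\<lambda>s. 1 / \<beta> * norm (velocity a b \<gamma> s) powr \<beta>"
  have Ui: "integrable ?M (\<lambda>s. U (\<gamma> s) s)"
    using absolutely_integrable_continuous_real[OF U] by (simp add: integrable_restrict_space set_integrable_def)
  have Km: "?K \<in> borel_measurable ?M" using m by measurable
  have Lm: "?L \<in> borel_measurable ?M"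
    unfolding lagrangian_def[abs_def] by (intro borel_measurable_diff Km borel_measurable_integrable[OF Ui])
  have "(\<integral>\<^sup>+s. ennreal (- ?L s) \<partial>?M) \<le> (\<integral>\<^sup>+s. ennreal (norm (U (\<gamma> s) s)) \<partial>?M)"
  proof (rule nn_integral_mono)
    fix s
    have "0 \<le> ?K s" using \<beta> by simp
    then show "ennreal (- ?L s) \<le> ennreal (norm (U (\<gamma> s) s))"
      unfolding lagrangian_def by (intro ennreal_leI) simp
  qed
  also have "\<dots> < \<infinity>" using Ui by (simp add: integrable_iff_bounded)
  finally have B: "(\<integral>\<^sup>+s. ennreal (- ?L s) \<partial>?M) < \<infinity>" .
  have A: "(\<integral>\<^sup>+s. ennreal (?L s) \<partial>?M) \<noteq> \<infinity>"
  proof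
    assume "(\<integral>\<^sup>+s. ennreal (?L s) \<partial>?M) = \<infinity>"
    then have "action \<beta> U a b \<gamma> = \<infinity> - enn2ereal (\<integral>\<^sup>+s. ennreal (- ?L s) \<partial>?M)"
      unfolding action_def set_nn_integral_lebesgue_on by simp
    moreover have "enn2ereal (\<integral>\<^sup>+s. ennreal (- ?L s) \<partial>?M) \<noteq> \<infinity>"
      using B by (cases "\<integral>\<^sup>+s. ennreal (- ?L s) \<partial>?M" rule: ennreal_cases) (auto simp: enn2ereal_ennreal)
    ultimately show False using fin by simp
  qed
  have "integrable ?M ?L" using Lm A B unfolding real_integrable_def by auto
  then have "integrable ?M (\<lambda>s. ?L s + U (\<gamma> s) s)" by (rule Bochner_Integration.integrable_add[OF _ Ui])
  then have "integrable ?M (\<lambda>s. \<beta> * (?L s + U (\<gamma> s) s))" by (rule integrable_mult_right)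
  moreover have "\<beta> * (?L s + U (\<gamma> s) s) = norm (velocity a b \<gamma> s) powr \<beta>" for s
    using \<beta> by (simp add: lagrangian_def)
  ultimately have "(\<lambda>s. norm (velocity a b \<gamma> s) powr \<beta>) absolutely_integrable_on {a..b}"
    by (simp add: integrable_restrict_space set_integrable_def)
  then show ?thesis by (rule set_lebesgue_integral_eq_integral(1))
qed

section \<open>Projection to one coordinate and lifting of competitors\<close>

lemma abs_continuous_on_velocity:
  fixes \<gamma> :: "real \<Rightarrow> 'a::euclidean_space"
  assumes ac: "abs_continuous_on a b \<gamma>" and "a \<le> b"
  obtains N where "negligible N" "a \<in> N" "b \<in> N"
    "\<And>s. s \<in> {a..b} - N \<Longrightarrow> (\<gamma> has_vector_derivative velocity a b \<gamma> s) (at s)"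
    "\<And>c d. a \<le> c \<Longrightarrow> c \<le> d \<Longrightarrow> d \<le> b \<Longrightarrow> (velocity a b \<gamma> has_integral (\<gamma> d - \<gamma> c)) {c..d}"
proof -
  obtain N where N: "negligible N" "a \<in> N" "b \<in> N"
    "\<And>s. s \<in> {a..b} - N \<Longrightarrow> (\<gamma> has_vector_derivative vector_derivative \<gamma> (at s)) (at s)"
    by (rule abs_continuous_on_differentiable_ae[OF assms]) blast
  have der: "(\<gamma> has_vector_derivative velocity a b \<gamma> s) (at s)" if s: "s \<in> {a..b} - N" for s
  proof -
    have "a < s" "s < b" using s N(2,3) by (auto simp: order.order_iff_strict)
    then have "velocity a b \<gamma> s = vector_derivative \<gamma> (at s)"
      by (simp add: velocity_def at_within_Icc_at)
    then show ?thesis using N(4)[OF s] by simp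
  qed
  have vi: "(velocity a b \<gamma> has_integral (\<gamma> d - \<gamma> c)) {c..d}" if "a \<le> c" "c \<le> d" "d \<le> b" for c d
  proof (rule abs_continuous_on_has_integral[OF abs_continuous_on_subset[OF ac that(1,3)] that(2) N(1)])
    fix s assume "s \<in> {c..d} - N"
    then have "s \<in> {a..b} - N" using that(1,3) by auto
    then show "(\<gamma> has_vector_derivative velocity a b \<gamma> s) (at s within {c..d})"
      by (rule has_vector_derivative_at_within[OF der])
  qed
  show ?thesis by (rule that[OF N(1-3) der vi])
qed

text \<open>Potentials depending on one coordinate only: the orthogonal components of the velocity only
  increase the action, which reduces the problem to dimension one.\<close>

lemma traj_of_curve:
  fixes \<gamma> :: "real \<Rightarrow> 'a::euclidean_space"
  assumes \<beta>: "1 < \<beta>" and W: "continuous_on UNIV (\<lambda>(x, t). W x t)" and e: "norm e = 1"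
    and ac: "abs_continuous_on a b \<gamma>" and "a \<le> b"
    and fin: "action \<beta> (\<lambda>x t. W (e \<bullet> x) t) a b \<gamma> < \<infinity>"
  shows "(\<lambda>s. norm (velocity a b \<gamma> s) powr \<beta>) integrable_on {a..b}"
    "traj \<beta> a b (\<lambda>s. e \<bullet> \<gamma> s) (\<lambda>s. e \<bullet> velocity a b \<gamma> s)"
    "ereal (act \<beta> W a b (\<lambda>s. e \<bullet> \<gamma> s) (\<lambda>s. e \<bullet> velocity a b \<gamma> s)) \<le> action \<beta> (\<lambda>x t. W (e \<bullet> x) t) a b \<gamma>"
proof -
  obtain N where vi: "\<And>c d. a \<le> c \<Longrightarrow> c \<le> d \<Longrightarrow> d \<le> b \<Longrightarrow> (velocity a b \<gamma> has_integral (\<gamma> d - \<gamma> c)) {c..d}"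
    by (rule abs_continuous_on_velocity[OF ac \<open>a \<le> b\<close>]) blast
  have U: "continuous_on {a..b} (\<lambda>s. W (e \<bullet> \<gamma> s) s)"
    by (intro continuous_on_along_path[OF W] continuous_intros abs_continuous_on_imp_continuous_on[OF ac])
  have m: "velocity a b \<gamma> \<in> borel_measurable (lebesgue_on {a..b})"
    using vi[of a b] \<open>a \<le> b\<close> by (intro integrable_imp_measurable has_integral_integrable) auto
  show k: "(\<lambda>s. norm (velocity a b \<gamma> s) powr \<beta>) integrable_on {a..b}"
    by (rule integrable_of_action_finite[OF \<beta> _ m fin]) (rule U)
  have le: "\<bar>e \<bullet> velocity a b \<gamma> s\<bar> powr \<beta> \<le> norm (velocity a b \<gamma> s) powr \<beta>" for s
    using Cauchy_Schwarz_ineq2[of e "velocity a b \<gamma> s"] e \<beta> by (intro powr_mono2) auto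
  show tr: "traj \<beta> a b (\<lambda>s. e \<bullet> \<gamma> s) (\<lambda>s. e \<bullet> velocity a b \<gamma> s)"
    unfolding traj_def
  proof (intro conjI ballI)
    fix s assume "s \<in> {a..b}"
    then have "(velocity a b \<gamma> has_integral (\<gamma> s - \<gamma> a)) {a..s}" by (intro vi) auto
    from has_integral_linear[OF this bounded_linear_inner_right[of e]]
    show "((\<lambda>s. e \<bullet> velocity a b \<gamma> s) has_integral (e \<bullet> \<gamma> s - e \<bullet> \<gamma> a)) {a..s}"
      by (simp add: o_def inner_diff_right)
  next
    show "(\<lambda>s. \<bar>e \<bullet> velocity a b \<gamma> s\<bar> powr \<beta>) integrable_on {a..b}"
    proof (rule measurable_bounded_by_integrable_imp_integrable[OF _ k])
      show "(\<lambda>s. \<bar>e \<bullet> velocity a b \<gamma> s\<bar> powr \<beta>) \<in> borel_measurable (lebesgue_on {a..b})"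
        using m by measurable
    qed (use le in auto)
  qed
  note fi = action_finite[where U = "\<lambda>x t. W (e \<bullet> x) t", OF \<beta> U k]
  have "act \<beta> W a b (\<lambda>s. e \<bullet> \<gamma> s) (\<lambda>s. e \<bullet> velocity a b \<gamma> s) \<le>
     integral {a..b} (lagrangian \<beta> (\<lambda>x t. W (e \<bullet> x) t) a b \<gamma>)"
    unfolding act_def
  proof (rule integral_le[OF act_integrable(3)[OF tr W] fi(1)])
    fix s assume "s \<in> {a..b}"
    show "1 / \<beta> * \<bar>e \<bullet> velocity a b \<gamma> s\<bar> powr \<beta> - W (e \<bullet> \<gamma> s) s \<le> lagrangian \<beta> (\<lambda>x t. W (e \<bullet> x) t) a b \<gamma> s"
      unfolding lagrangian_def using le[of s] \<beta> by (intro diff_right_mono mult_left_mono) auto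
  qed
  then show "ereal (act \<beta> W a b (\<lambda>s. e \<bullet> \<gamma> s) (\<lambda>s. e \<bullet> velocity a b \<gamma> s)) \<le> action \<beta> (\<lambda>x t. W (e \<bullet> x) t) a b \<gamma>"
    unfolding fi(2) by simp
qed

text \<open>The lifted curve runs on a line parallel to \<open>e\<close>, so its speed is that of
  \<open>h\<close> and no action is lost in orthogonal directions.\<close>

lemma curve_of_competitor:
  fixes x0 e :: "'a::euclidean_space"
  assumes \<beta>: "1 < \<beta>" and W: "continuous_on UNIV (\<lambda>(x, t). W x t)" and e: "norm e = 1" "e \<bullet> x0 = 0"
    and c: "competitor \<beta> a b h v" and "a \<le> b"
  defines "\<eta> \<equiv> (\<lambda>s. x0 + h s *\<^sub>R e)"
  shows "abs_continuous_on a b \<eta>" "action \<beta> (\<lambda>x t. W (e \<bullet> x) t) a b \<eta> = ereal (act \<beta> W a b h v)"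
proof -
  obtain S L where tr: "traj \<beta> a b h v" and S: "finite S" "\<And>s. s \<in> {a<..<b} - S \<Longrightarrow> (h has_real_derivative v s) (at s)"
    and L: "L-lipschitz_on {a..b} h" using c unfolding competitor_def by blast
  show ac: "abs_continuous_on a b \<eta>"
    by (rule abs_continuous_on_dominated[OF lipschitz_imp_abs_continuous_on[OF L]])
      (simp add: \<eta>_def scaleR_diff_left[symmetric] e)
  have ee: "e \<bullet> e = 1" using e(1) by (simp add: norm_eq_1)
  have eh: "e \<bullet> \<eta> s = h s" for s by (simp add: \<eta>_def inner_add_right e ee)
  have vel: "velocity a b \<eta> s = v s *\<^sub>R e" if s: "s \<in> {a..b} - (S \<union> {a, b})" for s
  proof -
    have ab: "a < s" "s < b" using s by (auto simp: order.order_iff_strict)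
    have "(h has_real_derivative v s) (at s)" using S(2)[of s] s ab by auto
    then have "(\<eta> has_vector_derivative v s *\<^sub>R e) (at s)"
      unfolding \<eta>_def by (auto intro!: derivative_eq_intros simp: has_real_derivative_iff_has_vector_derivative)
    then show ?thesis using ab by (simp add: velocity_def at_within_Icc_at vector_derivative_at)
  qed
  have neg: "negligible (S \<union> {a, b})" using S(1) by (intro negligible_finite) auto
  have U: "continuous_on {a..b} (\<lambda>s. W (e \<bullet> \<eta> s) s)"
    unfolding eh by (intro continuous_on_along_path[OF W] traj_continuous[OF tr])
  have "(\<lambda>s. \<bar>v s\<bar> powr \<beta>) integrable_on {a..b}" using tr by (simp add: traj_def)
  then have k: "(\<lambda>s. norm (velocity a b \<eta> s) powr \<beta>) integrable_on {a..b}"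
    by (rule integrable_spike[OF _ neg]) (simp add: vel e)
  have "act \<beta> W a b h v = integral {a..b} (lagrangian \<beta> (\<lambda>x t. W (e \<bullet> x) t) a b \<eta>)"
    unfolding act_def by (rule integral_spike[OF neg]) (simp add: lagrangian_def vel e eh)
  then show "action \<beta> (\<lambda>x t. W (e \<bullet> x) t) a b \<eta> = ereal (act \<beta> W a b h v)"
    using action_finite(2)[where U = "\<lambda>x t. W (e \<bullet> x) t", OF \<beta> U k] by simp
qed

text \<open>Projection does not raise the action and lifting preserves it. A competitor ending at
  \<open>e \<bullet> x\<close> is lifted to the line through \<open>x\<close> in direction
  \<open>e\<close>, so that its lift ends at \<open>x\<close>; the constant competitor shows that
  the minimal action is finite.\<close>

lemma minimizer_imp_minimal_traj:
  fixes \<gamma> :: "real \<Rightarrow> 'a::euclidean_space"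
  assumes \<beta>: "1 < \<beta>" and W: "continuous_on UNIV (\<lambda>(x, t). W x t)" and e: "norm e = 1" and "a \<le> b"
    and min: "is_minimizer \<beta> (\<lambda>x t. W (e \<bullet> x) t) a b x \<gamma>"
  shows "action \<beta> (\<lambda>x t. W (e \<bullet> x) t) a b \<gamma> < \<infinity>"
    "minimal_traj \<beta> W a b (\<lambda>s. e \<bullet> \<gamma> s) (\<lambda>s. e \<bullet> velocity a b \<gamma> s)"
proof -
  have ac: "abs_continuous_on a b \<gamma>" and x: "\<gamma> b = x" using min by (auto simp: is_minimizer_def)
  have ee: "e \<bullet> e = 1" using e(1) by (simp add: norm_eq_1)
  have le: "action \<beta> (\<lambda>x t. W (e \<bullet> x) t) a b \<gamma> \<le> ereal (act \<beta> W a b h v)"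
    if c: "competitor \<beta> a b h v" and hb: "h b = e \<bullet> x" for h v
  proof -
    define x0 where "x0 = x - (e \<bullet> x) *\<^sub>R e"
    have x0: "e \<bullet> x0 = 0" by (simp add: x0_def inner_diff_right ee)
    note cc = curve_of_competitor[OF \<beta> W e x0 c \<open>a \<le> b\<close>]
    have "x0 + h b *\<^sub>R e = x" by (simp add: x0_def hb)
    then show ?thesis using min cc unfolding is_minimizer_def by metis
  qed
  have "action \<beta> (\<lambda>x t. W (e \<bullet> x) t) a b \<gamma> \<le> ereal (act \<beta> W a b (\<lambda>_. e \<bullet> x) (\<lambda>_. 0))"
    by (rule le[OF competitor_const[OF \<beta>]]) simp
  then show fin: "action \<beta> (\<lambda>x t. W (e \<bullet> x) t) a b \<gamma> < \<infinity>"
    by (metis ereal_infty_less(1) le_less_trans less_ereal.simps(4))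
  note tc = traj_of_curve[OF \<beta> W e ac \<open>a \<le> b\<close> fin]
  show "minimal_traj \<beta> W a b (\<lambda>s. e \<bullet> \<gamma> s) (\<lambda>s. e \<bullet> velocity a b \<gamma> s)"
    unfolding minimal_traj_def
  proof (intro conjI allI impI tc(2))
    fix h' v' assume "competitor \<beta> a b h' v' \<and> h' b = e \<bullet> \<gamma> b"
    then have "action \<beta> (\<lambda>x t. W (e \<bullet> x) t) a b \<gamma> \<le> ereal (act \<beta> W a b h' v')"
      using le x by blast
    from order_trans[OF tc(3) this]
    show "act \<beta> W a b (\<lambda>s. e \<bullet> \<gamma> s) (\<lambda>s. e \<bullet> velocity a b \<gamma> s) \<le> act \<beta> W a b h' v'"
      by simp
  qed
qed

section \<open>Straight motion at the end, and conclusion\<close>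

text \<open>\<open>P\<close> is the gradient of \<open>norm w powr \<beta> / \<beta>\<close>; the
  claim is its tangent inequality with strict convexity. For \<open>w = 0\<close> the convention
  \<open>0 powr _ = 0\<close> gives the correct value \<open>P = 0\<close>, also when \<beta> < 2.
  Equality forces equal norms by the scalar Young inequality and equal directions by
  Cauchy-Schwarz.\<close>

lemma vector_powr_Young:
  fixes v w :: "'a::real_inner"
  assumes \<beta>: "1 < \<beta>"
  defines "P \<equiv> norm w powr (\<beta> - 2) *\<^sub>R w"
  shows "1 / \<beta> * norm w powr \<beta> + P \<bullet> (v - w) \<le> 1 / \<beta> * norm v powr \<beta>"
    "1 / \<beta> * norm w powr \<beta> + P \<bullet> (v - w) = 1 / \<beta> * norm v powr \<beta> \<Longrightarrow> v = w"
proof -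
  have Pw: "P \<bullet> w = norm w powr \<beta>"
  proof (cases "w = 0")
    case False
    have "P \<bullet> w = norm w powr (\<beta> - 2) * norm w powr 2"
      using False by (simp add: P_def power2_norm_eq_inner[symmetric])
    also have "\<dots> = norm w powr \<beta>" unfolding powr_add[symmetric] by simp
    finally show ?thesis .
  qed (simp add: P_def)
  have nP: "norm P = norm w powr (\<beta> - 1)"
  proof (cases "w = 0")
    case False
    have "norm P = norm w powr (\<beta> - 2) * norm w powr 1" using False by (simp add: P_def)
    also have "\<dots> = norm w powr (\<beta> - 1)" unfolding powr_add[symmetric] by simp
    finally show ?thesis .
  qed (simp add: P_def)
  have CS: "P \<bullet> v \<le> norm w powr (\<beta> - 1) * norm v"
    using norm_cauchy_schwarz[of P v] by (simp add: nP)
  note Y = powr_Young[OF \<beta> norm_ge_zero[of w] norm_ge_zero[of v]]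
  have eq: "1 / \<beta> * norm w powr \<beta> + P \<bullet> (v - w) = P \<bullet> v - (1 - 1 / \<beta>) * norm w powr \<beta>"
    by (simp add: inner_diff_right Pw algebra_simps)
  show "1 / \<beta> * norm w powr \<beta> + P \<bullet> (v - w) \<le> 1 / \<beta> * norm v powr \<beta>"
    unfolding eq using CS Y(1) by linarith
  assume "1 / \<beta> * norm w powr \<beta> + P \<bullet> (v - w) = 1 / \<beta> * norm v powr \<beta>"
  then have Pv: "P \<bullet> v = norm w powr (\<beta> - 1) * norm v"
    and "norm w powr (\<beta> - 1) * norm v = (1 - 1 / \<beta>) * norm w powr \<beta> + 1 / \<beta> * norm v powr \<beta>"
    unfolding eq using CS Y(1) by linarith+
  then have n: "norm w = norm v" by (intro Y(2))
  have PV: "P \<bullet> v = norm P * norm v" by (simp add: nP Pv)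
  show "v = w"
  proof (cases "w = 0")
    case True then show ?thesis using n by simp
  next
    case False
    then have "w \<bullet> v = norm w * norm v" using PV by (simp add: P_def)
    then have "norm w *\<^sub>R v = norm v *\<^sub>R w" by (simp add: norm_cauchy_schwarz_eq)
    then show ?thesis using n False by auto
  qed
qed

text \<open>On an interval without potential a minimizer moves along a straight line; comparing it with the
  segment joining its endpoints forces equality in Young's inequality almost everywhere.\<close>

lemma minimizer_velocity_end:
  fixes \<gamma> :: "real \<Rightarrow> 'a::euclidean_space"
  assumes \<beta>: "1 < \<beta>" and U: "continuous_on UNIV (\<lambda>(x, t). U x t)" and "a < - 1"
    and U0: "\<And>x t. - 1 \<le> t \<Longrightarrow> U x t = 0"
    and min: "is_minimizer \<beta> U a 0 x \<gamma>"
    and k: "(\<lambda>s. norm (velocity a 0 \<gamma> s) powr \<beta>) integrable_on {a..0}"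
  shows "velocity a 0 \<gamma> 0 = \<gamma> 0 - \<gamma> (- 1)"
proof -
  define w where "w = \<gamma> 0 - \<gamma> (- 1)"
  \<comment> \<open>Only the last unit of time is altered, so the actions on \<open>[a, -1]\<close>
    agree and comparing them reduces to kinetic energies on \<open>[-1, 0]\<close>.\<close>
  define \<eta> where "\<eta> = (\<lambda>s. if s \<le> - 1 then \<gamma> s else \<gamma> (- 1) + (s + 1) *\<^sub>R w)"
  have ac: "abs_continuous_on a 0 \<gamma>" and x: "\<gamma> 0 = x" using min by (auto simp: is_minimizer_def)
  have path: "continuous_on A (\<lambda>s. U (c s) s)" if "continuous_on A c" for A c
  proof -
    have "continuous_on A (\<lambda>s. (\<lambda>(x, t). U x t) (c s, s))"
      by (intro continuous_on_compose2[OF U] continuous_intros that) auto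
    then show ?thesis by simp
  qed
  have seg: "(\<lambda>s. \<gamma> (- 1) + (s + 1) *\<^sub>R w) = (\<lambda>s. (\<gamma> (- 1) + w) + s *\<^sub>R w)"
    by (simp add: fun_eq_iff algebra_simps)
  have "(norm w)-lipschitz_on {- 1..0} (\<lambda>s. \<gamma> (- 1) + (s + 1) *\<^sub>R w)"
    by (rule lipschitz_onI) (simp_all add: seg dist_norm scaleR_diff_left[symmetric] mult.commute)
  then have acs: "abs_continuous_on (- 1) 0 (\<lambda>s. \<gamma> (- 1) + (s + 1) *\<^sub>R w)"
    by (rule lipschitz_imp_abs_continuous_on)
  have ac\<eta>: "abs_continuous_on a 0 \<eta>"
    unfolding \<eta>_def using \<open>a < - 1\<close>
    by (intro abs_continuous_on_glue[OF abs_continuous_on_subset[OF ac] acs]) auto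
  have \<eta>0: "\<eta> 0 = x" by (simp add: \<eta>_def w_def x)
  have a0: "a \<le> 0" using \<open>a < - 1\<close> by simp
  obtain N where N: "negligible N" "a \<in> N" "0 \<in> N"
    "\<And>s. s \<in> {a..0} - N \<Longrightarrow> (\<gamma> has_vector_derivative velocity a 0 \<gamma> s) (at s)"
    "\<And>c d. a \<le> c \<Longrightarrow> c \<le> d \<Longrightarrow> d \<le> 0 \<Longrightarrow> (velocity a 0 \<gamma> has_integral (\<gamma> d - \<gamma> c)) {c..d}"
    by (rule abs_continuous_on_velocity[OF ac a0]) (rule that; assumption)
  have N1: "negligible (insert (- 1) N)" using N(1) by simp
  have vel_at: "velocity a 0 \<eta> s = y" if "(\<eta> has_vector_derivative y) (at s)" "a < s" "s < 0" for s y
    using that by (simp add: velocity_def at_within_Icc_at vector_derivative_at)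
  have vl: "velocity a 0 \<eta> s = velocity a 0 \<gamma> s" if s: "s \<in> {a..- 1} - insert (- 1) N" for s
  proof (rule vel_at)
    have "s \<noteq> a" using s N(2) by auto
    then show "a < s" "s < 0" using s by auto
    have "(\<gamma> has_vector_derivative velocity a 0 \<gamma> s) (at s)" using s by (intro N(4)) auto
    then show "(\<eta> has_vector_derivative velocity a 0 \<gamma> s) (at s)"
      by (rule has_vector_derivative_transform_within_open[of _ _ _ "{..<- 1}"])
        (use s in \<open>auto simp: \<eta>_def\<close>)
  qed
  have vr: "velocity a 0 \<eta> s = w" if s: "s \<in> {- 1..0} - {- 1, 0}" for s
  proof (rule vel_at)
    show "a < s" "s < 0" using s \<open>a < - 1\<close> by auto
    have "((\<lambda>s. \<gamma> (- 1) + (s + 1) *\<^sub>R w) has_vector_derivative w) (at s)"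
      by (auto intro!: derivative_eq_intros)
    then show "(\<eta> has_vector_derivative w) (at s)"
      by (rule has_vector_derivative_transform_within_open[of _ _ _ "{- 1<..}"])
        (use s in \<open>auto simp: \<eta>_def\<close>)
  qed
  have kl: "(\<lambda>s. norm (velocity a 0 \<gamma> s) powr \<beta>) integrable_on {a..- 1}"
    and kr: "(\<lambda>s. norm (velocity a 0 \<gamma> s) powr \<beta>) integrable_on {- 1..0}"
    using \<open>a < - 1\<close> by (auto intro: integrable_on_subinterval[OF k])
  have k1: "(\<lambda>s. norm (velocity a 0 \<eta> s) powr \<beta>) integrable_on {a..- 1}"
    by (rule integrable_spike[OF kl N1]) (simp add: vl)
  have k2: "(\<lambda>s. norm (velocity a 0 \<eta> s) powr \<beta>) integrable_on {- 1..0}"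
    by (rule integrable_spike[OF integrable_const_ivl, of "{- 1, 0}" _ _ _ "norm w powr \<beta>"]) (simp_all add: vr)
  have k\<eta>: "(\<lambda>s. norm (velocity a 0 \<eta> s) powr \<beta>) integrable_on {a..0}"
    by (rule Henstock_Kurzweil_Integration.integrable_combine[OF _ _ k1 k2]) (use \<open>a < - 1\<close> in auto)
  note f\<gamma> = action_finite[where U = U, OF \<beta> path[OF abs_continuous_on_imp_continuous_on[OF ac]] k]
  note f\<eta> = action_finite[where U = U, OF \<beta> path[OF abs_continuous_on_imp_continuous_on[OF ac\<eta>]] k\<eta>]
  have "integral {a..0} (lagrangian \<beta> U a 0 \<gamma>) \<le> integral {a..0} (lagrangian \<beta> U a 0 \<eta>)"
    using min ac\<eta> \<eta>0 f\<gamma>(2) f\<eta>(2) unfolding is_minimizer_def by (metis ereal_less_eq(3))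
  moreover have "integral {a..- 1} f + integral {- 1..0} f = integral {a..0} f"
    if "f integrable_on {a..0}" for f :: "real \<Rightarrow> real"
    using \<open>a < - 1\<close> that by (intro Henstock_Kurzweil_Integration.integral_combine) auto
  moreover have "integral {a..- 1} (lagrangian \<beta> U a 0 \<gamma>) = integral {a..- 1} (lagrangian \<beta> U a 0 \<eta>)"
    by (rule integral_spike[OF N1]) (simp add: lagrangian_def vl, simp add: \<eta>_def)
  ultimately have "integral {- 1..0} (lagrangian \<beta> U a 0 \<gamma>) \<le> integral {- 1..0} (lagrangian \<beta> U a 0 \<eta>)"
    using f\<gamma>(1) f\<eta>(1) by (metis add_le_cancel_left)
  also have "\<dots> = integral {- 1..0 :: real} (\<lambda>s. 1 / \<beta> * norm w powr \<beta>)"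
    by (rule integral_spike[of "{- 1, 0 :: real}"]) (simp_all add: lagrangian_def vr U0)
  finally have le: "integral {- 1..0} (\<lambda>s. 1 / \<beta> * norm (velocity a 0 \<gamma> s) powr \<beta>) \<le> 1 / \<beta> * norm w powr \<beta>"
    by (subst integral_cong[of _ _ "lagrangian \<beta> U a 0 \<gamma>"]) (simp_all add: lagrangian_def U0)
  define P where "P = norm w powr (\<beta> - 2) *\<^sub>R w"
  \<comment> \<open>The deficit in Young's inequality. Its linear term integrates to 0 because the
    velocity has mean \<open>w\<close> on \<open>[-1, 0]\<close>, so minimality makes the integral
    of this nonnegative function at most 0.\<close>
  define F where "F = (\<lambda>s. 1 / \<beta> * norm (velocity a 0 \<gamma> s) powr \<beta> - (1 / \<beta> * norm w powr \<beta> + P \<bullet> (velocity a 0 \<gamma> s - w)))"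
  have F0: "0 \<le> F s" "F s = 0 \<Longrightarrow> velocity a 0 \<gamma> s = w" for s
    using vector_powr_Young[OF \<beta>, of w "velocity a 0 \<gamma> s"] by (auto simp: F_def P_def)
  have "(velocity a 0 \<gamma> has_integral w) {- 1..0}"
    using N(5)[of "- 1" 0] \<open>a < - 1\<close> by (simp add: w_def)
  from has_integral_diff[OF this has_integral_const_real[of w "- 1" 0]]
  have "((\<lambda>s. velocity a 0 \<gamma> s - w) has_integral 0) {- 1..0}" by simp
  from has_integral_linear[OF this bounded_linear_inner_right[of P]]
  have "((\<lambda>s. P \<bullet> (velocity a 0 \<gamma> s - w)) has_integral 0) {- 1..0}" by (simp add: o_def)
  from has_integral_add[OF has_integral_const_real[of "1 / \<beta> * norm w powr \<beta>" "- 1" 0] this]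
  have "((\<lambda>s. 1 / \<beta> * norm w powr \<beta> + P \<bullet> (velocity a 0 \<gamma> s - w)) has_integral 1 / \<beta> * norm w powr \<beta>) {- 1..0}"
    by simp
  from has_integral_diff[OF integrable_integral[OF integrable_on_mult_right[OF kr, of "1 / \<beta>"]] this]
  have Fi: "(F has_integral (integral {- 1..0} (\<lambda>s. 1 / \<beta> * norm (velocity a 0 \<gamma> s) powr \<beta>) - 1 / \<beta> * norm w powr \<beta>)) {- 1..0}"
    unfolding F_def .
  then have "integral {- 1..0} F \<le> 0" using le by (simp add: integral_unique)
  moreover have Fint: "F integrable_on {- 1..0}" using Fi by (rule has_integral_integrable)
  moreover have "0 \<le> integral {- 1..0} F" using Fint F0 by (intro integral_nonneg) auto
  ultimately have I0: "integral {- 1..0} F = 0" by simp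
  have Fabs: "F absolutely_integrable_on {- 1..0}"
    using Fint F0 by (intro nonnegative_absolutely_integrable_1) auto
  have "integrable (lebesgue_on {- 1..0}) F"
    using Fabs by (simp add: integrable_restrict_space set_integrable_def)
  moreover have "integral\<^sup>L (lebesgue_on {- 1..0}) F = 0"
    using set_lebesgue_integral_eq_integral(2)[OF Fabs] I0
    by (simp add: integral_restrict_space set_lebesgue_integral_def)
  ultimately have "AE s in lebesgue_on {- 1..0}. F s = 0"
    using F0 by (subst (asm) integral_nonneg_eq_0_iff_AE) auto
  then have "AE s in lebesgue. s \<in> {- 1..0} \<longrightarrow> F s = 0"
    by (subst (asm) AE_restrict_space_iff) auto
  then obtain Z where sub: "{s \<in> space lebesgue. \<not> (s \<in> {- 1..0} \<longrightarrow> F s = 0)} \<subseteq> Z"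
    and null: "emeasure lebesgue Z = 0" "Z \<in> sets lebesgue"
    by (rule AE_E)
  have Z: "negligible Z" using null by (simp add: negligible_iff_null_sets null_setsI)
  have vw: "velocity a 0 \<gamma> s = w" if "s \<in> {- 1..0} - Z" for s
  proof -
    have "s \<in> space lebesgue" by simp
    then have "F s = 0" using sub that by blast
    then show "velocity a 0 \<gamma> s = w" by (rule F0(2))
  qed
  \<comment> \<open>Equality almost everywhere says nothing about the single time 0. Integrating the
    velocity again gives the curve at every time of \<open>[-1, 0]\<close>, and with it the
    one-sided derivative at the endpoint.\<close>
  have line: "\<gamma> s = \<gamma> (- 1) + (s + 1) *\<^sub>R w" if s: "s \<in> {- 1..0}" for s
  proof -
    have "(velocity a 0 \<gamma> has_integral (\<gamma> s - \<gamma> (- 1))) {- 1..s}"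
      using s \<open>a < - 1\<close> by (intro N(5)) auto
    then have "((\<lambda>_. w) has_integral (\<gamma> s - \<gamma> (- 1))) {- 1..s}"
      by (rule has_integral_spike[OF Z, rotated]) (use s vw in auto)
    moreover have "((\<lambda>_. w) has_integral (s + 1) *\<^sub>R w) {- 1..s}"
      using has_integral_const_real[of w "- 1" s] s by (simp add: algebra_simps)
    ultimately have "\<gamma> s - \<gamma> (- 1) = (s + 1) *\<^sub>R w" by (rule has_integral_unique)
    then show ?thesis by (simp add: algebra_simps)
  qed
  have "((\<lambda>s. \<gamma> (- 1) + (s + 1) *\<^sub>R w) has_vector_derivative w) (at 0 within {a..0})"
    by (auto intro!: derivative_eq_intros)
  then have "(\<gamma> has_vector_derivative w) (at 0 within {a..0})"
  proof (rule has_vector_derivative_transform_within[where d = 1])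
    fix s assume "s \<in> {a..0}" "dist s 0 < 1"
    then show "\<gamma> (- 1) + (s + 1) *\<^sub>R w = \<gamma> s" by (intro line[symmetric]) (auto simp: dist_real_def)
  qed (use \<open>a < - 1\<close> in auto)
  then show ?thesis
    using \<open>a < - 1\<close> unfolding velocity_def w_def[symmetric]
    by (intro vector_derivative_within) (auto simp: trivial_limit_within)
qed

theorem theorem3:
  fixes \<beta> C :: real
  assumes "\<beta> > 1" and "C > 0"
  shows "\<exists>(U :: real ^ 'd \<Rightarrow> real \<Rightarrow> real) (DU :: real ^ 'd \<Rightarrow> real \<Rightarrow> real ^ 'd).
    (\<lambda>(x, t). U x t) \<in> borel_measurable (restrict_space borel (UNIV \<times> {..<0})) \<and>
    (\<forall>t<0. (\<forall>x. GDERIV (\<lambda>y. U y t) x :> DU x t) \<and> continuous_on UNIV (\<lambda>x. DU x t)) \<and>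
    (\<forall>x. \<forall>t<0. 0 \<le> U x t \<and> U x t \<le> C \<and> norm (DU x t) \<le> C) \<and>
    (\<forall>x. continuous_on {..<0} (\<lambda>t. U x t)) \<and>
    (\<forall>x. \<forall>\<gamma> :: real \<Rightarrow> real \<Rightarrow> real ^ 'd.
       (\<forall>t<0. is_minimizer \<beta> U t 0 x (\<gamma> t)) \<longrightarrow>
       Limsup at_bot (\<lambda>t. ereal (norm (velocity t 0 (\<gamma> t) 0))) = \<infinity>)"
proof -
  obtain W DW :: "real \<Rightarrow> real \<Rightarrow> real" and T :: "nat \<Rightarrow> real" where
    W: "continuous_on UNIV (\<lambda>(x, t). W x t)"
    and DW: "\<And>x t. ((\<lambda>y. W y t) has_real_derivative DW x t) (at x)" "\<And>t. continuous_on UNIV (\<lambda>x. DW x t)"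
    and bd: "\<And>x t. 0 \<le> W x t" "\<And>x t. W x t \<le> C" "\<And>x t. \<bar>DW x t\<bar> \<le> C"
    and W0: "\<And>x t. - 1 \<le> t \<Longrightarrow> W x t = 0"
    and T: "\<And>n. real n + 1 \<le> T n"
    and far: "\<And>n h v. minimal_traj \<beta> W (- T n) 0 h v \<Longrightarrow> \<bar>h 0\<bar> \<le> real n \<Longrightarrow> real n \<le> h 0 - h (- 1)"
    by (rule exists_accelerating_potential[OF assms]) blast
  \<comment> \<open>Any unit vector would do: the potential depends only on the coordinate in this
    direction.\<close>
  define e :: "real ^ 'd" where "e = (SOME i. i \<in> Basis)"
  have e: "norm e = 1" by (simp add: e_def SOME_Basis)
  define U where "U = (\<lambda>x t. W (e \<bullet> x) t)"
  define DU where "DU = (\<lambda>x t. DW (e \<bullet> x) t *\<^sub>R e)"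
  have Uc: "continuous_on UNIV (\<lambda>(x, t). U x t)"
  proof -
    have "continuous_on UNIV (\<lambda>p::(real ^ 'd) \<times> real. (\<lambda>(x, t). W x t) (e \<bullet> fst p, snd p))"
      by (intro continuous_on_compose2[OF W] continuous_intros) auto
    then show ?thesis by (simp add: U_def case_prod_unfold)
  qed
  show ?thesis
  proof (intro exI[of _ U] exI[of _ DU] conjI allI impI)
    show "(\<lambda>(x, t). U x t) \<in> borel_measurable (restrict_space borel (UNIV \<times> {..<0}))"
      by (intro measurable_restrict_space1 borel_measurable_continuous_onI Uc)
    fix x :: "real ^ 'd" and t :: real
    have "((\<lambda>y. e \<bullet> y) has_derivative (\<lambda>h. e \<bullet> h)) (at x)"
      by (intro bounded_linear_imp_has_derivative bounded_linear_inner_right)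
    from DERIV_compose_FDERIV[OF DW(1) this]
    have "((\<lambda>y. W (e \<bullet> y) t) has_derivative (\<lambda>h. (e \<bullet> h) * DW (e \<bullet> x) t)) (at x)" .
    then show "GDERIV (\<lambda>y. U y t) x :> DU x t"
      by (simp add: gderiv_def U_def DU_def inner_commute mult.commute)
    show "continuous_on UNIV (\<lambda>x. DU x t)"
      unfolding DU_def by (intro continuous_intros continuous_on_compose2[OF DW(2)]) auto
    show "0 \<le> U x t" "U x t \<le> C" "norm (DU x t) \<le> C"
      using bd e by (auto simp: U_def DU_def)
    show "continuous_on {..<0} (\<lambda>t. U x t)"
      unfolding U_def by (intro continuous_on_along_path[OF W] continuous_intros)
  next
    fix x and \<gamma> :: "real \<Rightarrow> real \<Rightarrow> real ^ 'd"
    assume min: "\<forall>t<0. is_minimizer \<beta> U t 0 x (\<gamma> t)"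
    \<comment> \<open>The condition on \<open>norm x\<close> puts the endpoint into the range
      controlled by the block for \<open>n\<close>; \<open>0 < n\<close> gives
      \<open>T n > 1\<close>, so that the time \<open>-1\<close> is interior.\<close>
    have large: "real n \<le> norm (velocity (- T n) 0 (\<gamma> (- T n)) 0)" if n: "norm x \<le> real n" "0 < n" for n
    proof -
      let ?\<gamma> = "\<gamma> (- T n)"
      have Tn: "- T n < - 1" using T[of n] n by linarith
      have m: "is_minimizer \<beta> (\<lambda>x t. W (e \<bullet> x) t) (- T n) 0 x ?\<gamma>"
        using min Tn unfolding U_def by simp
      have ac: "abs_continuous_on (- T n) 0 ?\<gamma>" and x: "?\<gamma> 0 = x" using m by (auto simp: is_minimizer_def)
      have Tn0: "- T n \<le> 0" using Tn by simp
      note mt = minimizer_imp_minimal_traj[OF assms(1) W e Tn0 m]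
      have "\<bar>e \<bullet> ?\<gamma> 0\<bar> \<le> real n" using Cauchy_Schwarz_ineq2[of e x] e n x by simp
      from far[OF mt(2) this] have "real n \<le> e \<bullet> (?\<gamma> 0 - ?\<gamma> (- 1))" by (simp add: inner_diff_right)
      also have "\<dots> \<le> norm (?\<gamma> 0 - ?\<gamma> (- 1))"
        using norm_cauchy_schwarz[of e "?\<gamma> 0 - ?\<gamma> (- 1)"] e by simp
      also have "?\<gamma> 0 - ?\<gamma> (- 1) = velocity (- T n) 0 ?\<gamma> 0"
      proof (rule minimizer_velocity_end[symmetric, OF assms(1) Uc Tn])
        show "is_minimizer \<beta> U (- T n) 0 x ?\<gamma>" using m unfolding U_def .
        show "U x t = 0" if "- 1 \<le> t" for x t using that by (simp add: U_def W0)
        show "(\<lambda>s. norm (velocity (- T n) 0 ?\<gamma> s) powr \<beta>) integrable_on {- T n..0}"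
          by (rule traj_of_curve(1)[OF assms(1) W e ac Tn0 mt(1)])
      qed
      finally show ?thesis .
    qed
    have "ereal B \<le> Limsup at_bot (\<lambda>t. ereal (norm (velocity t 0 (\<gamma> t) 0)))" for B
      unfolding Limsup_def
    proof (rule INF_greatest, clarify)
      fix P assume "eventually P (at_bot :: real filter)"
      then obtain c where c: "\<And>t. t \<le> c \<Longrightarrow> P t" by (auto simp: eventually_at_bot_linorder)
      obtain n where n: "max (max (norm x) 1) (max B (- c)) < real n" using reals_Archimedean2 by blast
      \<comment> \<open>The sampling times tend to minus infinity because
        \<open>T n \<ge> n + 1\<close>.\<close>
      have "P (- T n)" using T[of n] n by (intro c) linarith
      have "B \<le> norm (velocity (- T n) 0 (\<gamma> (- T n)) 0)" using large[of n] n by force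
      then have "ereal B \<le> ereal (norm (velocity (- T n) 0 (\<gamma> (- T n)) 0))" by simp
      also have "\<dots> \<le> (SUP t\<in>Collect P. ereal (norm (velocity t 0 (\<gamma> t) 0)))"
        using \<open>P (- T n)\<close> by (intro SUP_upper) simp
      finally show "ereal B \<le> (SUP t\<in>Collect P. ereal (norm (velocity t 0 (\<gamma> t) 0)))" .
    qed
    then show "Limsup at_bot (\<lambda>t. ereal (norm (velocity t 0 (\<gamma> t) 0))) = \<infinity>"
      using ereal_top by blast
  qed
qed

end
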